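(* Let $i\in\{1,2\}$ and let $j\ge 2i$ be an integer. Let $G$ be a simple graph and let $\mathbf{c}=(\mathbf{c}_1,\mathbf{c}_2):V(G)\to\{-1,0,\dots,i\}\times\{-1,0,\dots,j\}$ be a capacity function such that $G$ is $\mathbf{c}$-critical. Then $$\rho(G,\mathbf{c})=\sum_{u\in V(G)}\bigl(i-j+1+\mathbf{c}_1(u)+\mathbf{c}_2(u)\bigr)-(i+1)|E(G)|\ \le\ i-j-1.$$
   Context: All graphs are finite. Let $G$ be a simple graph. A ($2$-fold) cover of $G$ is a pair $\mathscr{H}=(L,H)$ where $H$ is a graph and $L:V(G)\to 2^{V(H)}$ satisfies: (1) the sets $L(u)$, $u\in V(G)$, partition $V(H)$, and $|L(u)|=2$ for every $u$; (2) $H[L(u)]$ is complete for every $u\in V(G)$; (3) if there is an edge of $H$ between $L(u)$ and $L(v)$, then $u=v$ or $uv\in E(G)$; (4) for every $uv\in E(G)$, the edges of $H$ between $L(u)$ and $L(v)$ form a (possibly empty) matching. For each $u\in V(G)$ the two elements of $L(u)$ are labelled $L(u)=\{p(u),r(u)\}$ (the poor node and the rich node, respectively); the labelling is part of the cover. An $\mathscr{H}$-map is a function $\varphi:V(G)\to V(H)$ with $\varphi(v)\in L(v)$ for every $v\in V(G)$; $H_\varphi$ denotes the subgraph of $H$ induced by $\varphi(V(G))$. A capacity function on $G$ is a map $\mathbf{c}:V(G)\to\{-1,0,\dots,i\}\times\{-1,0,\dots,j\}$, written $\mathbf{c}(u)=(\mathbf{c}_1(u),\mathbf{c}_2(u))$.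 A $(\mathbf{c},\mathscr{H})$-coloring of $G$ is an $\mathscr{H}$-map $\varphi$ such that for each $u\in V(G)$: if $\varphi(u)=p(u)$ then the degree of $p(u)$ in $H_\varphi$ is at most $\mathbf{c}_1(u)$, and if $\varphi(u)=r(u)$ then the degree of $r(u)$ in $H_\varphi$ is at most $\mathbf{c}_2(u)$. (In particular, a node with capacity $-1$ can never be used.) $G$ is $\mathbf{c}$-colorable if it has a $(\mathbf{c},\mathscr{H})$-coloring for every $2$-fold cover $\mathscr{H}$ of $G$. $G$ is $\mathbf{c}$-critical if $G$ is not $\mathbf{c}$-colorable, but every proper subgraph $G'$ of $G$ is $\mathbf{c}|_{V(G')}$-colorable. *)

theory Defs
  imports Main "HOL-Library.Disjoint_Sets"
begin

record 'a ugraph =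
  verts :: "'a set"
  edges :: "'a set set"

definition simple_graph :: "'a ugraph \<Rightarrow> bool" where
  "simple_graph G \<longleftrightarrow> finite (verts G) \<and> (\<forall>e\<in>edges G. e \<subseteq> verts G \<and> card e = 2)"

definition proper_subgraph :: "'a ugraph \<Rightarrow> 'a ugraph \<Rightarrow> bool" where
  "proper_subgraph G' G \<longleftrightarrow>
     simple_graph G' \<and> verts G' \<subseteq> verts G \<and> edges G' \<subseteq> edges G \<and> G' \<noteq> G"

definition induced :: "'a ugraph \<Rightarrow> 'a set \<Rightarrow> 'a ugraph" where
  "induced G S = \<lparr>verts = verts G \<inter> S, edges = {e \<in> edges G. e \<subseteq> S}\<rparr>"

definition degree :: "'a ugraph \<Rightarrow> 'a \<Rightarrow> nat" where
  "degree G x = card {e \<in> edges G. x \<in> e}"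

definition complete_graph :: "'a ugraph \<Rightarrow> bool" where
  "complete_graph G \<longleftrightarrow> (\<forall>x\<in>verts G. \<forall>y\<in>verts G. x \<noteq> y \<longrightarrow> {x, y} \<in> edges G)"

definition edges_between :: "'a ugraph \<Rightarrow> 'a set \<Rightarrow> 'a set \<Rightarrow> 'a set set" where
  "edges_between G A B = {e \<in> edges G. \<exists>x\<in>A. \<exists>y\<in>B. e = {x, y}}"

definition is_matching :: "'a set set \<Rightarrow> bool" where
  "is_matching M \<longleftrightarrow> disjoint M"

record ('a, 'b) cover =
  fibre :: "'a \<Rightarrow> 'b set"
  host :: "'b ugraph"
  poor :: "'a \<Rightarrow> 'b"
  rich :: "'a \<Rightarrow> 'b"

definition cover_of :: "'a ugraph \<Rightarrow> ('a, 'b) cover \<Rightarrow> bool" where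
  "cover_of G C \<longleftrightarrow>
     simple_graph (host C) \<and>
     (\<Union>u\<in>verts G. fibre C u) = verts (host C) \<and>
     disjoint_family_on (fibre C) (verts G) \<and>
     (\<forall>u\<in>verts G. card (fibre C u) = 2 \<and> fibre C u = {poor C u, rich C u}) \<and>
     (\<forall>u\<in>verts G. complete_graph (induced (host C) (fibre C u))) \<and>
     (\<forall>u\<in>verts G. \<forall>v\<in>verts G.
        edges_between (host C) (fibre C u) (fibre C v) \<noteq> {} \<longrightarrow> u = v \<or> {u, v} \<in> edges G) \<and>
     (\<forall>u\<in>verts G. \<forall>v\<in>verts G. {u, v} \<in> edges G \<longrightarrow>
        is_matching (edges_between (host C) (fibre C u) (fibre C v)))"

definition cover_map :: "'a ugraph \<Rightarrow> ('a, 'b) cover \<Rightarrow> ('a \<Rightarrow> 'b) \<Rightarrow> bool" where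
  "cover_map G C \<phi> \<longleftrightarrow> (\<forall>v\<in>verts G. \<phi> v \<in> fibre C v)"

definition map_graph :: "'a ugraph \<Rightarrow> ('a, 'b) cover \<Rightarrow> ('a \<Rightarrow> 'b) \<Rightarrow> 'b ugraph" where
  "map_graph G C \<phi> = induced (host C) (\<phi> ` verts G)"

definition coloring :: "'a ugraph \<Rightarrow> ('a \<Rightarrow> int \<times> int) \<Rightarrow> ('a, 'b) cover \<Rightarrow> ('a \<Rightarrow> 'b) \<Rightarrow> bool" where
  "coloring G c C \<phi> \<longleftrightarrow> cover_map G C \<phi> \<and>
     (\<forall>u\<in>verts G.
        (\<phi> u = poor C u \<longrightarrow> int (degree (map_graph G C \<phi>) (poor C u)) \<le> fst (c u)) \<and>
        (\<phi> u = rich C u \<longrightarrow> int (degree (map_graph G C \<phi>) (rich C u)) \<le> snd (c u)))"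

text \<open>
  HOL cannot quantify over the type of nodes inside a formula. Covers of finite graphs are finite,
  so up to isomorphism their nodes are natural numbers; lemma \<open>colorable_any_cover\<close> below
  confirms that nothing is lost.
\<close>
definition colorable :: "'a ugraph \<Rightarrow> ('a \<Rightarrow> int \<times> int) \<Rightarrow> bool" where
  "colorable G c \<longleftrightarrow> (\<forall>C :: ('a, nat) cover. cover_of G C \<longrightarrow> (\<exists>\<phi>. coloring G c C \<phi>))"

text \<open>
  Only the values of \<open>c\<close> on the vertices of the graph matter in \<open>colorable\<close>, so
  the restriction of \<open>c\<close> to a subgraph is \<open>c\<close> itself.
\<close>
definition critical :: "'a ugraph \<Rightarrow> ('a \<Rightarrow> int \<times> int) \<Rightarrow> bool" where
  "critical G c \<longleftrightarrow> \<not> colorable G c \<and> (\<forall>G'. proper_subgraph G' G \<longrightarrow> colorable G' c)"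

definition capacity :: "int \<Rightarrow> int \<Rightarrow> 'a ugraph \<Rightarrow> ('a \<Rightarrow> int \<times> int) \<Rightarrow> bool" where
  "capacity i j G c \<longleftrightarrow> (\<forall>u\<in>verts G. c u \<in> {-1..i} \<times> {-1..j})"

definition potential :: "int \<Rightarrow> int \<Rightarrow> 'a ugraph \<Rightarrow> ('a \<Rightarrow> int \<times> int) \<Rightarrow> int" where
  "potential i j G c =
     (\<Sum>u\<in>verts G. i - j + 1 + fst (c u) + snd (c u)) - (i + 1) * int (card (edges G))"

lemma colorable_any_cover:
  fixes C :: "('a, 'b) cover"
  assumes col: "colorable G c" and C: "cover_of G C"
  shows "\<exists>\<phi>. coloring G c C \<phi>"
proof -
  let ?H = "host C"
  let ?V = "verts ?H"
  have sH: "simple_graph ?H" using C unfolding cover_of_def by (elim conjE)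
  then have fin: "finite ?V" and eV: "\<And>e. e \<in> edges ?H \<Longrightarrow> e \<subseteq> ?V" "\<And>e. e \<in> edges ?H \<Longrightarrow> card e = 2"
    by (auto simp: simple_graph_def)
  obtain f :: "'b \<Rightarrow> nat" where inj: "inj_on f ?V"
    using finite_imp_inj_to_nat_seg[OF fin] by blast
  have UV: "(\<Union>u\<in>verts G. fibre C u) = ?V"
    using C unfolding cover_of_def by (elim conjE)
  then have fibV: "fibre C u \<subseteq> ?V" if "u \<in> verts G" for u
    using that by blast
  have "\<forall>u\<in>verts G. card (fibre C u) = 2 \<and> fibre C u = {poor C u, rich C u}"
    using C unfolding cover_of_def by (elim conjE)
  then have fib: "fibre C u = {poor C u, rich C u}" "card (fibre C u) = 2" if "u \<in> verts G" for u
    using that by blast+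
  have dis: "disjoint_family_on (fibre C) (verts G)"
    using C unfolding cover_of_def by (elim conjE)
  have com: "\<forall>u\<in>verts G. complete_graph (induced ?H (fibre C u))"
    using C unfolding cover_of_def by (elim conjE)
  have adj: "\<forall>u\<in>verts G. \<forall>v\<in>verts G.
      edges_between ?H (fibre C u) (fibre C v) \<noteq> {} \<longrightarrow> u = v \<or> {u, v} \<in> edges G"
    using C unfolding cover_of_def by (elim conjE)
  have mat: "\<forall>u\<in>verts G. \<forall>v\<in>verts G. {u, v} \<in> edges G \<longrightarrow>
      is_matching (edges_between ?H (fibre C u) (fibre C v))"
    using C unfolding cover_of_def by (elim conjE)
  define D :: "('a, nat) cover" where "D = \<lparr>fibre = (\<lambda>u. f ` fibre C u),
     host = \<lparr>verts = f ` ?V, edges = (`) f ` edges ?H\<rparr>, poor = f \<circ> poor C, rich = f \<circ> rich C\<rparr>"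
  have eb: "edges_between (host D) (f ` A) (f ` B) = (`) f ` edges_between ?H A B"
    if "A \<subseteq> ?V" "B \<subseteq> ?V" for A B
  proof (intro equalityI subsetI)
    fix e assume "e \<in> edges_between (host D) (f ` A) (f ` B)"
    then obtain e' x y where e: "e' \<in> edges ?H" "e = f ` e'" "x \<in> A" "y \<in> B" "f ` e' = f ` {x, y}"
      by (auto simp: edges_between_def D_def)
    then have "e' = {x, y}"
      using inj_on_image_eq_iff[OF inj eV(1)[OF e(1)], of "{x, y}"] that by blast
    then have "e' \<in> edges_between ?H A B"
      using e unfolding edges_between_def by blast
    then show "e \<in> (`) f ` edges_between ?H A B"
      using e(2) by blast
  next
    fix e assume "e \<in> (`) f ` edges_between ?H A B"
    then show "e \<in> edges_between (host D) (f ` A) (f ` B)"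
      by (fastforce simp: edges_between_def D_def)
  qed
  have "cover_of G D"
    unfolding cover_of_def
  proof (intro conjI ballI impI)
    show "simple_graph (host D)"
      using fin eV by (auto simp: simple_graph_def D_def card_image inj_on_subset[OF inj])
    show "(\<Union>u\<in>verts G. fibre D u) = verts (host D)"
      unfolding D_def UV[symmetric] by (simp add: image_UN)
    have "f ` fibre C u \<inter> f ` fibre C v = {}" if "u \<in> verts G" "v \<in> verts G" "u \<noteq> v" for u v
    proof -
      have "fibre C u \<inter> fibre C v = {}"
        using dis that by (auto simp: disjoint_family_on_def)
      then show ?thesis
        using inj_on_image_Int[OF inj fibV fibV, of u v] that by auto
    qed
    then show "disjoint_family_on (fibre D) (verts G)"
      by (auto simp: disjoint_family_on_def D_def)
  next
    fix u assume u: "u \<in> verts G"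
    show "card (fibre D u) = 2"
      using fib(2)[OF u] fibV[OF u] by (simp add: D_def card_image inj_on_subset[OF inj])
    show "fibre D u = {poor D u, rich D u}"
      using fib(1)[OF u] by (auto simp: D_def)
    have "complete_graph (induced ?H (fibre C u))"
      using com u by blast
    then have "\<And>x y. x \<in> fibre C u \<Longrightarrow> y \<in> fibre C u \<Longrightarrow> x \<noteq> y \<Longrightarrow> {x, y} \<in> edges ?H"
      using fibV[OF u] by (auto simp: complete_graph_def induced_def)
    then have "{f x, f y} \<in> (`) f ` edges ?H"
      if "x \<in> fibre C u" "y \<in> fibre C u" "f x \<noteq> f y" for x y
      using that image_eqI[of "{f x, f y}" "(`) f" "{x, y}"] by auto
    then show "complete_graph (induced (host D) (fibre D u))"
      by (auto simp: complete_graph_def induced_def D_def)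
  next
    fix u v assume uv: "u \<in> verts G" "v \<in> verts G"
    have *: "edges_between (host D) (fibre D u) (fibre D v) =
       (`) f ` edges_between ?H (fibre C u) (fibre C v)"
      using eb[OF fibV[OF uv(1)] fibV[OF uv(2)]] by (simp add: D_def)
    show "u = v \<or> {u, v} \<in> edges G"
      if "edges_between (host D) (fibre D u) (fibre D v) \<noteq> {}"
      using adj uv that unfolding * by blast
    show "is_matching (edges_between (host D) (fibre D u) (fibre D v))" if "{u, v} \<in> edges G"
    proof -
      let ?M = "edges_between ?H (fibre C u) (fibre C v)"
      have M: "disjoint ?M"
        using mat uv that by (simp add: is_matching_def)
      have "f ` e \<inter> f ` e' = {}" if "e \<in> ?M" "e' \<in> ?M" "f ` e \<noteq> f ` e'" for e e'
      proof -
        have "e \<inter> e' = {}" using M that by (auto simp: disjoint_def)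
        moreover have "e \<subseteq> ?V" "e' \<subseteq> ?V" using that eV(1) by (auto simp: edges_between_def)
        ultimately show ?thesis
          using inj_on_image_Int[OF inj, of e e'] by auto
      qed
      then show ?thesis unfolding * is_matching_def disjoint_def by blast
    qed
  qed
  then obtain \<psi> where \<psi>: "coloring G c D \<psi>"
    using col by (auto simp: colorable_def)
  define \<phi> where "\<phi> = (\<lambda>u. the_inv_into ?V f (\<psi> u))"
  have \<psi>f: "\<psi> u \<in> f ` fibre C u" if "u \<in> verts G" for u
    using \<psi> that by (auto simp: coloring_def cover_map_def D_def)
  have \<phi>: "\<phi> u \<in> fibre C u \<and> f (\<phi> u) = \<psi> u" if u: "u \<in> verts G" for u
    using \<psi>f[OF u] fibV[OF u] the_inv_into_f_f[OF inj] unfolding \<phi>_def by auto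
  have img: "\<psi> ` verts G = f ` \<phi> ` verts G"
    using \<phi> by (auto simp: image_iff)
  have sub: "\<phi> ` verts G \<subseteq> ?V"
    using \<phi> fibV by blast
  have deg: "degree (map_graph G D \<psi>) (f x) = degree (map_graph G C \<phi>) x" if x: "x \<in> ?V" for x
  proof -
    let ?E = "{e \<in> edges ?H. e \<subseteq> \<phi> ` verts G \<and> x \<in> e}"
    have "{e \<in> (`) f ` edges ?H. e \<subseteq> f ` \<phi> ` verts G \<and> f x \<in> e} = (`) f ` ?E"
    proof -
      have "f ` e \<subseteq> f ` \<phi> ` verts G \<longleftrightarrow> e \<subseteq> \<phi> ` verts G" "f x \<in> f ` e \<longleftrightarrow> x \<in> e"
        if "e \<in> edges ?H" for e
      proof -
        show "f x \<in> f ` e \<longleftrightarrow> x \<in> e"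
          using inj_on_image_mem_iff[OF inj x eV(1)[OF that]] .
        have "y \<in> \<phi> ` verts G" if "f ` e \<subseteq> f ` \<phi> ` verts G" "y \<in> e" for y
          using inj_on_image_mem_iff[OF inj _ sub, of y] eV(1)[OF \<open>e \<in> edges ?H\<close>] that by blast
        then show "f ` e \<subseteq> f ` \<phi> ` verts G \<longleftrightarrow> e \<subseteq> \<phi> ` verts G"
          by blast
      qed
      then show ?thesis
        unfolding Compr_image_eq by (intro arg_cong[where f = "(`) ((`) f)"] Collect_cong) blast
    qed
    moreover have "inj_on ((`) f) ?E"
      using inj_on_image_eq_iff[OF inj] eV(1) by (auto simp: inj_on_def)
    ultimately show ?thesis
      by (simp add: degree_def map_graph_def induced_def D_def img card_image conj_assoc)
  qed
  have "coloring G c C \<phi>"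
    unfolding coloring_def cover_map_def
  proof (intro conjI ballI impI)
    fix u assume u: "u \<in> verts G"
    show "\<phi> u \<in> fibre C u" using \<phi>[OF u] by simp
    have pr: "poor C u \<in> ?V" "rich C u \<in> ?V" using fib(1)[OF u] fibV[OF u] by auto
    show "int (degree (map_graph G C \<phi>) (poor C u)) \<le> fst (c u)" if "\<phi> u = poor C u"
    proof -
      have eq: "poor D u = f (poor C u)" by (simp add: D_def)
      have "\<psi> u = poor D u" using \<phi>[OF u] that eq by simp
      then have "int (degree (map_graph G D \<psi>) (poor D u)) \<le> fst (c u)"
        using \<psi> u unfolding coloring_def by blast
      then show ?thesis using deg[OF pr(1)] by (simp add: eq)
    qed
    show "int (degree (map_graph G C \<phi>) (rich C u)) \<le> snd (c u)" if "\<phi> u = rich C u"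
    proof -
      have eq: "rich D u = f (rich C u)" by (simp add: D_def)
      have "\<psi> u = rich D u" using \<phi>[OF u] that eq by simp
      then have "int (degree (map_graph G D \<psi>) (rich D u)) \<le> snd (c u)"
        using \<psi> u unfolding coloring_def by blast
      then show ?thesis using deg[OF pr(2)] by (simp add: eq)
    qed
  qed
  then show ?thesis by blast
qed

end

theory Submission
  imports Defs
begin

text \<open>
  The theorem follows from a bound that does not mention \<open>j\<close>. Give a vertex with capacities
  \<open>(a, b)\<close>, both nonnegative, the weight \<open>1 - i + a + min b (2 i)\<close>, and a vertex with only one usable node,
  of capacity \<open>b\<close>, the weight \<open>min b i\<close>; let \<open>\<kappa> = a + b + 1 - weight\<close>. Then
  \<open>\<rho>(v) = weight(v) - (j - i - \<kappa>(v))\<close> with \<open>\<kappa> \<le> j - i\<close>, so it suffices that a critical graph satisfies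
  \<open>pot(V) \<le> - 1 - \<kappa>(v)\<close> for some vertex \<open>v\<close>, where \<open>pot\<close> is total weight minus \<open>i + 1\<close> per edge.

  The weights are chosen such that making one node unusable costs at most \<open>i + 1\<close>, and lowering a
  capacity by one costs at most one. In a minimal counterexample, colouring a proper subset first shows that
  \<open>V\<close> has the smallest potential; exploiting the rich nodes of large capacity improves the gap to 2, except for the
  sets \<open>V - {v}\<close> where \<open>v\<close> is in the set \<open>B\<close> of vertices of degree 2 with positive capacities. This gap leaves
  room to reserve capacity, and excludes vertices of small degree outside \<open>B\<close>. Finally a colouring of
  minimal energy is considered, in which each vertex of \<open>B\<close> acts as an edge whose conflict is borne by
  one of its ends: a violation of Hall's condition yields a set of vertices with too many edges.
\<close>

section \<open>Potentials\<close>

text \<open>The constants of \<open>wt\<close> are forced by the price \<open>i + 1\<close> of an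
  edge. A rich node left alone is credited with at most \<open>i\<close>, as much as a poor node can
  have; then \<open>2 * i\<close> is the largest cap on the rich capacity for which making either
  node unusable still costs at most \<open>i + 1\<close>. The largest weight is therefore
  \<open>2 * i + 1\<close>, one less than the price of two edges. This is why degree 2 is the
  critical degree and why \<open>B\<close> has to be carried through the proof. The capacity hidden
  by the caps is recorded in \<open>kap\<close>; it is at least \<open>i\<close> once both nodes are
  usable, and this slack helps to pay for reservations. The restriction on \<open>i\<close> is felt
  in \<open>star_bound\<close>. A vertex with all neighbours in \<open>B\<close> can have up to
  \<open>i\<close> more of them than its two nodes tolerate together; each surplus neighbour must
  avoid it and burden its far end instead, at a cost of two. The gap of 2 pays for one of them. A
  surplus of two occurs only for \<open>i = 2\<close> with 9 neighbours, and an uncrossing argument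
  then selects a suitable pair.\<close>

definition wt :: "int \<Rightarrow> (bool \<Rightarrow> int) \<Rightarrow> int" where
  "wt i p = (if 0 \<le> p False \<and> 0 \<le> p True then 1 - i + p False + min (p True) (2 * i)
             else if p True < 0 then p False else min (p True) i)"

text \<open>For capacities at least - 1 and \<open>b\<close> the rich capacity, this is
  \<open>max i (b - i)\<close> if both nodes are usable, \<open>max 0 (b - i)\<close> if only the
  rich one is, and 0 otherwise.\<close>

definition kap :: "int \<Rightarrow> (bool \<Rightarrow> int) \<Rightarrow> int" where
  "kap i p = p False + p True + 1 - wt i p"

definition nbrs :: "'a set set \<Rightarrow> 'a \<Rightarrow> 'a set \<Rightarrow> 'a set" where
  "nbrs E v S = {y \<in> S. {v, y} \<in> E}"

definition pot :: "int \<Rightarrow> 'a set set \<Rightarrow> ('a \<Rightarrow> bool \<Rightarrow> int) \<Rightarrow> 'a set \<Rightarrow> int" where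
  "pot i E c S = (\<Sum>v\<in>S. wt i (c v)) - (i + 1) * int (card {e \<in> E. e \<subseteq> S})"

definition valid :: "int \<Rightarrow> 'a set \<Rightarrow> ('a \<Rightarrow> bool \<Rightarrow> int) \<Rightarrow> bool" where
  "valid i V c \<longleftrightarrow> (\<forall>v\<in>V. - 1 \<le> c v False \<and> c v False \<le> i \<and> - 1 \<le> c v True)"

text \<open>Quantifying over all subsets makes the condition hereditary, so that induction can pass
  to subsets; its failure exhibits a single vertex \<open>v\<close>, which is the form needed for
  the theorem.\<close>

definition good :: "int \<Rightarrow> 'a set set \<Rightarrow> 'a set \<Rightarrow> ('a \<Rightarrow> bool \<Rightarrow> int) \<Rightarrow> bool" where
  "good i E V c \<longleftrightarrow> (\<forall>S\<subseteq>V. \<forall>v\<in>S. 0 \<le> pot i E c S + kap i (c v))"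

section \<open>Arithmetic of the weights\<close>

lemma kap_nonneg:
  assumes "0 \<le> i" "- 1 \<le> p False" "- 1 \<le> p True" "p False \<le> i"
  shows "0 \<le> kap i p"
  using assms by (auto simp: kap_def wt_def)

lemma kap_alive:
  assumes "0 \<le> i" "0 \<le> p False" "0 \<le> p True"
  shows "i \<le> kap i p"
  using assms by (auto simp: kap_def wt_def)

text \<open>The delicate cases are those in which a node becomes unusable and \<open>wt\<close>
  changes its formula; as \<open>i\<close> is at least 1, the loss still does not exceed the number
  of units taken away.\<close>

lemma wt_reserve:
  assumes "1 \<le> i" "p' False \<le> p False" "p' True \<le> p True" "- 1 \<le> p' False" "- 1 \<le> p' True"
  shows "wt i p - wt i p' \<le> (p False - p' False) + (p True - p' True)"
  using assms by (auto simp: wt_def min_def)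

lemma wt_kill:
  assumes "1 \<le> i" "- 1 \<le> p False" "- 1 \<le> p True" "p False \<le> i"
    and "p' \<beta> = p \<beta>" "p' (\<not> \<beta>) = - 1"
  shows "wt i p - wt i p' \<le> i + 1"
  using assms by (cases \<beta>) (auto simp: wt_def min_def)

lemma wt_kill2:
  assumes "1 \<le> i" "- 1 \<le> p False" "- 1 \<le> p True" "p False \<le> i"
    and "p' False = - 1" "p' True = - 1"
  shows "wt i p - wt i p' \<le> 2 * (i + 1)"
  using assms by (auto simp: wt_def min_def)

lemma wt_le:
  assumes "1 \<le> i" "- 1 \<le> p False" "- 1 \<le> p True" "p False \<le> i"
  shows "wt i p \<le> 2 * i + 1"
  using assms by (auto simp: wt_def min_def)

section \<open>Edge counts and potentials of unions\<close>

lemma nbrs_subset: "nbrs E v S \<subseteq> S"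
  by (auto simp: nbrs_def)

lemma finite_nbrs [simp]: "finite S \<Longrightarrow> finite (nbrs E v S)"
  by (auto simp: nbrs_def)

lemma card_nbrs_Un:
  assumes "finite S" "finite W" "S \<inter> W = {}"
  shows "card (nbrs E v (S \<union> W)) = card (nbrs E v S) + card (nbrs E v W)"
proof -
  have "nbrs E v (S \<union> W) = nbrs E v S \<union> nbrs E v W" by (auto simp: nbrs_def)
  moreover have "nbrs E v S \<inter> nbrs E v W = {}" using assms by (auto simp: nbrs_def)
  ultimately show ?thesis using assms by (simp add: card_Un_disjoint)
qed

lemma finite_edges_within: "finite S \<Longrightarrow> finite {e \<in> E. e \<subseteq> S}"
  by (rule finite_subset[of _ "Pow S"]) auto

lemma card_edges_insert:
  assumes "finite S" "v \<notin> S" and E2: "\<forall>e\<in>E. card e = 2"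
  shows "card {e \<in> E. e \<subseteq> insert v S} = card {e \<in> E. e \<subseteq> S} + card (nbrs E v S)"
proof -
  have "{e \<in> E. e \<subseteq> insert v S} = {e \<in> E. e \<subseteq> S} \<union> (\<lambda>y. {v, y}) ` nbrs E v S" (is "?A = ?B \<union> ?C")
  proof (intro equalityI subsetI)
    fix e assume e: "e \<in> ?A"
    then obtain a b where ab: "e = {a, b}" "a \<noteq> b" using E2 by (auto simp: card_2_iff)
    show "e \<in> ?B \<union> ?C"
    proof (cases "v \<in> e")
      case True
      then obtain y where y: "e = {v, y}" "y \<noteq> v" using ab by (metis insert_commute insertE singletonD)
      then have "y \<in> nbrs E v S" using e by (auto simp: nbrs_def)
      then show ?thesis using y by blast
    qed (use e in auto)
  qed (auto simp: nbrs_def)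
  moreover have "?B \<inter> ?C = {}" using assms(2) by (auto simp: nbrs_def)
  moreover have "card ?C = card (nbrs E v S)"
    by (rule card_image) (use assms(2) in \<open>auto simp: inj_on_def nbrs_def doubleton_eq_iff\<close>)
  ultimately show ?thesis
    using assms(1) finite_edges_within[OF assms(1)] by (simp add: card_Un_disjoint)
qed

lemma card_edges_Un:
  assumes "finite S" "finite W" "S \<inter> W = {}" and E2: "\<forall>e\<in>E. card e = 2"
  shows "card {e \<in> E. e \<subseteq> S \<union> W} =
    card {e \<in> E. e \<subseteq> S} + card {e \<in> E. e \<subseteq> W} + (\<Sum>y\<in>W. card (nbrs E y S))"
  using assms(2,3)
proof (induction W)
  case empty
  have "{e \<in> E. e \<subseteq> {}} = {}" using E2 by auto
  then show ?case by simp
next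
  case (insert v W)
  have "card {e \<in> E. e \<subseteq> insert v (S \<union> W)} = card {e \<in> E. e \<subseteq> S \<union> W} + card (nbrs E v (S \<union> W))"
    by (rule card_edges_insert) (use insert assms in auto)
  moreover have "card {e \<in> E. e \<subseteq> insert v W} = card {e \<in> E. e \<subseteq> W} + card (nbrs E v W)"
    by (rule card_edges_insert) (use insert assms in auto)
  moreover have "card (nbrs E v (S \<union> W)) = card (nbrs E v S) + card (nbrs E v W)"
    by (rule card_nbrs_Un) (use insert assms in auto)
  ultimately show ?case using insert by simp
qed

lemma handshake:
  assumes "finite S" and E2: "\<forall>e\<in>E. card e = 2"
  shows "(\<Sum>v\<in>S. card (nbrs E v S)) = 2 * card {e \<in> E. e \<subseteq> S}"
  using assms(1)
proof (induction S)
  case empty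
  have "{e \<in> E. e \<subseteq> {}} = {}" using E2 by auto
  then show ?case by simp
next
  case (insert v S)
  have loop: "{v, v} \<notin> E" using E2 by force
  have "nbrs E v (insert v S) = nbrs E v S" using loop by (auto simp: nbrs_def)
  moreover have "card (nbrs E y (insert v S)) = card (nbrs E y S) + (if {v, y} \<in> E then 1 else 0)"
    if "y \<in> S" for y
  proof -
    have "nbrs E y (insert v S) = (if {v, y} \<in> E then insert v (nbrs E y S) else nbrs E y S)"
      by (auto simp: nbrs_def insert_commute)
    then show ?thesis using insert by (auto simp: nbrs_def)
  qed
  moreover have "(\<Sum>y\<in>S. if {v, y} \<in> E then 1 else 0) = card (nbrs E v S)"
    using insert by (simp add: nbrs_def flip: sum.inter_filter)
  ultimately show ?case
    using insert card_edges_insert[OF insert(1,2) E2] by (simp add: sum.distrib)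
qed

lemma pot_Un:
  assumes "finite S" "finite W" "S \<inter> W = {}" and E2: "\<forall>e\<in>E. card e = 2"
  shows "pot i E c (S \<union> W) = pot i E c S + pot i E c W - (i + 1) * (\<Sum>y\<in>W. int (card (nbrs E y S)))"
  unfolding pot_def using assms card_edges_Un[OF assms]
  by (simp add: sum.union_disjoint algebra_simps)

lemma pot_insert:
  assumes "finite S" "v \<notin> S" and E2: "\<forall>e\<in>E. card e = 2"
  shows "pot i E c (insert v S) = pot i E c S + wt i (c v) - (i + 1) * int (card (nbrs E v S))"
  unfolding pot_def using assms card_edges_insert[OF assms]
  by (simp add: algebra_simps)

lemma pot_empty [simp]: "\<forall>e\<in>E. card e = 2 \<Longrightarrow> pot i E c {} = 0"
  by (auto simp: pot_def card_eq_0_iff)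

text \<open>Weights are modular, while edges between \<open>S - W\<close> and \<open>W - S\<close>
  are counted only in the union.\<close>

lemma pot_submodular:
  assumes "finite S" "finite W" "0 \<le> i"
  shows "pot i E c (S \<union> W) + pot i E c (S \<inter> W) \<le> pot i E c S + pot i E c W"
proof -
  let ?e = "\<lambda>S. {e \<in> E. e \<subseteq> S}"
  have "card (?e S) + card (?e W) = card (?e S \<union> ?e W) + card (?e S \<inter> ?e W)"
    by (rule card_Un_Int) (use assms finite_edges_within in auto)
  moreover have "card (?e S \<inter> ?e W) = card (?e (S \<inter> W))" by (rule arg_cong[where f = card]) auto
  moreover have "card (?e S \<union> ?e W) \<le> card (?e (S \<union> W))"
    by (rule card_mono) (use assms finite_edges_within[of "S \<union> W"] in auto)
  ultimately have "int (card (?e S)) + int (card (?e W)) \<le> int (card (?e (S \<union> W))) + int (card (?e (S \<inter> W)))"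
    by linarith
  then have "(i + 1) * (int (card (?e S)) + int (card (?e W)))
      \<le> (i + 1) * (int (card (?e (S \<union> W))) + int (card (?e (S \<inter> W))))"
    using assms by (intro mult_left_mono) auto
  moreover have "(\<Sum>v\<in>S \<union> W. wt i (c v)) + (\<Sum>v\<in>S \<inter> W. wt i (c v)) = (\<Sum>v\<in>S. wt i (c v)) + (\<Sum>v\<in>W. wt i (c v))"
    using assms by (intro sum.union_inter) auto
  ultimately show ?thesis by (simp add: pot_def algebra_simps)
qed

lemma pot_remove_edge:
  assumes "finite S" "{u, z} \<in> E"
  shows "pot i (E - {{u, z}}) c S = pot i E c S + (if u \<in> S \<and> z \<in> S then i + 1 else 0)"
proof (cases "u \<in> S \<and> z \<in> S")
  case True
  have "{e \<in> E. e \<subseteq> S} = insert {u, z} {e \<in> E - {{u, z}}. e \<subseteq> S}" using True assms by auto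
  moreover have "card (insert {u, z} {e \<in> E - {{u, z}}. e \<subseteq> S}) = Suc (card {e \<in> E - {{u, z}}. e \<subseteq> S})"
    using finite_edges_within[OF assms(1), of "E - {{u, z}}"] by (intro card_insert_disjoint) auto
  ultimately have "card {e \<in> E. e \<subseteq> S} = Suc (card {e \<in> E - {{u, z}}. e \<subseteq> S})" by simp
  then show ?thesis using True unfolding pot_def by (simp only: of_nat_Suc) (simp add: algebra_simps)
next
  case False
  then have "{e \<in> E - {{u, z}}. e \<subseteq> S} = {e \<in> E. e \<subseteq> S}" by auto
  then show ?thesis using False unfolding pot_def by (simp only:) auto
qed

text \<open>In the second part the weight of \<open>v\<close> cancels in \<open>pot + kap\<close>
  and leaves its true capacities, so the units taken at \<open>v\<close> count exactly.\<close>

lemma pot_reserve: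
  assumes "finite W" "1 \<le> i" and dec: "\<And>v \<beta>. v \<in> W \<Longrightarrow> c' v \<beta> \<le> c v \<beta> \<and> - 1 \<le> c' v \<beta>"
  shows "pot i E c W \<le> pot i E c' W + (\<Sum>v\<in>W. (c v False - c' v False) + (c v True - c' v True))"
    and "v \<in> W \<Longrightarrow> pot i E c W + kap i (c v) \<le> pot i E c' W + kap i (c' v) + (\<Sum>v\<in>W. (c v False - c' v False) + (c v True - c' v True))"
proof -
  let ?d = "\<lambda>v. (c v False - c' v False) + (c v True - c' v True)"
  have d: "wt i (c v) - wt i (c' v) \<le> ?d v" if "v \<in> W" for v
    using wt_reserve[of i "c' v" "c v"] dec[OF that, of True] dec[OF that, of False] assms by auto
  have "(\<Sum>v\<in>W. wt i (c v) - wt i (c' v)) \<le> (\<Sum>v\<in>W. ?d v)"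
    by (rule sum_mono) (rule d)
  then show "pot i E c W \<le> pot i E c' W + (\<Sum>v\<in>W. ?d v)"
    by (simp add: pot_def sum_subtractf)
  assume v: "v \<in> W"
  have "(\<Sum>v\<in>W-{v}. wt i (c v) - wt i (c' v)) \<le> (\<Sum>v\<in>W-{v}. ?d v)"
    by (rule sum_mono) (use d in auto)
  then show "pot i E c W + kap i (c v) \<le> pot i E c' W + kap i (c' v) + (\<Sum>v\<in>W. ?d v)"
    using v assms(1) by (simp add: pot_def sum_subtractf sum.remove[of W v] kap_def)
qed

lemma good_subset: "good i E V c \<Longrightarrow> S \<subseteq> V \<Longrightarrow> good i E S c"
  unfolding good_def by blast

lemma valid_subset: "valid i V c \<Longrightarrow> S \<subseteq> V \<Longrightarrow> valid i S c"
  unfolding valid_def by blast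

text \<open>Rado's argument: if both choices for \<open>v\<close> violate the condition, uncrossing the two violating
  sets gives a contradiction.\<close>
lemma orientation_Hall:
  fixes k :: "'b \<Rightarrow> int" and p q :: "'c \<Rightarrow> 'b"
  assumes "finite A" "finite R" "\<And>v. v \<in> A \<Longrightarrow> p v \<in> R \<and> q v \<in> R"
    and "\<And>Z. Z \<subseteq> R \<Longrightarrow> int (card {v \<in> A. p v \<in> Z \<and> q v \<in> Z}) \<le> (\<Sum>u\<in>Z. k u)"
  shows "\<exists>t. (\<forall>v\<in>A. t v = p v \<or> t v = q v) \<and> (\<forall>u\<in>R. int (card {v \<in> A. t v = u}) \<le> k u)"
  using assms
proof (induction A arbitrary: k)
  case empty
  have "0 \<le> k u" if "u \<in> R" for u using empty.prems(3)[of "{u}"] that by simp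
  then show ?case by simp
next
  case (insert v A)
  let ?g = "\<lambda>Z. int (card {v \<in> A. p v \<in> Z \<and> q v \<in> Z})"
  let ?g1 = "\<lambda>Z. int (card {v' \<in> insert v A. p v' \<in> Z \<and> q v' \<in> Z})"
  have g1: "?g1 Z = ?g Z + (if p v \<in> Z \<and> q v \<in> Z then 1 else 0)" for Z
  proof -
    have "{v' \<in> insert v A. p v' \<in> Z \<and> q v' \<in> Z} = (if p v \<in> Z \<and> q v \<in> Z then insert v {v \<in> A. p v \<in> Z \<and> q v \<in> Z} else {v \<in> A. p v \<in> Z \<and> q v \<in> Z})"
      by auto
    then show ?thesis using insert.hyps by simp
  qed
  have H: "?g Z + (if p v \<in> Z \<and> q v \<in> Z then 1 else 0) \<le> (\<Sum>u\<in>Z. k u)" if "Z \<subseteq> R" for Z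
    using insert.prems(3)[OF that] g1[of Z] by simp
  have "\<exists>x. (x = p v \<or> x = q v) \<and> (\<forall>Z\<subseteq>R. ?g Z \<le> (\<Sum>u\<in>Z. (k(x := k x - 1)) u))"
  proof (rule ccontr)
    assume neg: "\<not> ?thesis"
    have sm: "(\<Sum>u\<in>Z. (k(x := k x - 1)) u) = (\<Sum>u\<in>Z. k u) - (if x \<in> Z then 1 else 0)" if "Z \<subseteq> R" for x Z
    proof -
      have fZ: "finite Z" using that insert.prems finite_subset by auto
      have "(\<Sum>u\<in>Z. (k(x := k x - 1)) u) = (\<Sum>u\<in>Z. k u - (if u = x then 1 else 0))"
        by (rule sum.cong) auto
      then show ?thesis using fZ by (simp add: sum_subtractf)
    qed
    have "\<not> (\<forall>Z\<subseteq>R. ?g Z \<le> (\<Sum>u\<in>Z. (k(p v := k (p v) - 1)) u))" using neg by blast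
    then obtain Z1 where "Z1 \<subseteq> R" "\<not> ?g Z1 \<le> (\<Sum>u\<in>Z1. (k(p v := k (p v) - 1)) u)" by blast
    then have Z1: "Z1 \<subseteq> R" "?g Z1 > (\<Sum>u\<in>Z1. k u) - (if p v \<in> Z1 then 1 else 0)"
      using sm[of Z1 "p v"] by simp_all
    have "\<not> (\<forall>Z\<subseteq>R. ?g Z \<le> (\<Sum>u\<in>Z. (k(q v := k (q v) - 1)) u))" using neg by blast
    then obtain Z2 where "Z2 \<subseteq> R" "\<not> ?g Z2 \<le> (\<Sum>u\<in>Z2. (k(q v := k (q v) - 1)) u)" by blast
    then have Z2: "Z2 \<subseteq> R" "?g Z2 > (\<Sum>u\<in>Z2. k u) - (if q v \<in> Z2 then 1 else 0)"
      using sm[of Z2 "q v"] by simp_all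
    have 1: "p v \<in> Z1" "q v \<notin> Z1" "?g Z1 \<ge> (\<Sum>u\<in>Z1. k u)"
      using Z1 H[of Z1] by (auto split: if_splits)
    have 2: "q v \<in> Z2" "p v \<notin> Z2" "?g Z2 \<ge> (\<Sum>u\<in>Z2. k u)"
      using Z2 H[of Z2] by (auto split: if_splits)
    let ?s = "\<lambda>Z. {v \<in> A. p v \<in> Z \<and> q v \<in> Z}"
    have "card (?s Z1) + card (?s Z2) = card (?s Z1 \<union> ?s Z2) + card (?s Z1 \<inter> ?s Z2)"
      by (rule card_Un_Int) (use insert in auto)
    moreover have "card (?s Z1 \<inter> ?s Z2) = card (?s (Z1 \<inter> Z2))" by (rule arg_cong[where f = card]) auto
    moreover have "card (?s Z1 \<union> ?s Z2) \<le> card (?s (Z1 \<union> Z2))"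
      by (rule card_mono) (use insert in auto)
    ultimately have A: "?g Z1 + ?g Z2 \<le> ?g (Z1 \<union> Z2) + ?g (Z1 \<inter> Z2)" by linarith
    \<comment> \<open>Both ends of \<open>v\<close> lie in the union, so \<open>v\<close> itself
      supplies the extra unit that contradicts submodularity.\<close>
    have B: "?g (Z1 \<union> Z2) + 1 \<le> (\<Sum>u\<in>Z1 \<union> Z2. k u)" using H[of "Z1 \<union> Z2"] Z1 Z2 1 2 by auto
    have C: "?g (Z1 \<inter> Z2) \<le> (\<Sum>u\<in>Z1 \<inter> Z2. k u)" using H[of "Z1 \<inter> Z2"] Z1 Z2 1 2 by auto
    have D: "(\<Sum>u\<in>Z1 \<union> Z2. k u) + (\<Sum>u\<in>Z1 \<inter> Z2. k u) = (\<Sum>u\<in>Z1. k u) + (\<Sum>u\<in>Z2. k u)"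
      using Z1 Z2 insert.prems finite_subset by (intro sum.union_inter) auto
    show False using A B C D 1 2 by linarith
  qed
  then obtain x where x: "x = p v \<or> x = q v" and xZ: "\<forall>Z\<subseteq>R. ?g Z \<le> (\<Sum>u\<in>Z. (k(x := k x - 1)) u)"
    by blast
  obtain t where t: "\<forall>v\<in>A. t v = p v \<or> t v = q v" "\<forall>u\<in>R. int (card {v \<in> A. t v = u}) \<le> (k(x := k x - 1)) u"
    using insert.IH[of "k(x := k x - 1)"] insert.prems xZ by (auto simp del: fun_upd_apply)
  let ?t = "t(v := x)"
  have "int (card {v' \<in> insert v A. ?t v' = u}) \<le> k u" if "u \<in> R" for u
  proof -
    have "{v' \<in> insert v A. ?t v' = u} = (if u = x then insert v {v' \<in> A. t v' = u} else {v' \<in> A. t v' = u})"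
      using insert.hyps by auto
    then have "card {v' \<in> insert v A. ?t v' = u} = card {v' \<in> A. t v' = u} + (if u = x then 1 else 0)"
      using insert.hyps by simp
    then show ?thesis using t(2) that by (auto split: if_splits)
  qed
  moreover have "\<forall>v'\<in>insert v A. ?t v' = p v' \<or> ?t v' = q v'" using t(1) x by auto
  ultimately show ?case by blast
qed

text \<open>Bookkeeping for colouring \<open>S\<close> first: every vertex of \<open>W\<close>
  compares the price of its edges into \<open>S\<close> with the weight it loses when
  \<open>c\<close> becomes \<open>c'\<close>.\<close>

lemma pot_Un_change:
  assumes "finite S" "finite W" "S \<inter> W = {}" and E2: "\<forall>e\<in>E. card e = 2"
  shows "pot i E c (S \<union> W) = pot i E c S + pot i E c' W
    - (\<Sum>y\<in>W. (i + 1) * int (card (nbrs E y S)) - (wt i (c y) - wt i (c' y)))"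
  using pot_Un[OF assms, of i c] by (simp add: pot_def sum_subtractf sum_distrib_left)

section \<open>Colourings of abstract covers\<close>

text \<open>The colours \<open>False\<close> and \<open>True\<close> stand for the poor and the rich node; \<open>X u \<alpha> v \<beta>\<close> says
  that node \<open>\<alpha>\<close> of \<open>u\<close> is joined to node \<open>\<beta>\<close> of \<open>v\<close>, which only counts if \<open>uv\<close> is an edge.\<close>
locale dp_cover =
  fixes X :: "'a \<Rightarrow> bool \<Rightarrow> 'a \<Rightarrow> bool \<Rightarrow> bool" and i :: int
  assumes X_sym: "X u \<alpha> v \<beta> \<Longrightarrow> X v \<beta> u \<alpha>"
    and X_fun: "X u \<alpha> v \<beta> \<Longrightarrow> X u \<alpha> v \<beta>' \<Longrightarrow> \<beta> = \<beta>'"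
    and i12: "i = 1 \<or> i = 2"
begin

definition load :: "'a set set \<Rightarrow> 'a set \<Rightarrow> ('a \<Rightarrow> bool) \<Rightarrow> 'a \<Rightarrow> nat" where
  "load E V f u = card {v \<in> V. {u, v} \<in> E \<and> X u (f u) v (f v)}"

definition col :: "'a set \<Rightarrow> 'a set set \<Rightarrow> ('a \<Rightarrow> bool \<Rightarrow> int) \<Rightarrow> ('a \<Rightarrow> bool) \<Rightarrow> bool" where
  "col V E c f \<longleftrightarrow> (\<forall>u\<in>V. int (load E V f u) \<le> c u (f u))"

definition kill :: "'a set set \<Rightarrow> 'a set \<Rightarrow> ('a \<Rightarrow> bool) \<Rightarrow> ('a \<Rightarrow> bool \<Rightarrow> int) \<Rightarrow> 'a \<Rightarrow> bool \<Rightarrow> int" where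
  "kill E S \<phi> c y \<beta> = (if \<exists>x\<in>S. {y, x} \<in> E \<and> X y \<beta> x (\<phi> x) then - 1 else c y \<beta>)"

lemma i_pos: "1 \<le> i" using i12 by auto

text \<open>One coloured neighbour is matched to at most one of the two nodes of
  \<open>v\<close>.\<close>

lemma X_avoid: "\<exists>\<beta>. \<not> X v \<beta> x \<gamma>"
  using X_sym[of v _ x \<gamma>] X_fun[of x \<gamma> v] by metis

lemma X_inj: "X u \<alpha> v \<beta> \<Longrightarrow> X u \<alpha>' v \<beta> \<Longrightarrow> \<alpha> = \<alpha>'"
  using X_sym X_fun by blast

lemma load_Un:
  assumes "finite S" "finite W" "S \<inter> W = {}"
  shows "load E (S \<union> W) f u = load E S f u + load E W f u"
proof -
  let ?s = "\<lambda>S. {v \<in> S. {u, v} \<in> E \<and> X u (f u) v (f v)}"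
  have "?s (S \<union> W) = ?s S \<union> ?s W" by auto
  moreover have "?s S \<inter> ?s W = {}" using assms by auto
  ultimately show ?thesis unfolding load_def using assms by (simp add: card_Un_disjoint)
qed

lemma load_cong: "f u = g u \<Longrightarrow> (\<And>v. v \<in> V \<Longrightarrow> f v = g v) \<Longrightarrow> load E V f u = load E V g u"
  unfolding load_def by (intro arg_cong[where f = card]) auto

lemma load_zero: "(\<And>v. v \<in> V \<Longrightarrow> {u, v} \<in> E \<Longrightarrow> \<not> X u (f u) v (f v)) \<Longrightarrow> load E V f u = 0"
  unfolding load_def by (auto intro: arg_cong[where f = card, of _ "{}", simplified])

lemma col_capacity_nonneg: "col V E c f \<Longrightarrow> u \<in> V \<Longrightarrow> 0 \<le> c u (f u)"
  unfolding col_def by force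

lemma col_mono: "col V E c' f \<Longrightarrow> (\<And>u \<beta>. u \<in> V \<Longrightarrow> c' u \<beta> \<le> c u \<beta>) \<Longrightarrow> col V E c f"
  unfolding col_def using order_trans by blast

text \<open>A coloured neighbour spoils at most one node of \<open>y\<close>, so two spoiled nodes
  mean two edges into \<open>S\<close>.\<close>

lemma kill_loss:
  assumes "finite S" "valid i V c" "y \<in> V"
  shows "wt i (c y) - wt i (kill E S \<phi> c y) \<le> (i + 1) * int (card (nbrs E y S))"
proof -
  let ?k = "\<lambda>\<beta>. \<exists>x\<in>S. {y, x} \<in> E \<and> X y \<beta> x (\<phi> x)"
  have v: "- 1 \<le> c y False" "- 1 \<le> c y True" "c y False \<le> i" using assms by (auto simp: valid_def)
  have fin: "finite (nbrs E y S)" using assms by simp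
  consider "\<not> ?k False" "\<not> ?k True" | "\<exists>\<beta>. \<not> ?k \<beta> \<and> ?k (\<not> \<beta>)" | "?k False" "?k True"
  proof -
    assume 1: "\<not> ?k False \<Longrightarrow> \<not> ?k True \<Longrightarrow> thesis" and 2: "\<exists>\<beta>. \<not> ?k \<beta> \<and> ?k (\<not> \<beta>) \<Longrightarrow> thesis"
      and 3: "?k False \<Longrightarrow> ?k True \<Longrightarrow> thesis"
    show thesis
    proof (cases "?k False")
      case True
      show thesis
      proof (cases "?k True")
        case False
        show thesis by (rule 2, rule exI[of _ True]) (use True False in simp)
      qed (use True 3 in blast)
    next
      case False
      show thesis
      proof (cases "?k True")
        case True
        show thesis by (rule 2, rule exI[of _ False]) (use True False in simp)
      qed (use False 1 in blast)
    qed
  qed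
  then show ?thesis
  proof cases
    case 1
    have "kill E S \<phi> c y \<beta> = c y \<beta>" for \<beta> using 1 unfolding kill_def by (cases \<beta>) auto
    then have "kill E S \<phi> c y = c y" by blast
    then show ?thesis using i_pos by simp
  next
    case 2
    then obtain \<beta> where 2: "\<not> ?k \<beta>" "?k (\<not> \<beta>)" by blast
    have "nbrs E y S \<noteq> {}" using 2 by (auto simp: nbrs_def)
    then have "1 \<le> card (nbrs E y S)" using fin by (simp add: Suc_leI card_gt_0_iff)
    then have "(i + 1) * 1 \<le> (i + 1) * int (card (nbrs E y S))" using i_pos by (intro mult_left_mono) auto
    moreover have "kill E S \<phi> c y \<beta> = c y \<beta>" "kill E S \<phi> c y (\<not> \<beta>) = - 1"
      using 2 unfolding kill_def by (simp_all only: if_True if_False)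
    then have "wt i (c y) - wt i (kill E S \<phi> c y) \<le> i + 1"
      by (intro wt_kill[OF i_pos v(1,2,3)])
    ultimately show ?thesis by simp
  next
    case 3
    then obtain x1 x2 where x: "x1 \<in> S" "{y, x1} \<in> E" "X y False x1 (\<phi> x1)"
      "x2 \<in> S" "{y, x2} \<in> E" "X y True x2 (\<phi> x2)" by blast
    then have "x1 \<noteq> x2" using X_inj by blast
    moreover have "{x1, x2} \<subseteq> nbrs E y S" using x by (auto simp: nbrs_def)
    ultimately have "2 \<le> card (nbrs E y S)" using card_mono[OF fin, of "{x1, x2}"] by simp
    then have "(i + 1) * 2 \<le> (i + 1) * int (card (nbrs E y S))" using i_pos by (intro mult_left_mono) auto
    moreover have "wt i (c y) - wt i (kill E S \<phi> c y) \<le> 2 * (i + 1)"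
      using 3 by (intro wt_kill2[OF i_pos v]) (simp_all add: kill_def)
    ultimately show ?thesis by linarith
  qed
qed

text \<open>No load fits a capacity of - 1, so spoiled nodes are never chosen, no conflict crosses
  between \<open>S\<close> and the rest, and the two colourings do not interact.\<close>

lemma kill_extend:
  assumes "finite V" "S \<subseteq> V" "col S E c \<phi>" "col (V - S) E (kill E S \<phi> c) \<psi>"
  shows "col V E c (\<lambda>x. if x \<in> S then \<phi> x else \<psi> x)"
proof -
  let ?f = "\<lambda>x. if x \<in> S then \<phi> x else \<psi> x"
  have fin: "finite S" "finite (V - S)" using assms finite_subset by auto
  have no: "\<not> X v (\<psi> v) u (\<phi> u)" if "u \<in> S" "v \<in> V - S" "{v, u} \<in> E" for u v
    using col_capacity_nonneg[OF assms(4) that(2)] that by (auto simp: kill_def split: if_splits)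
  have l: "load E V ?f u = load E S ?f u + load E (V - S) ?f u" for u
    using load_Un[OF fin, of E ?f u] assms by (simp add: Un_absorb1)
  show ?thesis unfolding col_def
  proof
    fix u assume u: "u \<in> V"
    show "int (load E V ?f u) \<le> c u (?f u)"
    proof (cases "u \<in> S")
      case True
      have "load E (V - S) ?f u = 0"
        by (rule load_zero) (use True no X_sym in \<open>fastforce simp: insert_commute\<close>)
      moreover have "load E S ?f u = load E S \<phi> u" by (rule load_cong) (use True in auto)
      ultimately show ?thesis using l True assms(3) by (simp add: col_def)
    next
      case False
      then have u': "u \<in> V - S" using u by auto
      have "load E S ?f u = 0"
        by (rule load_zero) (use False u' no in auto)
      moreover have "load E (V - S) ?f u = load E (V - S) \<psi> u" by (rule load_cong) (use False in auto)
      moreover have "kill E S \<phi> c u (\<psi> u) = c u (\<psi> u)"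
        using no u' by (auto simp: kill_def)
      moreover have "int (load E (V - S) \<psi> u) \<le> kill E S \<phi> c u (\<psi> u)"
        using assms(4) u' unfolding col_def by blast
      ultimately show ?thesis using l[of u] False by simp
    qed
  qed
qed

lemma kill_valid: "valid i V c \<Longrightarrow> valid i V (kill E S \<phi> c)"
  using i_pos by (auto simp: valid_def kill_def)

text \<open>Colour \<open>S\<close>, make the nodes adjacent to the chosen ones unusable, and apply the hypothesis to
  the rest: each unusable node costs at most \<open>i + 1\<close>, the price of the edge that spoiled it.\<close>
lemma pot_gap:
  assumes fin: "finite V" and E2: "\<forall>e\<in>E. card e = 2" and val: "valid i V c"
    and nc: "\<nexists>f. col V E c f"
    and sub: "\<And>S. S \<subset> V \<Longrightarrow> \<exists>f. col S E c f"
    and main: "\<And>V' c'. V' \<subset> V \<Longrightarrow> valid i V' c' \<Longrightarrow> good i E V' c' \<Longrightarrow> \<exists>f. col V' E c' f"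
    and S: "S \<noteq> {}" "S \<subset> V"
  shows "pot i E c V + 1 \<le> pot i E c S"
proof -
  let ?F = "{S. S \<noteq> {} \<and> S \<subset> V}"
  have finF: "finite ?F" by (rule finite_subset[of _ "Pow V"]) (use fin in auto)
  \<comment> \<open>With \<open>S0\<close> of least potential among proper subsets, an enlargement
    of strictly smaller potential can only be \<open>V\<close>; this bounds \<open>P V\<close> below
    the potential of every other set.\<close>
  obtain S0 where S0: "S0 \<noteq> {}" "S0 \<subset> V" and min: "\<And>S. S \<noteq> {} \<Longrightarrow> S \<subset> V \<Longrightarrow> pot i E c S0 \<le> pot i E c S"
  proof -
    have "Min (pot i E c ` ?F) \<in> pot i E c ` ?F" using finF S by (intro Min_in) auto
    then obtain S0 where S0: "Min (pot i E c ` ?F) = pot i E c S0" "S0 \<in> ?F" by (rule imageE)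
    have "Min (pot i E c ` ?F) \<le> pot i E c S" if "S \<in> ?F" for S
      using finF that by (intro Min_le) auto
    then show thesis using that[of S0] S0 by simp
  qed
  obtain \<phi> where \<phi>: "col S0 E c \<phi>" using sub S0 by blast
  let ?c = "kill E S0 \<phi> c"
  have "\<nexists>\<psi>. col (V - S0) E ?c \<psi>" using kill_extend[OF fin _ \<phi>] S0 nc by blast
  moreover have sm: "V - S0 \<subset> V" using S0 by auto
  moreover have val': "valid i (V - S0) ?c" using kill_valid valid_subset[OF val] by blast
  ultimately have "\<not> good i E (V - S0) ?c" using main by blast
  then obtain W v where W: "W \<subseteq> V - S0" "v \<in> W" "pot i E ?c W + kap i (?c v) < 0"
    by (auto simp: good_def not_le)
  have kap: "0 \<le> kap i (?c v)" using val' W i_pos by (intro kap_nonneg) (auto simp: valid_def)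
  have fins: "finite S0" "finite W" "S0 \<inter> W = {}"
    using S0 W fin finite_subset[of S0 V] finite_subset[of W V] by auto
  have "0 \<le> (\<Sum>y\<in>W. (i + 1) * int (card (nbrs E y S0)) - (wt i (c y) - wt i (?c y)))"
    by (rule sum_nonneg) (use kill_loss[OF fins(1) val] W in \<open>force\<close>)
  then have lt: "pot i E c (S0 \<union> W) < pot i E c S0"
    using pot_Un_change[OF fins E2, of i c ?c] W kap by linarith
  have "S0 \<union> W = V"
  proof (rule ccontr)
    assume "S0 \<union> W \<noteq> V"
    then have "S0 \<union> W \<subset> V" using S0 W by auto
    then show False using min[of "S0 \<union> W"] S0 lt by auto
  qed
  then show ?thesis using lt min[OF S] by auto
qed

lemma load_remove_edge:
  assumes "finite V" "u \<noteq> z"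
  shows "load E V f y \<le> load (E - {{u, z}}) V f y + (if y \<in> {u, z} \<and> X u (f u) z (f z) then 1 else 0)"
proof -
  let ?s = "\<lambda>E. {v \<in> V. {y, v} \<in> E \<and> X y (f y) v (f v)}"
  let ?o = "if y = u then z else u"
  show ?thesis
  proof (cases "y \<in> {u, z} \<and> X u (f u) z (f z)")
    case True
    have "?s E \<subseteq> insert ?o (?s (E - {{u, z}}))" using True by (auto simp: doubleton_eq_iff)
    then have "card (?s E) \<le> card (insert ?o (?s (E - {{u, z}})))"
      by (rule card_mono[rotated]) (use assms in simp)
    also have "\<dots> \<le> card (?s (E - {{u, z}})) + 1" using assms by (simp add: card_insert_if)
    finally show ?thesis using True by (simp add: load_def)
  next
    case False
    then have no: "\<not> (y \<in> {u, z} \<and> X u (f u) z (f z))" .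
    have "?s E \<subseteq> ?s (E - {{u, z}})"
    proof
      fix v assume v: "v \<in> ?s E"
      then have "{y, v} \<noteq> {u, z}" using no X_sym by (auto simp: doubleton_eq_iff)
      then show "v \<in> ?s (E - {{u, z}})" using v by auto
    qed
    then have "card (?s E) \<le> card (?s (E - {{u, z}}))"
      by (rule card_mono[rotated]) (use assms in simp)
    then show ?thesis by (simp add: load_def)
  qed
qed

text \<open>Puts a deleted edge \<open>uz\<close> back: if the chosen nodes conflict along it, each
  end has kept one unit in reserve.\<close>

lemma col_add_edge:
  assumes "finite V" "u \<noteq> z" and col: "col V (E - {{u, z}}) c' f"
    and le: "\<And>y \<beta>. y \<in> V \<Longrightarrow> c' y \<beta> \<le> c y \<beta>"
    and conf: "X u (f u) z (f z) \<Longrightarrow> u \<in> V \<Longrightarrow> z \<in> V \<Longrightarrow> c' u (f u) \<le> c u (f u) - 1 \<and> c' z (f z) \<le> c z (f z) - 1"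
    and uz: "u \<in> V" "z \<in> V"
  shows "col V E c f"
  unfolding col_def
proof
  fix y assume y: "y \<in> V"
  have "int (load (E - {{u, z}}) V f y) \<le> c' y (f y)" using col y by (simp add: col_def)
  then show "int (load E V f y) \<le> c y (f y)"
    using load_remove_edge[OF assms(1,2), of E f y] le[OF y, of "f y"] conf uz
    by (auto split: if_splits)
qed

end

section \<open>Minimal counterexamples\<close>

text \<open>\<open>IH\<close> is applied both to proper subsets with lowered capacities and to
  graphs with an edge deleted, hence the edges in the measure. The cover \<open>X\<close> stays
  fixed, because removing an edge from \<open>E\<close> already disables it.\<close>

locale min_counterexample = dp_cover X i
  for X :: "'a \<Rightarrow> bool \<Rightarrow> 'a \<Rightarrow> bool \<Rightarrow> bool" and i +
  fixes V :: "'a set" and E :: "'a set set" and c :: "'a \<Rightarrow> bool \<Rightarrow> int"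
  assumes fin: "finite V" and E2: "\<forall>e\<in>E. card e = 2" and val: "valid i V c"
    and gd: "good i E V c" and nc: "\<nexists>f. col V E c f"
    and IH: "\<And>V' E' c'. finite V' \<Longrightarrow> \<forall>e\<in>E'. card e = 2 \<Longrightarrow> valid i V' c' \<Longrightarrow> good i E' V' c' \<Longrightarrow>
      card V' + card {e \<in> E'. e \<subseteq> V'} < card V + card {e \<in> E. e \<subseteq> V} \<Longrightarrow> \<exists>f. col V' E' c' f"
begin

section \<open>Reservations, usable nodes and small degrees in a minimal counterexample\<close>

abbreviation P :: "'a set \<Rightarrow> int" where "P S \<equiv> pot i E c S"
abbreviation \<kappa> :: "'a \<Rightarrow> int" where "\<kappa> v \<equiv> kap i (c v)"

lemma fin_sub: "S \<subseteq> V \<Longrightarrow> finite S"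
  using fin finite_subset by blast

lemma no_loop: "{v, v} \<notin> E" using E2 by force

lemma val_D: "v \<in> V \<Longrightarrow> - 1 \<le> c v \<beta>" "v \<in> V \<Longrightarrow> c v False \<le> i"
  using val by (cases \<beta>; auto simp: valid_def)+

lemma IH_sub:
  assumes "V' \<subset> V" "valid i V' c'" "good i E V' c'"
  shows "\<exists>f. col V' E c' f"
proof (rule IH)
  have "card V' < card V" using assms(1) fin by (simp add: psubset_card_mono)
  moreover have "card {e \<in> E. e \<subseteq> V'} \<le> card {e \<in> E. e \<subseteq> V}"
    using assms(1) finite_edges_within[OF fin] by (intro card_mono) auto
  ultimately show "card V' + card {e \<in> E. e \<subseteq> V'} < card V + card {e \<in> E. e \<subseteq> V}" by linarith
qed (use assms E2 fin_sub in auto)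

lemma IH_edge:
  assumes "V' \<subseteq> V" "{u, z} \<in> E" "u \<in> V" "z \<in> V" "valid i V' c'" "good i (E - {{u, z}}) V' c'"
  shows "\<exists>f. col V' (E - {{u, z}}) c' f"
proof (rule IH)
  have "card V' \<le> card V" using assms(1) fin by (simp add: card_mono)
  moreover have "card {e \<in> E - {{u, z}}. e \<subseteq> V'} < card {e \<in> E. e \<subseteq> V}"
    using assms finite_edges_within[OF fin] by (intro psubset_card_mono) auto
  ultimately show "card V' + card {e \<in> E - {{u, z}}. e \<subseteq> V'} < card V + card {e \<in> E. e \<subseteq> V}" by linarith
qed (use assms E2 fin_sub in auto)

lemma col_sub: "S \<subset> V \<Longrightarrow> \<exists>f. col S E c f"
  using IH_sub valid_subset[OF val] good_subset[OF gd] by blast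

lemma gap: "S \<noteq> {} \<Longrightarrow> S \<subset> V \<Longrightarrow> P V + 1 \<le> P S"
  using pot_gap[OF fin E2 val nc col_sub IH_sub] by blast

lemma P_ge: "S \<noteq> {} \<Longrightarrow> S \<subseteq> V \<Longrightarrow> P V \<le> P S"
  using gap[of S] by (cases "S = V") (simp_all add: psubset_eq)

lemma P_kap: "v \<in> V \<Longrightarrow> 0 \<le> P V + \<kappa> v"
  using gd by (auto simp: good_def)

text \<open>The budget \<open>P W + \<kappa> v\<close> is exactly the slack of \<open>good\<close>;
  by \<open>pot_reserve\<close>, withholding units within it keeps the rest good.\<close>

lemma reserve_col:
  assumes "S \<subset> V" and dec: "\<And>v \<beta>. v \<in> S \<Longrightarrow> c' v \<beta> \<le> c v \<beta> \<and> - 1 \<le> c' v \<beta>"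
    and budget: "\<And>W v. W \<subseteq> S \<Longrightarrow> v \<in> W \<Longrightarrow>
      (\<Sum>v\<in>W. (c v False - c' v False) + (c v True - c' v True)) \<le> P W + \<kappa> v"
  shows "\<exists>f. col S E c' f"
proof (rule IH_sub[OF assms(1)])
  show "valid i S c'" unfolding valid_def
  proof
    fix v assume v: "v \<in> S"
    then show "- 1 \<le> c' v False \<and> c' v False \<le> i \<and> - 1 \<le> c' v True"
      using dec[OF v, of False] dec[OF v, of True] val_D(2)[of v] assms(1) by auto
  qed
  show "good i E S c'"
    unfolding good_def
  proof (intro allI impI ballI)
    fix W v assume W: "W \<subseteq> S" "v \<in> W"
    have "finite W" using W assms(1) fin_sub by auto
    then show "0 \<le> pot i E c' W + kap i (c' v)"
      using pot_reserve(2)[OF _ i_pos, of W c' c v E] dec W budget[OF W] by force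
  qed
qed

lemma extend_free:
  assumes v: "v \<in> V" and col: "col (V - {v}) E c f" and free: "\<And>x. x \<in> V \<Longrightarrow> {v, x} \<in> E \<Longrightarrow> \<not> X v \<beta> x (f x)"
    and cap: "0 \<le> c v \<beta>"
  shows False
proof -
  let ?f = "f(v := \<beta>)"
  have "load E V ?f y = load E (V - {v}) f y" if "y \<in> V" "y \<noteq> v" for y
  proof -
    have "load E V ?f y = load E (V - {v}) ?f y" unfolding load_def
      using free[of y] that X_sym[of y "f y" v \<beta>] by (intro arg_cong[where f = card]) (auto simp: insert_commute)
    then show ?thesis using load_cong[of ?f y f "V - {v}" E] that by auto
  qed
  moreover have "load E V ?f v = 0" using free no_loop by (intro load_zero) (auto split: if_splits)
  ultimately have "col V E c ?f" using col cap unfolding col_def by auto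
  then show False using nc by blast
qed

lemma ex_nbr:
  assumes "u \<in> V" "0 \<le> c u \<beta>"
  shows "\<exists>z\<in>V. {u, z} \<in> E"
proof (rule ccontr)
  assume none: "\<not> ?thesis"
  obtain f where "col (V - {u}) E c f" using col_sub[of "V - {u}"] assms by auto
  then show False using extend_free[OF assms(1)] none assms(2) by blast
qed

text \<open>Otherwise \<open>u\<close> has only one usable node, so an edge at \<open>u\<close> can be replaced by reserving one
  unit of capacity at each of the two nodes it may put in conflict.\<close>
lemma alive:
  assumes u: "u \<in> V"
  shows "0 \<le> c u \<gamma>"
proof (rule ccontr)
  assume "\<not> 0 \<le> c u \<gamma>"
  then have dead: "c u \<gamma> = - 1" using val_D(1)[OF u, of \<gamma>] by simp
  define \<alpha> where "\<alpha> = (\<not> \<gamma>)"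
  have Pu: "P {u} = wt i (c u)" using pot_insert[of "{}" u E i c] E2 by (simp add: nbrs_def)
  have "0 \<le> P {u} + \<kappa> u" using gd u by (auto simp: good_def)
  then have "0 \<le> c u \<alpha>" using dead unfolding Pu kap_def \<alpha>_def by (cases \<gamma>) auto
  \<comment> \<open>With a single usable node of capacity 0, both \<open>P {u}\<close> and
    \<open>\<kappa> u\<close> vanish, and the gap would make \<open>P V + \<kappa> u\<close>
    negative.\<close>
  have "c u \<alpha> \<noteq> 0"
  proof
    assume 0: "c u \<alpha> = 0"
    have w: "wt i (c u) = 0" "\<kappa> u = 0"
      using dead 0 i_pos unfolding \<alpha>_def by (cases \<gamma>; auto simp: wt_def kap_def)+
    show False
    proof (cases "V = {u}")
      case True
      then show False using ex_nbr[OF u, of \<alpha>] 0 no_loop by auto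
    next
      case False
      then show False using gap[of "{u}"] P_kap[OF u] w Pu u by auto
    qed
  qed
  then have cap: "1 \<le> c u \<alpha>" using \<open>0 \<le> c u \<alpha>\<close> by simp
  obtain z where z: "z \<in> V" "{u, z} \<in> E" using ex_nbr[OF u, of \<alpha>] cap by auto
  have uz: "u \<noteq> z" using z no_loop by auto
  define c' where "c' = (\<lambda>y \<beta>. c y \<beta> - (if y = u \<and> \<beta> = \<alpha> \<or> y = z \<and> X u \<alpha> z \<beta> \<and> 0 \<le> c z \<beta> then 1 else 0))"
  have dec: "c' y \<beta> \<le> c y \<beta> \<and> - 1 \<le> c' y \<beta>" if "y \<in> V" for y \<beta>
    using val_D(1)[OF that, of \<beta>] cap by (auto simp: c'_def)
  have \<delta>: "(c y False - c' y False) + (c y True - c' y True) \<le> (if y = u then 1 else 0) + (if y = z then 1 else 0)"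
    for y
  proof -
    have "\<not> (X u \<alpha> z False \<and> X u \<alpha> z True)" using X_fun by blast
    then show ?thesis using uz by (cases \<alpha>) (auto simp: c'_def)
  qed
  have "\<exists>f. col V (E - {{u, z}}) c' f"
  proof (rule IH_edge[OF _ z(2) u z(1)])
    show "valid i V c'"
      using dec val_D(2) unfolding valid_def by (meson order_trans)
    show "good i (E - {{u, z}}) V c'"
      unfolding good_def
    proof (intro allI impI ballI)
      fix W v assume W: "W \<subseteq> V" "v \<in> W"
      have fW: "finite W" using W fin_sub by auto
      have "(\<Sum>y\<in>W. (c y False - c' y False) + (c y True - c' y True)) \<le> (\<Sum>y\<in>W. (if y = u then 1 else 0) + (if y = z then 1 else 0))"
        by (rule sum_mono) (rule \<delta>)
      also have "\<dots> = (if u \<in> W then 1 else 0) + (if z \<in> W then 1 else 0)"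
        using fW by (simp add: sum.distrib)
      finally have "pot i (E - {{u, z}}) c W + \<kappa> v \<le> pot i (E - {{u, z}}) c' W + kap i (c' v)
          + ((if u \<in> W then 1 else 0) + (if z \<in> W then 1 else 0))"
        using pot_reserve(2)[OF fW i_pos, of c' c v "E - {{u, z}}"] dec W by force
      moreover have "P W + (if u \<in> W \<and> z \<in> W then i + 1 else 0) = pot i (E - {{u, z}}) c W"
        using pot_remove_edge[OF fW z(2), of i c] by simp
      \<comment> \<open>If both ends lie in \<open>W\<close>, two units are withheld but the deleted
        edge refunds \<open>i + 1\<close>, which is at least 2; if only one does, \<open>W\<close>
        is proper and the gap pays for the single unit.\<close>
      moreover have "0 \<le> P V + \<kappa> v" "P V \<le> P W" using P_kap P_ge W by auto
      moreover have "P V + 1 \<le> P W" if "u \<notin> W \<or> z \<notin> W" using gap[of W] W that u z by auto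
      ultimately show "0 \<le> pot i (E - {{u, z}}) c' W + kap i (c' v)"
        using i_pos by (auto split: if_splits)
    qed
  qed simp
  then obtain f where f: "col V (E - {{u, z}}) c' f" by blast
  have "f u = \<alpha>"
  proof (rule ccontr)
    assume "f u \<noteq> \<alpha>"
    then have "c' u (f u) = - 1" using dead uz by (auto simp: c'_def \<alpha>_def)
    then show False using col_capacity_nonneg[OF f u] by simp
  qed
  have "col V E c f"
  proof (rule col_add_edge[OF fin uz f])
    assume "X u (f u) z (f z)"
    then show "c' u (f u) \<le> c u (f u) - 1 \<and> c' z (f z) \<le> c z (f z) - 1"
      using col_capacity_nonneg[OF f z(1)] \<open>f u = \<alpha>\<close> dec[OF z(1), of "f z"] by (auto simp: c'_def)
  qed (use dec u z in auto)
  then show False using nc by blast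
qed

lemma kap_ge_i: "v \<in> V \<Longrightarrow> i \<le> \<kappa> v"
  using kap_alive[of i "c v"] alive i_pos by auto

lemma wt_alive: "v \<in> V \<Longrightarrow> wt i (c v) = 1 - i + c v False + min (c v True) (2 * i)"
  using alive[of v False] alive[of v True] by (simp add: wt_def)

lemma wt_le_2i: "v \<in> V \<Longrightarrow> wt i (c v) \<le> 2 * i + 1"
  using wt_le[OF i_pos, of "c v"] val_D by auto

lemma degree_ge_2:
  assumes v: "v \<in> V"
  shows "2 \<le> card (nbrs E v V)"
proof (rule ccontr)
  assume "\<not> ?thesis"
  then have "card (nbrs E v V) \<le> 1" by simp
  moreover obtain x where x: "x \<in> V" "{v, x} \<in> E" using ex_nbr[OF v alive[OF v]] by blast
  ultimately have only: "y = x" if "y \<in> V" "{v, y} \<in> E" for y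
    using that fin card_le_Suc0_iff_eq[of "nbrs E v V"] by (auto simp: nbrs_def)
  obtain f where f: "col (V - {v}) E c f" using col_sub[of "V - {v}"] v by auto
  obtain \<beta> where "\<not> X v \<beta> x (f x)" using X_avoid by blast
  then show False using extend_free[OF v f, of \<beta>] only alive[OF v] by blast
qed

end

lemma card_fibres:
  assumes "finite M" "finite W"
  shows "(\<Sum>y\<in>W. card {v \<in> M. z v = y}) = card {v \<in> M. z v \<in> W}"
proof -
  have "{v \<in> M. z v \<in> W} = (\<Union>y\<in>W. {v \<in> M. z v = y})" by auto
  then show ?thesis using assms by (subst card_UN_disjoint[symmetric]) auto
qed

lemma card_le_if: "A \<subseteq> (if Q then {a} else {}) \<Longrightarrow> card A \<le> (if Q then 1 else 0)"
  using card_mono[of "{a}" A] by (auto split: if_splits)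

context dp_cover
begin

text \<open>As in \<open>kill_extend\<close>, except that \<open>v\<close> is exempt: the one
  conflict that may cross runs along \<open>vx\<close>, and it is tolerated if both ends have a unit
  to spare.\<close>

lemma kill_extend_except:
  assumes "finite V" "S \<subseteq> V" and \<phi>: "col S E c \<phi>" and \<psi>: "col (V - S) E c' \<psi>"
    and v: "v \<in> V - S" and only: "nbrs E v S = {x}"
    and kl: "\<And>y. y \<in> V - S \<Longrightarrow> y \<noteq> v \<Longrightarrow> c' y = kill E S \<phi> c y"
    and le: "c' v (\<psi> v) \<le> c v (\<psi> v)"
    and conf: "X v (\<psi> v) x (\<phi> x) \<Longrightarrow> c' v (\<psi> v) \<le> c v (\<psi> v) - 1 \<and> int (load E S \<phi> x) \<le> c x (\<phi> x) - 1"
  shows "col V E c (\<lambda>x. if x \<in> S then \<phi> x else \<psi> x)"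
proof -
  define f where "f = (\<lambda>x. if x \<in> S then \<phi> x else \<psi> x)"
  have f: "f x = \<phi> x" if "x \<in> S" for x using that by (simp add: f_def)
  have f': "f x = \<psi> x" if "x \<notin> S" for x using that by (simp add: f_def)
  have fin: "finite S" "finite (V - S)" using assms finite_subset by auto
  have x: "x \<in> S" "{v, x} \<in> E" using only by (auto simp: nbrs_def)
  have vx: "u = x" if "u \<in> S" "{v, u} \<in> E" for u using only that by (auto simp: nbrs_def)
  have no: "\<not> X w (\<psi> w) u (\<phi> u)" if "u \<in> S" "w \<in> V - S" "w \<noteq> v" "{w, u} \<in> E" for u w
    using col_capacity_nonneg[OF \<psi> that(2)] kl[OF that(2,3)] that by (auto simp: kill_def split: if_splits)
  have l: "load E V f u = load E S f u + load E (V - S) f u" for u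
    using load_Un[OF fin, of E f u] assms by (simp add: Un_absorb1)
  have conf': "X x (\<phi> x) v (\<psi> v) \<longleftrightarrow> X v (\<psi> v) x (\<phi> x)" using X_sym by blast
  have "col V E c f" unfolding col_def
  proof
    fix u assume u: "u \<in> V"
    show "int (load E V f u) \<le> c u (f u)"
    proof (cases "u \<in> S")
      case True
      have 1: "load E S f u = load E S \<phi> u" by (rule load_cong) (use True f in auto)
      have 2: "int (load E S \<phi> u) \<le> c u (\<phi> u)" using \<phi> True by (simp add: col_def)
      have 3: "{w \<in> V - S. {u, w} \<in> E \<and> X u (f u) w (f w)} \<subseteq> (if u = x \<and> X v (\<psi> v) x (\<phi> x) then {v} else {})"
      proof
        fix w assume w: "w \<in> {w \<in> V - S. {u, w} \<in> E \<and> X u (f u) w (f w)}"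
        then have w': "w \<in> V - S" "{w, u} \<in> E" "X w (\<psi> w) u (\<phi> u)"
          using True X_sym f[of u] f'[of w] by (auto simp: insert_commute)
        then have "w = v" using no[OF True] by blast
        then show "w \<in> (if u = x \<and> X v (\<psi> v) x (\<phi> x) then {v} else {})" using w' vx True by auto
      qed
      have "load E (V - S) f u \<le> (if u = x \<and> X v (\<psi> v) x (\<phi> x) then 1 else 0)"
        unfolding load_def by (rule card_le_if[OF 3])
      then show ?thesis using l[of u] 1 2 f[OF True] conf by (auto split: if_splits)
    next
      case False
      then have u': "u \<in> V - S" using u by auto
      have 1: "load E (V - S) f u = load E (V - S) \<psi> u" by (rule load_cong) (use False f' in auto)
      have 2: "int (load E (V - S) \<psi> u) \<le> c' u (\<psi> u)" using \<psi> u' by (auto simp: col_def)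
      show ?thesis
      proof (cases "u = v")
        case True
        have 3: "{w \<in> S. {u, w} \<in> E \<and> X u (f u) w (f w)} \<subseteq> (if X v (\<psi> v) x (\<phi> x) then {x} else {})"
          using True False vx f f' by auto
        have "load E S f u \<le> (if X v (\<psi> v) x (\<phi> x) then 1 else 0)"
          unfolding load_def by (rule card_le_if[OF 3])
        then show ?thesis using l[of u] 1 2 True f'[OF False] conf le by (auto split: if_splits)
      next
        case neq: False
        have "load E S f u = 0"
          by (rule load_zero) (use False neq u' no f f' in auto)
        moreover have "kill E S \<phi> c u (\<psi> u) = c u (\<psi> u)"
          using no neq u' by (auto simp: kill_def)
        ultimately show ?thesis using l[of u] 1 2 f'[OF False] kl[OF u' neq] by simp
      qed
    qed
  qed
  then show ?thesis by (simp add: f_def)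
qed

end

section \<open>The degree-two vertices in \<open>B\<close> and sets of potential
  \<open>P V + 1\<close>\<close>

context min_counterexample
begin

definition B :: "'a set" where
  "B = {v \<in> V. card (nbrs E v V) = 2 \<and> 1 \<le> c v False \<and> 1 \<le> c v True}"

lemma B_V: "v \<in> B \<Longrightarrow> v \<in> V" by (simp add: B_def)

lemma B_cap: "v \<in> B \<Longrightarrow> 1 \<le> c v \<beta>" by (cases \<beta>) (auto simp: B_def)

lemma B_other:
  assumes "v \<in> B" "x \<in> V" "{v, x} \<in> E"
  obtains y where "y \<in> V" "y \<noteq> x" "nbrs E v V = {x, y}"
proof -
  have "card (nbrs E v V) = 2" using assms by (simp add: B_def)
  then obtain a b where ab: "nbrs E v V = {a, b}" "a \<noteq> b" by (auto simp: card_2_iff)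
  have "x \<in> nbrs E v V" using assms by (simp add: nbrs_def)
  then consider "x = a" | "x = b" using ab by auto
  then show thesis
  proof cases
    case 1 then show thesis using that[of b] ab nbrs_subset[of E v V] by auto
  next
    case 2 then show thesis using that[of a] ab nbrs_subset[of E v V] by auto
  qed
qed

lemma extend_general:
  assumes "T \<subseteq> V" and "\<And>t. t \<in> T \<Longrightarrow> int (load E T f t + load E (V - T) f t) \<le> c t (f t)"
    and "\<And>d. d \<in> V - T \<Longrightarrow> int (load E V f d) \<le> c d (f d)"
  shows False
proof -
  have "load E V f t = load E T f t + load E (V - T) f t" for t
    using load_Un[of T "V - T" E f t] assms(1) fin_sub by (simp add: Un_absorb1)
  then have "col V E c f" using assms unfolding col_def by (metis DiffI)
  then show False using nc by blast
qed

text \<open>With one of its two neighbours avoided, \<open>v\<close> meets at most one conflict, and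
  either of its nodes tolerates one.\<close>

lemma B_load:
  assumes "v \<in> B" "x \<in> V" "{v, x} \<in> E" "\<not> X v (f v) x (f x)"
  shows "int (load E V f v) \<le> c v (f v)"
proof -
  obtain y where y: "y \<in> V" "y \<noteq> x" "nbrs E v V = {x, y}" using B_other[OF assms(1-3)] by blast
  have "w = x \<or> w = y" if "w \<in> V" "{v, w} \<in> E" for w using y(3) that by (auto simp: nbrs_def)
  then have "{w \<in> V. {v, w} \<in> E \<and> X v (f v) w (f w)} \<subseteq> {y}" using assms(4) by auto
  then have "load E V f v \<le> 1" unfolding load_def using card_mono[of "{y}"] by fastforce
  then show ?thesis using B_cap[OF assms(1), of "f v"] by linarith
qed

text \<open>Colour the rest first. Each of the two vertices can avoid its outer neighbour, and a
  conflict between them is within their capacities.\<close>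

lemma B_independent:
  assumes "v \<in> B" "v' \<in> B"
  shows "{v, v'} \<notin> E"
proof
  assume e: "{v, v'} \<in> E"
  then have vv: "v \<noteq> v'" using no_loop by auto
  have e': "{v', v} \<in> E" using e by (simp add: insert_commute)
  obtain x where x: "x \<in> V" "x \<noteq> v'" "nbrs E v V = {v', x}" using B_other[OF assms(1) B_V[OF assms(2)] e] .
  obtain y where y: "y \<in> V" "y \<noteq> v" "nbrs E v' V = {v, y}" using B_other[OF assms(2) B_V[OF assms(1)] e'] .
  have vx: "{v, x} \<in> E" "x \<noteq> v" using x no_loop by (auto simp: nbrs_def)
  have vy: "{v', y} \<in> E" "y \<noteq> v'" using y no_loop by (auto simp: nbrs_def)
  let ?T = "V - {v, v'}"
  have "?T \<subset> V" using B_V assms by auto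
  then obtain \<psi> where \<psi>: "col ?T E c \<psi>" using col_sub by blast
  obtain \<beta> where \<beta>: "\<not> X v \<beta> x (\<psi> x)" using X_avoid by blast
  obtain \<beta>' where \<beta>': "\<not> X v' \<beta>' y (\<psi> y)" using X_avoid by blast
  let ?f = "\<psi>(v := \<beta>, v' := \<beta>')"
  have D: "V - ?T = {v, v'}" using B_V assms by auto
  show False
  proof (rule extend_general[of ?T ?f])
    show "?T \<subseteq> V" by auto
  next
    fix t assume t: "t \<in> ?T"
    have 1: "load E ?T ?f t = load E ?T \<psi> t" by (rule load_cong) (use t in auto)
    have tv: "t = x" if "{t, v} \<in> E" using that x(3) t by (auto simp: nbrs_def insert_commute)
    have tv': "t = y" if "{t, v'} \<in> E" using that y(3) t by (auto simp: nbrs_def insert_commute)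
    have "load E (V - ?T) ?f t = 0" unfolding D
      by (rule load_zero) (use t tv tv' \<beta> \<beta>' X_sym vv in \<open>auto split: if_splits\<close>)
    then show "int (load E ?T ?f t + load E (V - ?T) ?f t) \<le> c t (?f t)"
      using 1 \<psi> t by (auto simp: col_def)
  next
    fix d assume "d \<in> V - ?T"
    then consider "d = v" | "d = v'" using D by blast
    then show "int (load E V ?f d) \<le> c d (?f d)"
    proof cases
      case 1
      show ?thesis unfolding 1 by (rule B_load[OF assms(1) x(1) vx(1)]) (use \<beta> vv vx x in auto)
    next
      case 2
      show ?thesis unfolding 2 by (rule B_load[OF assms(2) y(1) vy(1)]) (use \<beta>' vv vy y in auto)
    qed
  qed
qed

lemma wt_full:
  assumes "v \<in> V" "2 * i + 1 \<le> wt i (c v)"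
  shows "c v False = i" "2 * i \<le> c v True"
  using assms wt_alive[OF assms(1)] val_D(2)[OF assms(1)] by auto

text \<open>The edges at \<open>v\<close> cost at most \<open>wt i (c v) + 1\<close>, hence at most
  the price of two edges; as the degree is at least 2, equality holds and the weight is
  full.\<close>

lemma B_from:
  assumes v: "v \<in> V" and le: "P (V - {v}) \<le> P V + 1"
  shows "v \<in> B"
proof -
  let ?d = "card (nbrs E v V)"
  have nb: "nbrs E v (V - {v}) = nbrs E v V" using no_loop by (auto simp: nbrs_def)
  have "P V = P (V - {v}) + wt i (c v) - (i + 1) * int ?d"
    using pot_insert[of "V - {v}" v E i c] fin E2 v nb by (simp add: insert_absorb)
  then have *: "(i + 1) * int ?d \<le> wt i (c v) + 1" using le by linarith
  have d2: "2 \<le> ?d" using degree_ge_2[OF v] .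
  have "\<not> 3 \<le> ?d"
  proof
    assume "3 \<le> ?d"
    then have "(i + 1) * 3 \<le> (i + 1) * int ?d" using i_pos by (intro mult_left_mono) auto
    then show False using * wt_le_2i[OF v] i_pos by simp
  qed
  then have d: "?d = 2" using d2 by simp
  then have "2 * i + 1 \<le> wt i (c v)" using * by simp
  then show ?thesis using wt_full[OF v] d v i_pos by (simp add: B_def)
qed

text \<open>Two edges into \<open>S\<close> cost one more than the largest weight, so adding
  \<open>y\<close> uses up the margin of \<open>S\<close> over \<open>P V\<close>.\<close>

lemma gap_insert:
  assumes "S \<subseteq> V" "y \<in> V" "y \<notin> S" "2 \<le> card (nbrs E y S)" "P S \<le> P V + 1"
  shows "S = V - {y}" "y \<in> B"
proof -
  have "(i + 1) * 2 \<le> (i + 1) * int (card (nbrs E y S))" using assms i_pos by (intro mult_left_mono) auto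
  then have "P (insert y S) \<le> P V"
    using pot_insert[OF fin_sub[OF assms(1)] assms(3) E2, of i c] wt_le_2i[OF assms(2)] assms(5) by simp
  then have "insert y S = V" using gap[of "insert y S"] assms(1,2) by (metis insert_not_empty insert_subset less_irrefl linorder_not_le order_le_less zle_add1_eq_le)
  then show S: "S = V - {y}" using assms by auto
  then show "y \<in> B" using B_from assms by auto
qed

lemma bad_set:
  assumes "V' \<subset> V" "valid i V' c'" "\<nexists>f. col V' E c' f"
  obtains W where "W \<subseteq> V'" "W \<noteq> {}" "pot i E c' W \<le> - 1"
proof -
  have "\<not> good i E V' c'" using IH_sub assms by blast
  then obtain W v where W: "W \<subseteq> V'" "v \<in> W" "pot i E c' W + kap i (c' v) < 0"
    by (auto simp: good_def not_le)
  have "0 \<le> kap i (c' v)" using assms(2) W i_pos by (intro kap_nonneg) (auto simp: valid_def)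
  then show thesis using that[of W] W by auto
qed

lemma bad_set_edge:
  assumes "V' \<subseteq> V" "{u, z} \<in> E" "u \<in> V" "z \<in> V" "valid i V' c'" "\<nexists>f. col V' (E - {{u, z}}) c' f"
  obtains W where "W \<subseteq> V'" "W \<noteq> {}" "pot i (E - {{u, z}}) c' W \<le> - 1"
proof -
  have "\<not> good i (E - {{u, z}}) V' c'" using IH_edge[OF assms(1-5)] assms(6) by blast
  then obtain W v where W: "W \<subseteq> V'" "v \<in> W" "pot i (E - {{u, z}}) c' W + kap i (c' v) < 0"
    by (auto simp: good_def not_le)
  have "0 \<le> kap i (c' v)" using assms(5) W i_pos by (intro kap_nonneg) (auto simp: valid_def)
  then show thesis using that[of W] W by auto
qed

text \<open>The main step towards the improved gap: a vertex \<open>v\<close> sending one edge into a set \<open>S\<close> of potential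
  \<open>P V + 1\<close> can be forced to be rich at the price of one edge, and then has so much capacity that
  another edge \<open>vz\<close> can be deleted for one unit of capacity at \<open>z\<close>.\<close>
lemma tight_boundary:
  assumes S: "S \<noteq> {}" "S \<subset> V" "P S = P V + 1"
    and v: "v \<in> V - S" and only: "nbrs E v S = {x}"
  shows "v \<in> B"
proof -
  have finS: "finite S" using S fin_sub by auto
  have x: "x \<in> S" "{v, x} \<in> E" using only by (auto simp: nbrs_def)
  have vV: "v \<in> V" "v \<notin> S" using v by auto
  have sm: "V - S \<subset> V" using S by auto
  have card1: "card (nbrs E v S) = 1" using only by simp
  have alv: "0 \<le> c v True" "0 \<le> c v False" using alive vV by auto
  have val0: "- 1 \<le> c v False" "- 1 \<le> c v True" "c v False \<le> i" using val_D vV by auto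
  \<comment> \<open>The terms of the other vertices are nonnegative by \<open>kill_loss\<close>; the
    term of \<open>v\<close>, whose capacities are treated differently, is kept.\<close>
  have change: "P (S \<union> W) \<le> P S + pot i E c' W - (if v \<in> W then (i + 1) - (wt i (c v) - wt i (c' v)) else 0)"
    if W: "W \<subseteq> V - S" and kl: "\<And>y. y \<in> V - S \<Longrightarrow> y \<noteq> v \<Longrightarrow> c' y = kill E S \<phi> c y" for W c' \<phi>
  proof -
    let ?t = "\<lambda>y. (i + 1) * int (card (nbrs E y S)) - (wt i (c y) - wt i (c' y))"
    have fW: "finite W" "S \<inter> W = {}" using W fin_sub[of W] by auto
    have nn: "0 \<le> ?t y" if "y \<in> W" "y \<noteq> v" for y
      using kill_loss[OF finS val, of y E \<phi>] that W kl[of y] by auto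
    have "(if v \<in> W then ?t v else 0) \<le> (\<Sum>y\<in>W. ?t y)"
    proof (cases "v \<in> W")
      case True
      have "0 \<le> (\<Sum>y\<in>W - {v}. ?t y)" by (rule sum_nonneg) (use nn in auto)
      then show ?thesis using True fW by (simp add: sum.remove[of W v])
    next
      case False
      then have "0 \<le> ?t y" if "y \<in> W" for y using nn[of y] that by blast
      then have "0 \<le> (\<Sum>y\<in>W. ?t y)" by (rule sum_nonneg)
      then show ?thesis using False by simp
    qed
    then show ?thesis using pot_Un_change[OF finS fW E2, of i c c'] card1 by (auto split: if_splits)
  qed
  \<comment> \<open>Otherwise all colourings of \<open>S\<close> give \<open>x\<close> the same
    node, the one matched to the rich node of \<open>v\<close>, and one unit can be reserved there.
    Then \<open>v\<close> need not lose its rich node, only one unit of its capacity, which saves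
    \<open>i\<close> against the price of the edge \<open>vx\<close>.\<close>
  have "\<exists>\<phi>. col S E c \<phi> \<and> \<not> X x (\<phi> x) v True"
  proof (rule ccontr)
    assume "\<not> ?thesis"
    then have all: "X x (\<phi> x) v True" if "col S E c \<phi>" for \<phi> using that by blast
    obtain \<phi>0 where \<phi>0: "col S E c \<phi>0" using col_sub S by blast
    define c1 where "c1 = (\<lambda>y \<beta>. c y \<beta> - (if y = x \<and> \<beta> = \<phi>0 x then 1 else 0))"
    have "\<exists>\<phi>. col S E c1 \<phi>"
    proof (rule reserve_col)
      show "S \<subset> V" using S by auto
      show "c1 y \<beta> \<le> c y \<beta> \<and> - 1 \<le> c1 y \<beta>" if "y \<in> S" for y \<beta>
        using alive[of y \<beta>] that S by (auto simp: c1_def)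
      fix W v' assume W: "W \<subseteq> S" "v' \<in> W"
      have "(\<Sum>y\<in>W. (c y False - c1 y False) + (c y True - c1 y True)) \<le> (\<Sum>y\<in>W. if y = x then 1 else 0)"
        by (rule sum_mono) (auto simp: c1_def)
      also have "\<dots> \<le> 1" using W finS finite_subset[of W S] by simp
      also have "1 \<le> P W + \<kappa> v'"
      proof -
        have "W \<noteq> {}" "W \<subset> V" "v' \<in> V" using W S by auto
        then show ?thesis using gap[of W] P_kap[of v'] by linarith
      qed
      finally show "(\<Sum>y\<in>W. (c y False - c1 y False) + (c y True - c1 y True)) \<le> P W + \<kappa> v'" .
    qed
    then obtain \<phi> where \<phi>: "col S E c1 \<phi>" by blast
    then have \<phi>c: "col S E c \<phi>" by (rule col_mono) (auto simp: c1_def)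
    have "\<phi> x = \<phi>0 x" using X_inj[OF all[OF \<phi>c] all[OF \<phi>0]] .
    then have spare: "int (load E S \<phi> x) \<le> c x (\<phi> x) - 1"
      using \<phi> x by (auto simp: col_def c1_def)
    define c2 where "c2 = (\<lambda>y \<beta>. if y = v then c v \<beta> - (if \<beta> then 1 else 0) else kill E S \<phi> c y \<beta>)"
    have kl: "c2 y = kill E S \<phi> c y" if "y \<noteq> v" for y using that by (auto simp: c2_def)
    have "\<nexists>\<psi>. col (V - S) E c2 \<psi>"
    proof
      assume "\<exists>\<psi>. col (V - S) E c2 \<psi>"
      then obtain \<psi> where \<psi>: "col (V - S) E c2 \<psi>" by blast
      have "col V E c (\<lambda>x. if x \<in> S then \<phi> x else \<psi> x)"
      proof (rule kill_extend_except[OF fin _ \<phi>c \<psi> v only])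
        assume "X v (\<psi> v) x (\<phi> x)"
        then have "\<psi> v = True" using X_fun[OF all[OF \<phi>c]] X_sym by blast
        then show "c2 v (\<psi> v) \<le> c v (\<psi> v) - 1 \<and> int (load E S \<phi> x) \<le> c x (\<phi> x) - 1"
          using spare by (simp add: c2_def)
      qed (use S kl in \<open>auto simp: c2_def\<close>)
      then show False using nc by blast
    qed
    moreover have "valid i (V - S) c2"
      using kill_valid[OF val, of E S \<phi>] alv val0 by (auto simp: valid_def c2_def)
    ultimately obtain W where W: "W \<subseteq> V - S" "W \<noteq> {}" "pot i E c2 W \<le> - 1"
      using bad_set[OF sm] by blast
    have "wt i (c v) - wt i (c2 v) \<le> 1"
      using wt_reserve[OF i_pos, of "c2 v" "c v"] alv by (simp add: c2_def)
    then have "P (S \<union> W) \<le> P V - (if v \<in> W then i else 0)"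
      using change[OF W(1) kl] W S by (auto split: if_splits)
    moreover have "P V \<le> P (S \<union> W)" using P_ge[of "S \<union> W"] S W by auto
    moreover have "P V + 1 \<le> P (S \<union> W)" if "v \<notin> W" using gap[of "S \<union> W"] S W that vV by auto
    ultimately show False using i_pos by (auto split: if_splits)
  qed
  then obtain \<phi> where \<phi>: "col S E c \<phi>" and nx: "\<not> X x (\<phi> x) v True" by blast
  define c3 where "c3 = (\<lambda>y \<beta>. if y = v then (if \<beta> then c v True else - 1) else kill E S \<phi> c y \<beta>)"
  have kl: "c3 y = kill E S \<phi> c y" if "y \<noteq> v" for y using that by (auto simp: c3_def)
  have nc3: "\<nexists>\<psi>. col (V - S) E c3 \<psi>"
  proof
    assume "\<exists>\<psi>. col (V - S) E c3 \<psi>"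
    then obtain \<psi> where \<psi>: "col (V - S) E c3 \<psi>" by blast
    have \<psi>v: "\<psi> v = True" using col_capacity_nonneg[OF \<psi> v] by (auto simp: c3_def split: if_splits)
    have "col V E c (\<lambda>x. if x \<in> S then \<phi> x else \<psi> x)"
      by (rule kill_extend_except[OF fin _ \<phi> \<psi> v only]) (use S kl \<psi>v nx X_sym in \<open>auto simp: c3_def\<close>)
    then show False using nc by blast
  qed
  have val3: "valid i (V - S) c3"
    using kill_valid[OF val, of E S \<phi>] alv val0 i_pos by (auto simp: valid_def c3_def)
  have loss3: "wt i (c v) - wt i (c3 v) \<le> i + 1"
    using wt_kill[OF i_pos, of "c v" "c3 v" True] val0 by (simp add: c3_def)
  obtain W where W: "W \<subseteq> V - S" "W \<noteq> {}" "pot i E c3 W \<le> - 1"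
    using bad_set[OF sm val3 nc3] by blast
  have "P (S \<union> W) \<le> P V - (if v \<in> W then (i + 1) - (wt i (c v) - wt i (c3 v)) else 0)"
    using change[OF W(1) kl] W S by auto
  moreover have "P V \<le> P (S \<union> W)" using P_ge[of "S \<union> W"] S W by auto
  moreover have "P V + 1 \<le> P (S \<union> W)" if "v \<notin> W" using gap[of "S \<union> W"] S W that vV by auto
  ultimately have "i + 1 \<le> wt i (c v) - wt i (c3 v)" by (auto split: if_splits)
  \<comment> \<open>No room is left, so forcing \<open>v\<close> to be rich must cost exactly
    \<open>i + 1\<close>; the formula for \<open>wt\<close> allows this only at full weight.\<close>
  then have full: "c v False = i" "2 * i \<le> c v True"
    using alv val0 i_pos unfolding wt_def c3_def by (auto simp: min_def split: if_splits)
  obtain z where z: "z \<in> V" "{v, z} \<in> E" "z \<noteq> x"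
  proof -
    have "\<not> nbrs E v V \<subseteq> {x}"
      using degree_ge_2[OF vV(1)] card_mono[of "{x}" "nbrs E v V"] by auto
    then show thesis using that by (auto simp: nbrs_def)
  qed
  have zS: "z \<notin> S" using only z by (auto simp: nbrs_def)
  have vz: "v \<noteq> z" using z no_loop by auto
  let ?E = "E - {{v, z}}"
  \<comment> \<open>A lone rich node is credited with at most \<open>i\<close> while its capacity is
    at least \<open>2 * i\<close>, so the unit taken from \<open>v\<close> is free and only the one
    at \<open>z\<close> is paid for.\<close>
  define c4 where "c4 = (\<lambda>y \<beta>. c3 y \<beta> - (if y = v \<and> \<beta> \<or> y = z \<and> X v True z \<beta> \<and> 0 \<le> c3 z \<beta> then 1 else 0))"
  have lo3: "- 1 \<le> c3 y \<beta>" if "y \<in> V - S" for y \<beta>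
    using val3 that unfolding valid_def by (cases \<beta>) auto
  have lo4: "- 1 \<le> c4 y \<beta>" if "y \<in> V - S" for y \<beta>
    using lo3[OF that, of \<beta>] alv by (auto simp: c4_def c3_def)
  have dec4: "c4 y \<beta> \<le> c3 y \<beta>" for y \<beta> by (simp add: c4_def)
  have val4: "valid i (V - S) c4"
    using val3 dec4 lo4 unfolding valid_def by (meson order_trans)
  have "\<nexists>\<psi>. col (V - S) ?E c4 \<psi>"
  proof
    assume "\<exists>\<psi>. col (V - S) ?E c4 \<psi>"
    then obtain \<psi> where \<psi>: "col (V - S) ?E c4 \<psi>" by blast
    have zVS: "z \<in> V - S" using z zS by auto
    have \<psi>v: "\<psi> v = True"
      using col_capacity_nonneg[OF \<psi> v] vz by (cases "\<psi> v") (auto simp: c4_def c3_def)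
    have "col (V - S) E c3 \<psi>"
    proof (rule col_add_edge[OF _ vz \<psi>])
      assume "X v (\<psi> v) z (\<psi> z)"
      then show "c4 v (\<psi> v) \<le> c3 v (\<psi> v) - 1 \<and> c4 z (\<psi> z) \<le> c3 z (\<psi> z) - 1"
        using \<psi>v col_capacity_nonneg[OF \<psi> zVS] dec4[of z "\<psi> z"] by (auto simp: c4_def)
    qed (use fin v zVS dec4 in auto)
    then show False using nc3 by blast
  qed
  then obtain W' where W': "W' \<subseteq> V - S" "W' \<noteq> {}" "pot i ?E c4 W' \<le> - 1"
    using bad_set_edge[OF _ z(2) vV(1) z(1) val4] by blast
  have fW': "finite W'" using W' fin_sub[of W'] by auto
  have "wt i (c3 y) - wt i (c4 y) \<le> (if y = z then 1 else 0)" if y: "y \<in> W'" for y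
  proof -
    consider "y = v" | "y = z" | "y \<noteq> v" "y \<noteq> z" by blast
    then show ?thesis
    proof cases
      case 1
      then show ?thesis using full alv i_pos vz by (auto simp: wt_def c4_def c3_def min_def)
    next
      case 2
      have "\<not> (X v True z False \<and> X v True z True)" using X_fun by blast
      then have "(c3 z False - c4 z False) + (c3 z True - c4 z True) \<le> 1"
        using vz by (auto simp: c4_def)
      moreover have "wt i (c3 z) - wt i (c4 z) \<le> (c3 z False - c4 z False) + (c3 z True - c4 z True)"
        by (rule wt_reserve[OF i_pos]) (use dec4 lo4 z zS in auto)
      ultimately show ?thesis using 2 by simp
    next
      case 3
      then have "c4 y = c3 y" by (auto simp: c4_def)
      then show ?thesis using 3 by simp
    qed
  qed
  then have "(\<Sum>y\<in>W'. wt i (c3 y) - wt i (c4 y)) \<le> (\<Sum>y\<in>W'. if y = z then 1 else 0)"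
    by (rule sum_mono)
  then have "pot i ?E c3 W' \<le> pot i ?E c4 W' + (if z \<in> W' then 1 else 0)"
    using fW' by (simp add: pot_def sum_subtractf)
  moreover have "pot i ?E c3 W' = pot i E c3 W' + (if v \<in> W' \<and> z \<in> W' then i + 1 else 0)"
    using pot_remove_edge[OF fW' z(2)] .
  moreover have "P (S \<union> W') \<le> P S + pot i E c3 W'"
    using change[OF W'(1) kl] loss3 by (auto split: if_splits)
  ultimately have *: "P (S \<union> W') \<le> P V + (if z \<in> W' then 1 else 0) - (if v \<in> W' \<and> z \<in> W' then i + 1 else 0)"
    using W' S by (auto split: if_splits)
  have "P V \<le> P (S \<union> W')" using P_ge[of "S \<union> W'"] S W' by auto
  moreover have "P V + 1 \<le> P (S \<union> W')" if "z \<notin> W'"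
    using gap[of "S \<union> W'"] S W' that zS z by auto
  \<comment> \<open>Were \<open>v\<close> in \<open>W'\<close> as well, the \<open>i + 1\<close> for
    the edge \<open>vz\<close> would push the potential below \<open>P V\<close>. So
    \<open>v\<close> stays outside and has the two neighbours \<open>x\<close> and \<open>z\<close>
    in \<open>S \<union> W'\<close>.\<close>
  ultimately have zW: "z \<in> W'" "v \<notin> W'" using * i_pos by (auto split: if_splits)
  have "{x, z} \<subseteq> nbrs E v (S \<union> W')" using x z zW by (auto simp: nbrs_def)
  then have "card {x, z} \<le> card (nbrs E v (S \<union> W'))"
    using finS fW' by (intro card_mono) auto
  then have "2 \<le> card (nbrs E v (S \<union> W'))" using z by simp
  then show ?thesis using gap_insert(2)[of "S \<union> W'" v] S W' vV zW * by auto
qed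

end

lemma union_closed_greatest:
  assumes "finite F" "F \<noteq> {}" "\<And>A B. A \<in> F \<Longrightarrow> B \<in> F \<Longrightarrow> A \<union> B \<in> F"
  shows "\<exists>M\<in>F. \<forall>A\<in>F. A \<subseteq> M"
proof -
  obtain M where M: "M \<in> F" "\<And>A. A \<in> F \<Longrightarrow> M \<subseteq> A \<Longrightarrow> A = M"
    using finite_has_maximal[OF assms(1,2)] by blast
  have "A \<subseteq> M" if "A \<in> F" for A using M(2)[OF assms(3)[OF M(1) that]] by blast
  then show ?thesis using M(1) by blast
qed

lemma pot_le_sum: "0 \<le> i \<Longrightarrow> pot i E c S \<le> (\<Sum>v\<in>S. wt i (c v))"
  by (simp add: pot_def)

context min_counterexample
begin

text \<open>Apart from the trivial case \<open>S = V - {v}\<close>, all edges leaving \<open>S\<close> end in \<open>B\<close>. Vertices of \<open>B\<close>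
  can avoid the colour of their neighbour in \<open>S\<close>, passing at most one conflict on to the other side.\<close>
lemma tight:
  assumes S: "S \<noteq> {}" "S \<subset> V" "P S = P V + 1"
  shows "\<exists>v\<in>B. S = V - {v}"
proof (rule ccontr)
  assume neg: "\<not> ?thesis"
  have finS: "finite S" using S fin_sub by auto
  have one: "card (nbrs E y S) \<le> 1" if "y \<in> V - S" for y
  proof (rule ccontr)
    assume "\<not> ?thesis"
    then show False using gap_insert[of S y] S that neg by auto
  qed
  define M where "M = {v \<in> V - S. nbrs E v S \<noteq> {}}"
  define U where "U = V - S - M"
  have MV: "M \<subseteq> V" and finM: "finite M" and finU: "finite U" and UV: "U \<subset> V"
    using fin S by (auto simp: M_def U_def)
  have ex: "\<exists>x z. nbrs E v S = {x} \<and> v \<in> B \<and> z \<in> U \<and> nbrs E v V = {x, z}" if v: "v \<in> M" for v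
  proof -
    have vV: "v \<in> V - S" "nbrs E v S \<noteq> {}" using v by (auto simp: M_def)
    then have "card (nbrs E v S) = 1" using one[OF vV(1)] finS by (simp add: card_gt_0_iff le_eq_less_or_eq)
    then obtain x where x: "nbrs E v S = {x}" by (rule card_1_singletonE)
    have vB: "v \<in> B" using tight_boundary[OF S vV(1) x] .
    have xV: "x \<in> S" "{v, x} \<in> E" using x by (auto simp: nbrs_def)
    then obtain z where z: "z \<in> V" "z \<noteq> x" "nbrs E v V = {x, z}" using B_other[OF vB, of x] S by blast
    have vz: "{v, z} \<in> E" using z by (auto simp: nbrs_def)
    have "z \<notin> S" using x vz z by (auto simp: nbrs_def)
    moreover have "z \<notin> M"
    proof
      assume "z \<in> M"
      then have zV: "z \<in> V - S" "nbrs E z S \<noteq> {}" by (auto simp: M_def)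
      then have "card (nbrs E z S) = 1" using one[OF zV(1)] finS by (simp add: card_gt_0_iff le_eq_less_or_eq)
      then obtain x' where x': "nbrs E z S = {x'}" by (rule card_1_singletonE)
      have "z \<in> B" using tight_boundary[OF S zV(1) x'] .
      then show False using B_independent[OF vB] vz by blast
    qed
    ultimately have "z \<in> U" using z by (simp add: U_def)
    then show ?thesis using x vB z by blast
  qed
  then obtain x z where xz: "\<And>v. v \<in> M \<Longrightarrow> nbrs E v S = {x v} \<and> v \<in> B \<and> z v \<in> U \<and> nbrs E v V = {x v, z v}"
    by metis
  obtain \<phi> where \<phi>: "col S E c \<phi>" using col_sub S by blast
  have "\<exists>\<beta>. \<not> X v \<beta> (x v) (\<phi> (x v))" for v by (rule X_avoid)
  then obtain g where g: "\<And>v. \<not> X v (g v) (x v) (\<phi> (x v))" by metis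
  \<comment> \<open>As \<open>g v\<close> avoids the colour of \<open>x v\<close>, a vertex
    \<open>v\<close> of \<open>M\<close> can collide only with \<open>z v\<close>. All connections
    between \<open>S\<close> and \<open>U\<close> pass through \<open>M\<close>, so it suffices to
    reserve \<open>D\<close> on \<open>U\<close>.\<close>
  define D where "D = (\<lambda>y \<beta>. card {v \<in> M. z v = y \<and> X v (g v) y \<beta>})"
  define c5 where "c5 = (\<lambda>y \<beta>. max (- 1) (c y \<beta> - int (D y \<beta>)))"
  have Dle: "D y False + D y True \<le> card {v \<in> M. z v = y}" for y
  proof -
    have "D y False + D y True = card ({v \<in> M. z v = y \<and> X v (g v) y False} \<union> {v \<in> M. z v = y \<and> X v (g v) y True})"
      unfolding D_def
    proof (rule card_Un_disjoint[symmetric])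
      show "{v \<in> M. z v = y \<and> X v (g v) y False} \<inter> {v \<in> M. z v = y \<and> X v (g v) y True} = {}"
        using X_fun by blast
    qed (use finM in auto)
    also have "\<dots> \<le> card {v \<in> M. z v = y}" using finM by (intro card_mono) auto
    finally show ?thesis .
  qed
  have "\<exists>\<psi>. col U E c5 \<psi>"
  proof (rule reserve_col[OF UV])
    show "c5 y \<beta> \<le> c y \<beta> \<and> - 1 \<le> c5 y \<beta>" if "y \<in> U" for y \<beta>
      using alive[of y \<beta>] that UV by (auto simp: c5_def)
  next
    fix W v' assume W: "W \<subseteq> U" "v' \<in> W"
    have finW: "finite W" using W finU finite_subset by blast
    define A where "A = {v \<in> M. z v \<in> W}"
    have finA: "finite A" using finM by (simp add: A_def)
    have "(\<Sum>y\<in>W. (c y False - c5 y False) + (c y True - c5 y True)) \<le> (\<Sum>y\<in>W. int (card {v \<in> M. z v = y}))"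
    proof (rule sum_mono)
      fix y
      have "(c y False - c5 y False) + (c y True - c5 y True) \<le> int (D y False + D y True)"
        by (simp add: c5_def)
      then show "(c y False - c5 y False) + (c y True - c5 y True) \<le> int (card {v \<in> M. z v = y})"
        using Dle[of y] by linarith
    qed
    also have "\<dots> = int (card A)" unfolding A_def using card_fibres[OF finM finW, of z] by (simp flip: of_nat_sum)
    \<comment> \<open>Adding \<open>A\<close> to \<open>S \<union> W\<close> gains at most
      \<open>2 * i + 1\<close> per vertex and pays for two edges each, so every vertex of
      \<open>A\<close> lowers the potential; it starts at \<open>P V + 1 + P W\<close> and cannot
      fall below \<open>P V\<close>.\<close>
    also have "\<dots> \<le> P W + \<kappa> v'"
    proof -
      have dSW: "S \<inter> W = {}" using W by (auto simp: U_def)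
      have "nbrs E y S = {}" if "y \<in> W" for y using W that by (auto simp: U_def M_def)
      then have 1: "P (S \<union> W) = P S + P W" using pot_Un[OF finS finW dSW E2, of i c] by simp
      have dA: "(S \<union> W) \<inter> A = {}" using W by (auto simp: A_def M_def U_def)
      have "nbrs E v (S \<union> W) = {x v, z v}" if "v \<in> A" for v
      proof -
        have v: "v \<in> M" "z v \<in> W" using that by (auto simp: A_def)
        have "x v \<in> S" using xz[OF v(1)] by (auto simp: nbrs_def)
        then show ?thesis using xz[OF v(1)] v S W UV by (auto simp: nbrs_def)
      qed
      moreover have "card {x v, z v} = 2" if "v \<in> A" for v
        using xz[of v] that by (auto simp: A_def B_def)
      ultimately have "P ((S \<union> W) \<union> A) = P (S \<union> W) + P A - (i + 1) * (\<Sum>y\<in>A. 2)"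
        using pot_Un[OF _ finA dA E2, of i c] finS finW by simp
      moreover have "P A \<le> (\<Sum>v\<in>A. 2 * i + 1)"
        using pot_le_sum[of i E c A] i_pos sum_mono[of A "\<lambda>v. wt i (c v)" "\<lambda>v. 2 * i + 1"] wt_le_2i MV
        by (force simp: A_def)
      ultimately have "P ((S \<union> W) \<union> A) \<le> P V + 1 + P W - int (card A)"
        using 1 S(3) by (simp add: algebra_simps)
      moreover have "P V \<le> P ((S \<union> W) \<union> A)"
        by (rule P_ge) (use S W UV MV in \<open>auto simp: A_def\<close>)
      moreover have "1 \<le> \<kappa> v'" using kap_ge_i[of v'] i_pos W UV by auto
      ultimately show ?thesis by linarith
    qed
    finally show "(\<Sum>y\<in>W. (c y False - c5 y False) + (c y True - c5 y True)) \<le> P W + \<kappa> v'" .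
  qed
  then obtain \<psi> where \<psi>: "col U E c5 \<psi>" by blast
  define f where "f = (\<lambda>y. if y \<in> S then \<phi> y else if y \<in> M then g y else \<psi> y)"
  have f: "f y = \<phi> y" if "y \<in> S" for y using that by (simp add: f_def)
  have f': "f y = g y" if "y \<in> M" for y using that by (simp add: f_def M_def)
  have f'': "f y = \<psi> y" if "y \<in> U" for y using that by (simp add: f_def U_def)
  have D: "V - (S \<union> U) = M" using S by (auto simp: U_def M_def)
  have nSU: "{s, w} \<notin> E" if "s \<in> S" "w \<in> U" for s w
    using that by (auto simp: U_def M_def nbrs_def insert_commute)
  have ends: "t = x v \<or> t = z v" if "v \<in> M" "t \<in> V" "{t, v} \<in> E" for v t
    using xz[OF that(1)] that by (auto simp: nbrs_def insert_commute)
  show False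
  proof (rule extend_general[of "S \<union> U" f])
    show "S \<union> U \<subseteq> V" using S UV by auto
  next
    fix t assume t: "t \<in> S \<union> U"
    have l: "load E (S \<union> U) f t = load E S f t + load E U f t"
      by (rule load_Un) (use finS finU in \<open>auto simp: U_def\<close>)
    show "int (load E (S \<union> U) f t + load E (V - (S \<union> U)) f t) \<le> c t (f t)"
      unfolding D
    proof (cases "t \<in> S")
      case True
      have "load E S f t = load E S \<phi> t" by (rule load_cong) (use True f in auto)
      moreover have "load E U f t = 0" by (rule load_zero) (use nSU True in auto)
      moreover have "load E M f t = 0"
      proof (rule load_zero)
        fix v assume v: "v \<in> M" "{t, v} \<in> E"
        then have "t = x v" using ends[OF v(1), of t] xz[OF v(1)] True S by (auto simp: U_def)
        then have "\<not> X v (f v) t (f t)" using g[of v] f[OF True] f'[OF v(1)] by simp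
        then show "\<not> X t (f t) v (f v)" using X_sym by blast
      qed
      ultimately show "int (load E (S \<union> U) f t + load E M f t) \<le> c t (f t)"
        using l \<phi> True f by (simp add: col_def)
    next
      case False
      then have tU: "t \<in> U" "t \<in> V" using t UV by auto
      have 1: "load E U f t = load E U \<psi> t" by (rule load_cong) (use tU f'' in auto)
      have 2: "load E S f t = 0" by (rule load_zero) (use nSU tU in \<open>auto simp: insert_commute\<close>)
      have "load E M f t \<le> D t (\<psi> t)" unfolding load_def D_def
      proof (rule card_mono)
        show "{v \<in> M. {t, v} \<in> E \<and> X t (f t) v (f v)} \<subseteq> {v \<in> M. z v = t \<and> X v (g v) t (\<psi> t)}"
        proof
          fix v assume "v \<in> {v \<in> M. {t, v} \<in> E \<and> X t (f t) v (f v)}"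
          then have v: "v \<in> M" "{t, v} \<in> E" "X t (\<psi> t) v (g v)" using f' f''[OF tU(1)] by auto
          have "x v \<in> S" using xz[OF v(1)] by (auto simp: nbrs_def)
          then have "z v = t" using ends[OF v(1) tU(2) v(2)] False by auto
          then show "v \<in> {v \<in> M. z v = t \<and> X v (g v) t (\<psi> t)}" using v X_sym by auto
        qed
      qed (use finM in simp)
      moreover have "int (load E U \<psi> t) \<le> c5 t (\<psi> t)" using \<psi> tU by (simp add: col_def)
      then have "int (load E U \<psi> t) \<le> c t (\<psi> t) - int (D t (\<psi> t))" by (simp add: c5_def)
      ultimately show "int (load E (S \<union> U) f t + load E M f t) \<le> c t (f t)"
        using l 1 2 f''[OF tU(1)] by simp
    qed
  next
    fix d assume "d \<in> V - (S \<union> U)"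
    then have d: "d \<in> M" using D by simp
    have xd: "x d \<in> S" "{d, x d} \<in> E" using xz[OF d] by (auto simp: nbrs_def)
    show "int (load E V f d) \<le> c d (f d)"
      by (rule B_load[of d "x d"]) (use xz[OF d] xd S g f f' d in auto)
  qed
qed

section \<open>Vertices outside \<open>B\<close> and their neighbours in \<open>B\<close>\<close>

definition K :: int where "K = max i (- P V)"

text \<open>With \<open>K\<close> in place of \<open>\<kappa> v\<close> the slack
  \<open>P W + K\<close> no longer depends on a vertex of \<open>W\<close>; it is then a submodular
  set function.\<close>

lemma K_le: "v \<in> V \<Longrightarrow> K \<le> \<kappa> v"
  using kap_ge_i[of v] P_kap[of v] by (simp add: K_def)

lemma K_ge: "i \<le> K" "0 \<le> P V + K"
  by (auto simp: K_def)

text \<open>Sets of potential \<open>P V + 1\<close> have the form \<open>V - {v}\<close> with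
  \<open>v\<close> in \<open>B\<close>, so none of them omits \<open>u\<close>.\<close>

lemma gap2:
  assumes "u \<in> V" "u \<notin> B" "W \<noteq> {}" "W \<subseteq> V - {u}"
  shows "P V + 2 \<le> P W"
proof -
  have W: "W \<subset> V" using assms by auto
  have "P W \<noteq> P V + 1" using tight[OF assms(3) W] assms by auto
  then show ?thesis using gap[OF assms(3) W] by simp
qed

definition far :: "'a \<Rightarrow> 'a \<Rightarrow> 'a" where
  "far u v = (SOME y. y \<in> V \<and> y \<noteq> u \<and> nbrs E v V = {u, y})"

definition T :: "'a \<Rightarrow> 'a set" where "T u = V - insert u (nbrs E u B)"

lemma far:
  assumes u: "u \<in> V" and v: "v \<in> nbrs E u B"
  shows "far u v \<in> T u" "nbrs E v V = {u, far u v}" "{v, far u v} \<in> E" "far u v \<noteq> u" "far u v \<in> V"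
proof -
  have vB: "v \<in> B" "{v, u} \<in> E" using v by (auto simp: nbrs_def insert_commute)
  obtain y where "y \<in> V" "y \<noteq> u" "nbrs E v V = {u, y}" using B_other[OF vB(1) u vB(2)] .
  then have *: "far u v \<in> V \<and> far u v \<noteq> u \<and> nbrs E v V = {u, far u v}"
    unfolding far_def by (intro someI) blast
  then show "nbrs E v V = {u, far u v}" "{v, far u v} \<in> E" "far u v \<noteq> u" "far u v \<in> V"
    by (auto simp: nbrs_def)
  then show "far u v \<in> T u" using * B_independent[OF vB(1)] by (auto simp: T_def nbrs_def)
qed

text \<open>Colour \<open>u\<close> and its neighbours in \<open>B\<close> last: those in \<open>F\<close> avoid \<open>u\<close>, the others their far end.\<close>
lemma extend_star:
  assumes u: "u \<in> V" and F: "F \<subseteq> nbrs E u B"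
    and g: "\<And>v. v \<in> nbrs E u B \<Longrightarrow> \<not> X v (g v) (far u v) (\<psi> (far u v))"
    and E1: "\<And>t. t \<in> T u \<Longrightarrow> int (load E (T u) \<psi> t + card {v \<in> F. far u v = t} +
        (if {u, t} \<in> E \<and> X u \<alpha> t (\<psi> t) then 1 else 0)) \<le> c t (\<psi> t)"
    and E2: "int (card {v \<in> nbrs E u B - F. X u \<alpha> v (g v)} + card {t \<in> T u. {u, t} \<in> E \<and> X u \<alpha> t (\<psi> t)}) \<le> c u \<alpha>"
  shows False
proof -
  let ?N = "nbrs E u B"
  have BV: "B \<subseteq> V" by (auto simp: B_def)
  have finN: "finite ?N" "finite F" using fin BV F finite_subset[of B V] finite_subset[of F ?N] by auto
  have "\<exists>\<beta>. \<not> X v \<beta> u \<alpha>" for v by (rule X_avoid)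
  then obtain h where h: "\<And>v. \<not> X v (h v) u \<alpha>" by metis
  define f where "f = (\<lambda>y. if y = u then \<alpha> else if y \<in> F then h y else if y \<in> ?N then g y else \<psi> y)"
  have uN: "u \<notin> ?N" using no_loop by (auto simp: nbrs_def)
  have fu: "f u = \<alpha>" by (simp add: f_def)
  have fF: "f v = h v" if "v \<in> F" for v using that F uN by (auto simp: f_def)
  have fN: "f v = g v" if "v \<in> ?N" "v \<notin> F" for v using that uN by (auto simp: f_def)
  have fT: "f t = \<psi> t" if "t \<in> T u" for t using that F by (auto simp: f_def T_def)
  have D: "V - T u = insert u ?N" using u BV by (auto simp: T_def nbrs_def)
  show False
  proof (rule extend_general[of "T u" f])
    show "T u \<subseteq> V" by (auto simp: T_def)
  next
    fix t assume t: "t \<in> T u"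
    then have tu: "t \<noteq> u" "t \<in> V" by (auto simp: T_def)
    have 1: "load E (T u) f t = load E (T u) \<psi> t" by (rule load_cong) (use t fT in auto)
    have "load E ({u} \<union> ?N) f t = load E {u} f t + load E ?N f t"
      by (rule load_Un) (use uN finN in auto)
    moreover have "load E {u} f t \<le> (if {u, t} \<in> E \<and> X u \<alpha> t (\<psi> t) then 1 else 0)"
      unfolding load_def
      by (rule card_le_if[of _ _ u]) (use fu fT[OF t] X_sym in \<open>auto simp: insert_commute\<close>)
    moreover have "load E ?N f t \<le> card {v \<in> F. far u v = t}"
      unfolding load_def
    proof (rule card_mono)
      show "{v \<in> ?N. {t, v} \<in> E \<and> X t (f t) v (f v)} \<subseteq> {v \<in> F. far u v = t}"
      proof
        fix v assume "v \<in> {v \<in> ?N. {t, v} \<in> E \<and> X t (f t) v (f v)}"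
        then have v: "v \<in> ?N" "{t, v} \<in> E" "X t (\<psi> t) v (f v)" using fT[OF t] by auto
        have "t \<in> nbrs E v V" using v tu by (auto simp: nbrs_def insert_commute)
        then have "far u v = t" using far(2)[OF u v(1)] tu by auto
        moreover have "v \<in> F"
        proof (rule ccontr)
          assume "v \<notin> F"
          then have "X v (g v) t (\<psi> t)" using fN[OF v(1)] v(3) X_sym by simp
          then show False using g[OF v(1)] \<open>far u v = t\<close> by simp
        qed
        ultimately show "v \<in> {v \<in> F. far u v = t}" by simp
      qed
    qed (use finN in simp)
    ultimately show "int (load E (T u) f t + load E (V - T u) f t) \<le> c t (f t)"
      using E1[OF t] 1 fT[OF t] D by (simp split: if_splits)
  next
    fix d assume "d \<in> V - T u"
    then consider "d = u" | "d \<in> ?N" using D by blast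
    then show "int (load E V f d) \<le> c d (f d)"
    proof cases
      case 1
      have "load E V f u \<le> card ({v \<in> ?N - F. X u \<alpha> v (g v)} \<union> {t \<in> T u. {u, t} \<in> E \<and> X u \<alpha> t (\<psi> t)})"
        unfolding load_def
      proof (rule card_mono)
        show "finite ({v \<in> ?N - F. X u \<alpha> v (g v)} \<union> {t \<in> T u. {u, t} \<in> E \<and> X u \<alpha> t (\<psi> t)})"
          using finN fin by (auto simp: T_def)
        show "{v \<in> V. {u, v} \<in> E \<and> X u (f u) v (f v)} \<subseteq> {v \<in> ?N - F. X u \<alpha> v (g v)} \<union> {t \<in> T u. {u, t} \<in> E \<and> X u \<alpha> t (\<psi> t)}"
        proof
          fix v assume "v \<in> {v \<in> V. {u, v} \<in> E \<and> X u (f u) v (f v)}"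
          then have v: "v \<in> V" "{u, v} \<in> E" "X u \<alpha> v (f v)" using fu by auto
          have "v \<noteq> u" using v no_loop by auto
          then consider "v \<in> F" | "v \<in> ?N" "v \<notin> F" | "v \<in> T u" using v by (auto simp: T_def)
          then show "v \<in> {v \<in> ?N - F. X u \<alpha> v (g v)} \<union> {t \<in> T u. {u, t} \<in> E \<and> X u \<alpha> t (\<psi> t)}"
          proof cases
            case 1
            then have "X v (h v) u \<alpha>" using v fF X_sym by simp
            then show ?thesis using h by blast
          next
            case 2 then show ?thesis using v fN by auto
          next
            case 3 then show ?thesis using v fT by auto
          qed
        qed
      qed
      also have "\<dots> \<le> card {v \<in> ?N - F. X u \<alpha> v (g v)} + card {t \<in> T u. {u, t} \<in> E \<and> X u \<alpha> t (\<psi> t)}"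
        by (rule card_Un_le)
      finally show ?thesis using E2 1 fu by simp
    next
      case 2
      then have dB: "d \<in> B" "{d, u} \<in> E" by (auto simp: nbrs_def insert_commute)
      show ?thesis
      proof (cases "d \<in> F")
        case True
        then have "\<not> X d (f d) u (f u)" using h[of d] fF fu by simp
        then show ?thesis by (rule B_load[OF dB(1) u dB(2)])
      next
        case False
        then have "\<not> X d (f d) (far u d) (f (far u d))"
          using g[OF 2] fN[OF 2] fT[OF far(1)[OF u 2]] by simp
        then show ?thesis by (rule B_load[OF dB(1) far(5)[OF u 2] far(3)[OF u 2]])
      qed
    qed
  qed
qed

text \<open>A vertex of \<open>F\<close> is going to avoid \<open>u\<close> and may then collide
  with its far end. The colour used there is not known beforehand, so a unit is withheld at both
  nodes, whence the factor 2. \<open>\<zeta>\<close> is what is withheld for \<open>u\<close>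
  itself.\<close>

lemma star_reserve:
  fixes \<zeta> :: "'a \<Rightarrow> bool \<Rightarrow> nat"
  assumes u: "u \<in> V" and F: "F \<subseteq> nbrs E u B"
    and budget: "\<And>W. W \<subseteq> T u \<Longrightarrow> W \<noteq> {} \<Longrightarrow>
      int (2 * card {v \<in> F. far u v \<in> W} + (\<Sum>t\<in>W. \<zeta> t False + \<zeta> t True)) \<le> P W + K"
  obtains \<psi> g where "\<And>v. v \<in> nbrs E u B \<Longrightarrow> \<not> X v (g v) (far u v) (\<psi> (far u v))"
    and "\<And>t. t \<in> T u \<Longrightarrow> int (load E (T u) \<psi> t + card {v \<in> F. far u v = t} + \<zeta> t (\<psi> t)) \<le> c t (\<psi> t)"
proof -
  have finF: "finite F"
    using fin F finite_subset[of F V] by (auto simp: nbrs_def B_def)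
  define c' where "c' = (\<lambda>t \<beta>. max (- 1) (c t \<beta> - int (card {v \<in> F. far u v = t} + \<zeta> t \<beta>)))"
  have "\<exists>\<psi>. col (T u) E c' \<psi>"
  proof (rule reserve_col)
    show "T u \<subset> V" using u by (auto simp: T_def)
    show "c' y \<beta> \<le> c y \<beta> \<and> - 1 \<le> c' y \<beta>" if "y \<in> T u" for y \<beta>
      using alive[of y \<beta>] that by (auto simp: c'_def T_def)
    fix W v assume W: "W \<subseteq> T u" "v \<in> W"
    have finW: "finite W" and vV: "v \<in> V" using W fin_sub[of W] by (auto simp: T_def)
    have "(\<Sum>y\<in>W. (c y False - c' y False) + (c y True - c' y True))
        \<le> (\<Sum>y\<in>W. int (2 * card {v \<in> F. far u v = y} + (\<zeta> y False + \<zeta> y True)))"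
      by (rule sum_mono) (auto simp: c'_def)
    also have "\<dots> = int (2 * card {v \<in> F. far u v \<in> W} + (\<Sum>t\<in>W. \<zeta> t False + \<zeta> t True))"
      using card_fibres[OF finF finW, of "far u"] by (simp add: sum.distrib flip: sum_distrib_left of_nat_sum)
    also have "\<dots> \<le> P W + \<kappa> v" using budget[OF W(1)] W K_le[OF vV] by force
    finally show "(\<Sum>y\<in>W. (c y False - c' y False) + (c y True - c' y True)) \<le> P W + \<kappa> v" .
  qed
  then obtain \<psi> where \<psi>: "col (T u) E c' \<psi>" by blast
  have "\<exists>\<beta>. \<not> X v \<beta> (far u v) (\<psi> (far u v))" for v by (rule X_avoid)
  then obtain g where g: "\<And>v. \<not> X v (g v) (far u v) (\<psi> (far u v))" by metis
  have "int (load E (T u) \<psi> t + card {v \<in> F. far u v = t} + \<zeta> t (\<psi> t)) \<le> c t (\<psi> t)" if "t \<in> T u" for t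
  proof -
    have "int (load E (T u) \<psi> t) \<le> c' t (\<psi> t)" using \<psi> that by (simp add: col_def)
    then show ?thesis by (simp add: c'_def)
  qed
  then show thesis using that g by blast
qed

lemma finite_star: "finite (nbrs E u B)"
  using fin finite_subset[of B V] by (auto simp: B_def)

lemma nbrs_T: "nbrs E u (T u) = nbrs E u (V - B)"
  using no_loop by (auto simp: T_def nbrs_def)

text \<open>A coloured neighbour is matched to at most one of the two nodes of
  \<open>u\<close>.\<close>

lemma card_conflicts:
  assumes "finite A"
  shows "card {v \<in> A. X u False v (g v)} + card {v \<in> A. X u True v (g v)} \<le> card A"
proof -
  have "{v \<in> A. X u False v (g v)} \<inter> {v \<in> A. X u True v (g v)} = {}" using X_inj by blast
  then have "card {v \<in> A. X u False v (g v)} + card {v \<in> A. X u True v (g v)}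
      = card ({v \<in> A. X u False v (g v)} \<union> {v \<in> A. X u True v (g v)})"
    using assms by (intro card_Un_disjoint[symmetric]) auto
  also have "\<dots> \<le> card A" using assms by (intro card_mono) auto
  finally show ?thesis .
qed

text \<open>Uncrossing: the sets of potential at most \<open>2 - K\<close>, and then those of potential at most \<open>3 - K\<close>
  through \<open>far u v1\<close>, are closed under union.\<close>
lemma far_pair:
  assumes u: "u \<in> V" "u \<notin> B" and i2: "i = 2" and l0: "nbrs E u (T u) = {}" and m9: "card (nbrs E u B) = 9"
  obtains v1 v2 where "v1 \<in> nbrs E u B" "v2 \<in> nbrs E u B" "v1 \<noteq> v2"
    "\<And>W. W \<subseteq> T u \<Longrightarrow> far u v1 \<in> W \<Longrightarrow> far u v2 \<in> W \<Longrightarrow> 4 \<le> P W + K"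
proof -
  let ?N = "nbrs E u B"
  define q where "q W = card {v \<in> ?N. far u v \<in> W}" for W
  define h where "h W = P W + K" for W
  have TV: "T u \<subseteq> V" by (auto simp: T_def)
  have finT: "finite (T u)" using TV fin_sub by blast
  have NV: "?N \<subseteq> V" "u \<notin> ?N" using no_loop by (auto simp: nbrs_def B_def)
  \<comment> \<open>Adding \<open>u\<close> gains at most 5, and each of the \<open>q W\<close>
    vertices of \<open>A\<close> then costs at least 1. If two neighbours of \<open>u\<close> are
    missed, the result is not an exceptional set and lies 2 above \<open>P V\<close>; otherwise
    \<open>q W\<close> is at least 8, which makes up for the weaker gap.\<close>
  have big: "h W \<ge> int (q W) - 3 \<or> h W \<ge> 4" if W: "W \<subseteq> T u" "W \<noteq> {}" for W
  proof -
    define A where "A = {v \<in> ?N. far u v \<in> W}"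
    have fins: "finite W" "finite A" using W finT finite_subset finite_star by (auto simp: A_def)
    have uW: "u \<notin> W" using W by (auto simp: T_def)
    have "nbrs E u W = {}" using l0 W by (auto simp: nbrs_def)
    then have 1: "P (insert u W) = P W + wt i (c u)" using pot_insert[OF fins(1) uW E2, of i c] by simp
    have dA: "insert u W \<inter> A = {}" using W NV by (auto simp: A_def T_def)
    have "nbrs E v (insert u W) = {u, far u v}" if "v \<in> A" for v
    proof -
      have v: "v \<in> ?N" "far u v \<in> W" using that by (auto simp: A_def)
      have "nbrs E v (insert u W) = nbrs E v V \<inter> insert u W" using W TV u by (auto simp: nbrs_def)
      then show ?thesis using far(2)[OF u(1) v(1)] v by auto
    qed
    moreover have "card {u, far u v} = 2" if "v \<in> A" for v
      using far(4)[OF u(1), of v] that by (auto simp: A_def)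
    ultimately have "P (insert u W \<union> A) = P (insert u W) + P A - (i + 1) * (\<Sum>y\<in>A. 2)"
      using pot_Un[OF _ fins(2) dA E2, of i c] fins by simp
    moreover have "P A \<le> (\<Sum>v\<in>A. 2 * i + 1)"
      using pot_le_sum[of i E c A] i_pos sum_mono[of A "\<lambda>v. wt i (c v)" "\<lambda>v. 2 * i + 1"] wt_le_2i NV
      by (force simp: A_def)
    ultimately have le5: "P (insert u W \<union> A) \<le> P W + 5 - int (card A)"
      using 1 wt_le_2i[OF u(1)] i2 by simp
    have cA: "card A = q W" by (simp add: A_def q_def)
    have sub: "insert u W \<union> A \<subseteq> V" using u W TV NV by (auto simp: A_def)
    have AN: "A \<subseteq> ?N" by (auto simp: A_def)
    have WN: "W \<inter> ?N = {}" using W by (auto simp: T_def)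
    consider "q W \<le> 7" | "q W = 8" | "q W = 9"
      using card_mono[OF finite_star AN] cA m9 by linarith
    then show ?thesis
    proof cases
      case 1
      have "2 \<le> card (?N - A)" using card_Diff_subset[OF fins(2) AN] m9 cA 1 by simp
      then obtain a b where ab: "a \<in> ?N - A" "b \<in> ?N - A" "a \<noteq> b"
        using card_le_Suc0_iff_eq[of "?N - A"] finite_star[of u] by auto
      have miss: "a \<notin> insert u W \<union> A" "b \<notin> insert u W \<union> A" using ab NV WN by auto
      have "insert u W \<union> A \<subset> V" using sub miss ab NV by auto
      moreover have "insert u W \<union> A \<noteq> V - {v}" for v using miss ab NV by auto
      ultimately have "P V + 2 \<le> P (insert u W \<union> A)"
        using gap[of "insert u W \<union> A"] tight[of "insert u W \<union> A"] by fastforce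
      then show ?thesis using le5 K_ge cA by (simp add: h_def)
    next
      case 2
      have "A \<noteq> ?N" using cA m9 2 by auto
      then obtain a where a: "a \<in> ?N" "a \<notin> A" using AN by blast
      then have "insert u W \<union> A \<subset> V" using sub NV WN by auto
      then have "P V + 1 \<le> P (insert u W \<union> A)" using gap[of "insert u W \<union> A"] by simp
      then show ?thesis using le5 K_ge cA 2 by (simp add: h_def)
    next
      case 3
      have "P V \<le> P (insert u W \<union> A)" using P_ge[OF _ sub] by simp
      then show ?thesis using le5 K_ge cA 3 by (simp add: h_def)
    qed
  qed
  \<comment> \<open>The empty set is included because \<open>K\<close> is at least
    \<open>i = 2\<close>, so disjoint sets can be uncrossed too.\<close>
  have h2: "2 \<le> h W" if W: "W \<subseteq> T u" for W
  proof (cases "W = {}")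
    case True
    then show ?thesis using K_ge i2 E2 by (simp add: h_def)
  next
    case False
    then show ?thesis using gap2[OF u, of W] W K_ge by (force simp: h_def T_def)
  qed
  have sm: "h (W1 \<union> W2) + h (W1 \<inter> W2) \<le> h W1 + h W2" if "W1 \<subseteq> T u" "W2 \<subseteq> T u" for W1 W2
    using pot_submodular[of W1 W2 i E c] that finT finite_subset i2 by (auto simp: h_def)
  let ?F2 = "{W. W \<subseteq> T u \<and> (W = {} \<or> h W \<le> 2)}"
  have "\<exists>M\<in>?F2. \<forall>A\<in>?F2. A \<subseteq> M"
  proof (rule union_closed_greatest)
    show "finite ?F2" by (rule finite_subset[of _ "Pow (T u)"]) (use finT in auto)
    fix W1 W2 assume W: "W1 \<in> ?F2" "W2 \<in> ?F2"
    show "W1 \<union> W2 \<in> ?F2"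
    proof (cases "W1 = {} \<or> W2 = {}")
      case False
      then have "h (W1 \<union> W2) + h (W1 \<inter> W2) \<le> h W1 + h W2" "2 \<le> h (W1 \<inter> W2)" "h W1 \<le> 2" "h W2 \<le> 2"
        using sm[of W1 W2] h2[of "W1 \<inter> W2"] W by auto
      then have "h (W1 \<union> W2) \<le> 2" by linarith
      then show ?thesis using W by auto
    qed (use W in auto)
  qed auto
  then obtain M where M0: "M \<in> ?F2" "\<forall>A\<in>?F2. A \<subseteq> M" by (rule bexE)
  then have M: "M \<subseteq> T u" "M = {} \<or> h M \<le> 2" by simp_all
  have M3: "W \<subseteq> M" if "W \<subseteq> T u" "h W \<le> 2" for W using bspec[OF M0(2), of W] that by simp
  \<comment> \<open>By \<open>big\<close>, the greatest set with \<open>h\<close> at most 2 catches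
    at most 5 of the 9 far ends, so one of them lies outside all such sets.\<close>
  have "q M \<le> 5"
  proof (cases "M = {}")
    case False
    then show ?thesis using M big[of M] by auto
  qed (simp add: q_def)
  then have "{v \<in> ?N. far u v \<in> M} \<noteq> ?N" using m9 by (auto simp: q_def)
  then obtain v1 where v1: "v1 \<in> ?N" "far u v1 \<notin> M" by blast
  let ?F3 = "{W. W \<subseteq> T u \<and> (W = {} \<or> far u v1 \<in> W \<and> h W \<le> 3)}"
  have "\<exists>M\<in>?F3. \<forall>A\<in>?F3. A \<subseteq> M"
  proof (rule union_closed_greatest)
    show "finite ?F3" by (rule finite_subset[of _ "Pow (T u)"]) (use finT in auto)
    fix W1 W2 assume W: "W1 \<in> ?F3" "W2 \<in> ?F3"
    show "W1 \<union> W2 \<in> ?F3"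
    proof (cases "W1 = {} \<or> W2 = {}")
      case False
      \<comment> \<open>The intersection contains \<open>far u v1\<close>, which lies outside
        \<open>M\<close>; so its \<open>h\<close> is at least 3, which is what uncrossing at level 3
        requires.\<close>
      have "\<not> h (W1 \<inter> W2) \<le> 2" using M3[of "W1 \<inter> W2"] v1 W False by auto
      moreover have "h (W1 \<union> W2) + h (W1 \<inter> W2) \<le> h W1 + h W2" "h W1 \<le> 3" "h W2 \<le> 3"
        using sm[of W1 W2] W False by auto
      ultimately have "h (W1 \<union> W2) \<le> 3" by linarith
      then show ?thesis using W False by auto
    qed (use W in auto)
  qed auto
  then obtain M1 where M10: "M1 \<in> ?F3" "\<forall>A\<in>?F3. A \<subseteq> M1" by (rule bexE)
  then have M1: "M1 \<subseteq> T u" "M1 = {} \<or> h M1 \<le> 3" by auto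
  have M13: "W \<subseteq> M1" if "W \<subseteq> T u" "far u v1 \<in> W" "h W \<le> 3" for W
    using bspec[OF M10(2), of W] that by simp
  have q6: "q M1 \<le> 6"
  proof (cases "M1 = {}")
    case False
    then show ?thesis using M1 big[of M1] by auto
  qed (simp add: q_def)
  have "\<not> ?N - {v1} \<subseteq> {v \<in> ?N. far u v \<in> M1}"
  proof
    assume "?N - {v1} \<subseteq> {v \<in> ?N. far u v \<in> M1}"
    then have "card (?N - {v1}) \<le> q M1" unfolding q_def using finite_star by (intro card_mono) auto
    then show False using q6 m9 v1 finite_star[of u] by simp
  qed
  then obtain v2 where v2: "v2 \<in> ?N" "v2 \<noteq> v1" "far u v2 \<notin> M1" by blast
  show thesis
  proof (rule that[OF v1(1) v2(1) v2(2)[symmetric]])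
    fix W assume W: "W \<subseteq> T u" "far u v1 \<in> W" "far u v2 \<in> W"
    then have "\<not> h W \<le> 3" using M13[OF W(1,2)] W(3) v2 by blast
    then show "4 \<le> P W + K" by (simp add: h_def)
  qed
qed

text \<open>This makes the term of \<open>u\<close> in \<open>pot_discharging\<close> nonpositive.
  If it failed, \<open>u\<close> would have so few neighbours that, after suitable reservations,
  \<open>u\<close> and its neighbours in \<open>B\<close> could be coloured last: each neighbour
  conflicts with at most one node of \<open>u\<close>.\<close>

lemma star_bound:
  assumes u: "u \<in> V" "u \<notin> B"
  shows "2 * wt i (c u) \<le> (i + 1) * int (card (nbrs E u (V - B))) + int (card (nbrs E u B))"
proof (rule ccontr)
  let ?N = "nbrs E u B"
  define l where "l = card (nbrs E u (T u))"
  define m where "m = card ?N"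
  define a where "a = c u False"
  define b where "b = c u True"
  assume "\<not> ?thesis"
  then have low: "2 * wt i (c u) > (i + 1) * int l + int m" by (simp add: l_def m_def nbrs_T)
  have TV: "T u \<subseteq> V - {u}" by (auto simp: T_def)
  have finT: "finite (T u)" using TV fin_sub[of "T u"] by auto
  have ab: "0 \<le> a" "a \<le> i" "0 \<le> b" "wt i (c u) = 1 - i + a + min b (2 * i)"
    using alive[OF u(1)] val_D(2)[OF u(1)] wt_alive[OF u(1)] by (auto simp: a_def b_def)
  have f2: "2 \<le> P W + K" if "W \<subseteq> T u" "W \<noteq> {}" for W
    using gap2[OF u that(2)] that TV K_ge by force
  have pick: False if F: "F \<subseteq> ?N"
    and g: "\<And>v. v \<in> ?N \<Longrightarrow> \<not> X v (g v) (far u v) (\<psi> (far u v))"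
    and E1: "\<And>t. t \<in> T u \<Longrightarrow> int (load E (T u) \<psi> t + card {v \<in> F. far u v = t} +
        (if {u, t} \<in> E \<and> X u \<alpha> t (\<psi> t) then 1 else 0)) \<le> c t (\<psi> t)"
    and E2: "int (card {v \<in> ?N - F. X u \<alpha> v (g v)} + card {t \<in> nbrs E u (T u). X u \<alpha> t (\<psi> t)}) \<le> c u \<alpha>"
    for F g \<psi> \<alpha>
  proof -
    have "{t \<in> T u. {u, t} \<in> E \<and> X u \<alpha> t (\<psi> t)} = {t \<in> nbrs E u (T u). X u \<alpha> t (\<psi> t)}"
      by (auto simp: nbrs_def)
    then show False using extend_star[OF u(1) F g E1] E2 by simp
  qed
  have cnt: "card {v \<in> ?N - F. X u False v (g v)} + card {t \<in> nbrs E u (T u). X u False t (\<psi> t)}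
      + (card {v \<in> ?N - F. X u True v (g v)} + card {t \<in> nbrs E u (T u). X u True t (\<psi> t)}) \<le> card (?N - F) + l"
    for F g \<psi>
    using card_conflicts[of "?N - F" u g] card_conflicts[of "nbrs E u (T u)" u \<psi>] finite_star finT
    unfolding l_def by fastforce
  consider "2 \<le> l" | "l = 1" | "l = 0" by linarith
  then show False
  proof cases
    case 1
    \<comment> \<open>With at most \<open>b + 1\<close> neighbours, either the rich node is within
      its capacity or all conflicts sit there and the poor node has none. So reservations are needed
      only against the rich choice.\<close>
    have l3: "l \<le> 3" and d: "int l + int m \<le> b + 1"
      using low ab 1 i12 by (auto simp: min_def split: if_splits)
    define \<zeta> where "\<zeta> = (\<lambda>t \<beta>. if {u, t} \<in> E \<and> X u True t \<beta> then 1 else 0 :: nat)"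
    have budget: "int (2 * card {v \<in> {}. far u v \<in> W} + (\<Sum>t\<in>W. \<zeta> t False + \<zeta> t True)) \<le> P W + K"
      if W: "W \<subseteq> T u" "W \<noteq> {}" for W
    proof -
      have finW: "finite W" "u \<notin> W" using W finT finite_subset TV by auto
      have "\<zeta> t False + \<zeta> t True \<le> (if {u, t} \<in> E then 1 else 0)" for t
      proof -
        have "\<not> (X u True t False \<and> X u True t True)" using X_fun by blast
        then show ?thesis by (auto simp: \<zeta>_def)
      qed
      then have "(\<Sum>t\<in>W. \<zeta> t False + \<zeta> t True) \<le> (\<Sum>t\<in>W. if {u, t} \<in> E then 1 else 0)"
        by (intro sum_mono) auto
      also have "\<dots> = card (nbrs E u W)" using finW by (simp add: nbrs_def flip: sum.inter_filter)
      finally have s: "(\<Sum>t\<in>W. \<zeta> t False + \<zeta> t True) \<le> card (nbrs E u W)" .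
      have nl: "card (nbrs E u W) \<le> l" unfolding l_def using W finT by (intro card_mono) (auto simp: nbrs_def)
      have e: "card {v \<in> {}. far u v \<in> W} = 0" by simp
      show ?thesis unfolding e
      proof (cases "card (nbrs E u W) \<le> 2")
        case True
        then show "int (2 * 0 + (\<Sum>t\<in>W. \<zeta> t False + \<zeta> t True)) \<le> P W + K" using s f2[OF W] by linarith
      next
        case False
        then have n3: "card (nbrs E u W) = 3" using nl l3 by simp
        \<comment> \<open>Three units exceed the gap of 2, but three edges to \<open>u\<close> cost
          \<open>i + 2\<close> more than its weight, and \<open>P W\<close> is larger
          accordingly.\<close>
        have "P V \<le> P (insert u W)" using P_ge[of "insert u W"] u W TV by auto
        then have "P V + (i + 1) * 3 - (2 * i + 1) \<le> P W"
          using pot_insert[OF finW E2, of i c] n3 wt_le_2i[OF u(1)] by simp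
        then have "3 \<le> P W + K" using i_pos K_ge by simp
        then show "int (2 * 0 + (\<Sum>t\<in>W. \<zeta> t False + \<zeta> t True)) \<le> P W + K" using s n3 by linarith
      qed
    qed
    obtain \<psi> g where g: "\<And>v. v \<in> ?N \<Longrightarrow> \<not> X v (g v) (far u v) (\<psi> (far u v))"
      and \<psi>: "\<And>t. t \<in> T u \<Longrightarrow> int (load E (T u) \<psi> t + card {v \<in> {}. far u v = t} + \<zeta> t (\<psi> t)) \<le> c t (\<psi> t)"
      by (rule star_reserve[OF u(1) empty_subsetI, of \<zeta>, OF budget]) (assumption | rule that)+
    show False
    proof (cases "int (card {v \<in> ?N - {}. X u True v (g v)} + card {t \<in> nbrs E u (T u). X u True t (\<psi> t)}) \<le> b")
      case True
      show False
        by (rule pick[of "{}" g \<psi> True]) (use g \<psi> True in \<open>auto simp: \<zeta>_def b_def\<close>)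
    next
      case False
      then have z: "card {v \<in> ?N - {}. X u False v (g v)} + card {t \<in> nbrs E u (T u). X u False t (\<psi> t)} = 0"
        using cnt[of "{}" g \<psi>] d by (simp add: m_def)
      have none: "\<not> ({u, t} \<in> E \<and> X u False t (\<psi> t))" if "t \<in> T u" for t
        using z that finT by (auto simp: nbrs_def)
      show False
      proof (rule pick[of "{}" g \<psi> False])
        show "int (card {v \<in> ?N - {}. X u False v (g v)} + card {t \<in> nbrs E u (T u). X u False t (\<psi> t)}) \<le> c u False"
          using z ab by (simp add: a_def)
        fix t assume t: "t \<in> T u"
        show "int (load E (T u) \<psi> t + card {v \<in> {}. far u v = t} +
          (if {u, t} \<in> E \<and> X u False t (\<psi> t) then 1 else 0)) \<le> c t (\<psi> t)"
          using \<psi>[OF t] none[OF t] by (auto split: if_splits)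
      qed (use g in auto)
    qed
  next
    case 2
    \<comment> \<open>At most \<open>a + b + 1\<close> conflicts cannot exceed both capacities.
      Which node of \<open>u\<close> works is not known in advance, so both nodes of its single
      neighbour in \<open>T u\<close> are reserved, two units in all.\<close>
    have d: "int l + int m \<le> a + b + 1"
      using low ab 2 i12 by (auto simp: min_def split: if_splits)
    define \<zeta> where "\<zeta> = (\<lambda>t (\<beta>::bool). if {u, t} \<in> E then 1 else 0 :: nat)"
    have budget: "int (2 * card {v \<in> {}. far u v \<in> W} + (\<Sum>t\<in>W. \<zeta> t False + \<zeta> t True)) \<le> P W + K"
      if W: "W \<subseteq> T u" "W \<noteq> {}" for W
    proof -
      have finW: "finite W" using W finT finite_subset by auto
      have "(\<Sum>t\<in>W. \<zeta> t False + \<zeta> t True) = 2 * (\<Sum>t\<in>W. if {u, t} \<in> E then 1 else 0)"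
        unfolding sum_distrib_left by (rule sum.cong) (auto simp: \<zeta>_def)
      also have "\<dots> = 2 * card (nbrs E u W)" using finW by (simp add: nbrs_def flip: sum.inter_filter)
      also have "\<dots> \<le> 2 * l" unfolding l_def using W finT by (intro mult_left_mono card_mono) (auto simp: nbrs_def)
      finally have s: "(\<Sum>t\<in>W. \<zeta> t False + \<zeta> t True) \<le> 2" using 2 by simp
      have e: "card {v \<in> {}. far u v \<in> W} = 0" by simp
      show ?thesis unfolding e using s f2[OF W] by linarith
    qed
    obtain \<psi> g where g: "\<And>v. v \<in> ?N \<Longrightarrow> \<not> X v (g v) (far u v) (\<psi> (far u v))"
      and \<psi>: "\<And>t. t \<in> T u \<Longrightarrow> int (load E (T u) \<psi> t + card {v \<in> {}. far u v = t} + \<zeta> t (\<psi> t)) \<le> c t (\<psi> t)"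
      by (rule star_reserve[OF u(1) empty_subsetI, of \<zeta>, OF budget]) (assumption | rule that)+
    have "\<exists>\<alpha>. int (card {v \<in> ?N - {}. X u \<alpha> v (g v)} + card {t \<in> nbrs E u (T u). X u \<alpha> t (\<psi> t)}) \<le> c u \<alpha>"
    proof (rule ccontr)
      assume "\<not> ?thesis"
      then have "\<And>\<alpha>. int (card {v \<in> ?N - {}. X u \<alpha> v (g v)} + card {t \<in> nbrs E u (T u). X u \<alpha> t (\<psi> t)}) > c u \<alpha>"
        by (simp add: not_le)
      from this[of False] this[of True] show False using cnt[of "{}" g \<psi>] d by (simp add: a_def b_def m_def)
    qed
    then obtain \<alpha> where \<alpha>: "int (card {v \<in> ?N - {}. X u \<alpha> v (g v)} + card {t \<in> nbrs E u (T u). X u \<alpha> t (\<psi> t)}) \<le> c u \<alpha>" by blast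
    show False
    proof (rule pick[of "{}" g \<psi> \<alpha>])
      fix t assume t: "t \<in> T u"
      show "int (load E (T u) \<psi> t + card {v \<in> {}. far u v = t} +
        (if {u, t} \<in> E \<and> X u \<alpha> t (\<psi> t) then 1 else 0)) \<le> c t (\<psi> t)"
        using \<psi>[OF t] by (auto simp: \<zeta>_def split: if_splits)
    qed (use g \<alpha> in auto)
  next
    case 3
    have l0: "nbrs E u (T u) = {}" using 3 finT by (simp add: l_def)
    \<comment> \<open>\<open>F\<close> absorbs the surplus of neighbours over
      \<open>a + b + 1\<close>, which is at most 1, or 2 in the extremal case \<open>i = 2\<close>,
      \<open>a = 2\<close>, \<open>b = 4\<close>.\<close>
    have "\<exists>F\<subseteq>?N. int (card (?N - F)) \<le> a + b + 1 \<and>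
        (\<forall>W\<subseteq>T u. W \<noteq> {} \<longrightarrow> int (2 * card {v \<in> F. far u v \<in> W}) \<le> P W + K)"
    proof -
      have "int m \<le> a + b + 1 \<or> int m = a + b + 2 \<or> i = 2 \<and> int m = 9 \<and> a + b = 6"
        using i12
      proof
        assume i1: "i = 1"
        then have "int m < 2 * (a + min b 2)" "a \<le> 1" using low ab 3 by auto
        then show ?thesis using ab(3) by (cases "b \<le> 2") (simp_all add: min_def, presburger+)
      next
        assume i2: "i = 2"
        then have "int m < 2 * (a - 1 + min b 4)" "a \<le> 2" using low ab 3 by auto
        then show ?thesis using ab(3) i2 by (cases "b \<le> 4") (simp_all add: min_def, presburger+)
      qed
      then consider "int m \<le> a + b + 1" | "int m = a + b + 2" | "i = 2" "m = 9" "a + b = 6" by linarith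
      then show ?thesis
      proof cases
        case 1
        moreover have "int (2 * card {v \<in> {}. far u v \<in> W}) \<le> P W + K" if "W \<subseteq> T u" "W \<noteq> {}" for W
          using f2[OF that] by simp
        ultimately show ?thesis by (intro exI[of _ "{}"]) (auto simp: m_def)
      next
        case 2
        then have "?N \<noteq> {}" using ab by (auto simp: m_def)
        then obtain v where v: "v \<in> ?N" by blast
        have "int (2 * card {v' \<in> {v}. far u v' \<in> W}) \<le> P W + K" if "W \<subseteq> T u" "W \<noteq> {}" for W
        proof -
          have "card {v' \<in> {v}. far u v' \<in> W} \<le> card {v}" by (rule card_mono) auto
          then show ?thesis using f2[OF that] by simp
        qed
        moreover have "int (card (?N - {v})) \<le> a + b + 1" using 2 card_Suc_Diff1[OF finite_star v] unfolding m_def by linarith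
        ultimately show ?thesis using v by (intro exI[of _ "{v}"]) auto
      next
        case 3
        then obtain v1 v2 where v: "v1 \<in> ?N" "v2 \<in> ?N" "v1 \<noteq> v2"
          and h4: "\<And>W. W \<subseteq> T u \<Longrightarrow> far u v1 \<in> W \<Longrightarrow> far u v2 \<in> W \<Longrightarrow> 4 \<le> P W + K"
          using far_pair[OF u 3(1) l0] by (auto simp: m_def)
        have "int (2 * card {v \<in> {v1, v2}. far u v \<in> W}) \<le> P W + K" if W: "W \<subseteq> T u" "W \<noteq> {}" for W
        proof (cases "far u v1 \<in> W \<and> far u v2 \<in> W")
          case True
          have "card {v \<in> {v1, v2}. far u v \<in> W} \<le> card {v1, v2}" by (rule card_mono) auto
          then show ?thesis using h4[OF W(1)] True v by simp
        next
          case False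
          then have "{v \<in> {v1, v2}. far u v \<in> W} \<subseteq> {v1} \<or> {v \<in> {v1, v2}. far u v \<in> W} \<subseteq> {v2}" by auto
          then have "card {v \<in> {v1, v2}. far u v \<in> W} \<le> 1"
            using card_mono[of "{v1}"] card_mono[of "{v2}"] by fastforce
          then show ?thesis using f2[OF W] by simp
        qed
        moreover have "int (card (?N - {v1, v2})) \<le> a + b + 1"
          using 3 v finite_star[of u] by (simp add: m_def card_Diff_subset)
        ultimately show ?thesis using v by (intro exI[of _ "{v1, v2}"]) auto
      qed
    qed
    then obtain F where F: "F \<subseteq> ?N" "int (card (?N - F)) \<le> a + b + 1"
      and bud: "\<And>W. W \<subseteq> T u \<Longrightarrow> W \<noteq> {} \<Longrightarrow> int (2 * card {v \<in> F. far u v \<in> W}) \<le> P W + K" by blast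
    obtain \<psi> g where g: "\<And>v. v \<in> ?N \<Longrightarrow> \<not> X v (g v) (far u v) (\<psi> (far u v))"
      and \<psi>: "\<And>t. t \<in> T u \<Longrightarrow> int (load E (T u) \<psi> t + card {v \<in> F. far u v = t} + 0) \<le> c t (\<psi> t)"
    proof (rule star_reserve[OF u(1) F(1), of "\<lambda>_ _. 0"])
      show "int (2 * card {v \<in> F. far u v \<in> W} + (\<Sum>t\<in>W. 0 + 0)) \<le> P W + K"
        if "W \<subseteq> T u" "W \<noteq> {}" for W using bud[OF that] by simp
    qed (rule that)
    have "\<exists>\<alpha>. int (card {v \<in> ?N - F. X u \<alpha> v (g v)} + card {t \<in> nbrs E u (T u). X u \<alpha> t (\<psi> t)}) \<le> c u \<alpha>"
    proof (rule ccontr)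
      assume "\<not> ?thesis"
      then have "\<And>\<alpha>. int (card {v \<in> ?N - F. X u \<alpha> v (g v)} + card {t \<in> nbrs E u (T u). X u \<alpha> t (\<psi> t)}) > c u \<alpha>"
        by (simp add: not_le)
      from this[of False] this[of True] show False using cnt[of F g \<psi>] F(2) 3 by (simp add: a_def b_def)
    qed
    then obtain \<alpha> where \<alpha>: "int (card {v \<in> ?N - F. X u \<alpha> v (g v)} + card {t \<in> nbrs E u (T u). X u \<alpha> t (\<psi> t)}) \<le> c u \<alpha>" by blast
    show False
    proof (rule pick[OF F(1) g _ \<alpha>])
      fix t assume t: "t \<in> T u"
      then have "{u, t} \<notin> E" using l0 by (auto simp: nbrs_def)
      then show "int (load E (T u) \<psi> t + card {v \<in> F. far u v = t} +
        (if {u, t} \<in> E \<and> X u \<alpha> t (\<psi> t) then 1 else 0)) \<le> c t (\<psi> t)"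
        using \<psi>[OF t] by simp
    qed
  qed
qed

end

section \<open>Minimal energy, Hall's condition and discharging\<close>

lemma sum_card_swap:
  assumes "finite A" "finite Z"
  shows "(\<Sum>u\<in>Z. card {v \<in> A. Q u v}) = (\<Sum>v\<in>A. card {u \<in> Z. Q u v})"
proof -
  have "(\<Sum>u\<in>Z. card {v \<in> A. Q u v}) = (\<Sum>u\<in>Z. \<Sum>v\<in>A. if Q u v then 1 else 0)"
    using assms by (simp flip: sum.inter_filter)
  also have "\<dots> = (\<Sum>v\<in>A. \<Sum>u\<in>Z. if Q u v then 1 else 0)" by (rule sum.swap)
  also have "\<dots> = (\<Sum>v\<in>A. card {u \<in> Z. Q u v})"
    using assms by (simp flip: sum.inter_filter)
  finally show ?thesis .
qed

context min_counterexample
begin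

abbreviation R :: "'a set" where "R \<equiv> V - B"

definition pe :: "'a \<Rightarrow> 'a" where "pe v = (SOME x. x \<in> nbrs E v V)"
definition qe :: "'a \<Rightarrow> 'a" where "qe v = far (pe v) v"

lemma BV: "B \<subseteq> V" by (auto simp: B_def)

lemma finB: "finite B" using BV fin finite_subset by blast

lemma ends:
  assumes v: "v \<in> B"
  shows "nbrs E v V = {pe v, qe v}" "pe v \<in> R" "qe v \<in> R" "pe v \<noteq> qe v" "{v, pe v} \<in> E" "{v, qe v} \<in> E"
proof -
  have "nbrs E v V \<noteq> {}" using v by (auto simp: B_def)
  then have p: "pe v \<in> nbrs E v V" unfolding pe_def by (simp add: some_in_eq)
  then have p': "pe v \<in> V" "{v, pe v} \<in> E" by (auto simp: nbrs_def)
  then have m: "v \<in> nbrs E (pe v) B" using v by (auto simp: nbrs_def insert_commute)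
  show *: "nbrs E v V = {pe v, qe v}" unfolding qe_def by (rule far(2)[OF p'(1) m])
  show "pe v \<noteq> qe v" using far(4)[OF p'(1) m] unfolding qe_def by simp
  show q: "{v, qe v} \<in> E" unfolding qe_def by (rule far(3)[OF p'(1) m])
  show "{v, pe v} \<in> E" using p' by simp
  then show "pe v \<in> R" "qe v \<in> R" using * q B_independent[OF v] by (auto simp: nbrs_def)
qed

text \<open>Any other vertex of \<open>B\<close> can avoid both its neighbours; a blocked one must
  conflict with one of them, and by \<open>B_load\<close> it may choose which.\<close>

definition blocked :: "('a \<Rightarrow> bool) \<Rightarrow> 'a set" where
  "blocked \<phi> = {v \<in> B. \<forall>\<beta>. \<exists>x\<in>V. {v, x} \<in> E \<and> X v \<beta> x (\<phi> x)}"

text \<open>The first two terms are the total load to be borne by \<open>R\<close>: a conflicting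
  edge burdens both its ends, a blocked vertex only one. Capacities are doubled because a flip at
  \<open>u\<close> changes the sum of the loads in \<open>R\<close> by twice the change at
  \<open>u\<close>.\<close>

definition energy :: "('a \<Rightarrow> bool) \<Rightarrow> int" where
  "energy \<phi> = int (\<Sum>u\<in>R. load E R \<phi> u) + int (card (blocked \<phi>)) - 2 * (\<Sum>u\<in>R. c u (\<phi> u))"

text \<open>The type of vertices may be infinite, so the minimum comes from the lower bound
  \<open>- L\<close> and the well-ordering of the natural numbers.\<close>

lemma ex_min_energy: "\<exists>\<phi>. \<forall>\<phi>'. energy \<phi> \<le> energy \<phi>'"
proof -
  define L where "L = 2 * (\<Sum>u\<in>R. \<bar>c u False\<bar> + \<bar>c u True\<bar>)"
  have lb: "0 \<le> energy \<phi> + L" for \<phi>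
  proof -
    have "(\<Sum>u\<in>R. c u (\<phi> u)) \<le> (\<Sum>u\<in>R. \<bar>c u False\<bar> + \<bar>c u True\<bar>)"
    proof (rule sum_mono)
      fix u show "c u (\<phi> u) \<le> \<bar>c u False\<bar> + \<bar>c u True\<bar>" by (cases "\<phi> u") auto
    qed
    then show ?thesis unfolding energy_def L_def by linarith
  qed
  obtain \<phi> :: "'a \<Rightarrow> bool" where "\<forall>\<phi>'. True \<longrightarrow> nat (energy \<phi> + L) \<le> nat (energy \<phi>' + L)"
    using ex_has_least_nat[of "\<lambda>_. True" undefined "\<lambda>\<phi>. nat (energy \<phi> + L)"] by blast
  then have le: "nat (energy \<phi> + L) \<le> nat (energy \<phi>' + L)" for \<phi>' by blast
  have "energy \<phi> \<le> energy \<phi>'" for \<phi>'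
    using le[of \<phi>'] lb[of \<phi>'] by (simp add: nat_le_eq_zle)
  then show ?thesis by blast
qed

lemma sum_load:
  assumes u: "u \<in> R"
  shows "(\<Sum>x\<in>R. load E R \<phi> x) = 2 * load E R \<phi> u + (\<Sum>x\<in>R - {u}. load E (R - {u}) \<phi> x)"
proof -
  have finR: "finite R" using fin by auto
  have split: "load E R \<phi> x = load E (R - {u}) \<phi> x + load E {u} \<phi> x" for x
    using load_Un[of "R - {u}" "{u}" E \<phi> x] finR u by (simp add: insert_absorb)
  have one: "load E {u} \<phi> x = (if {x, u} \<in> E \<and> X x (\<phi> x) u (\<phi> u) then 1 else 0)" for x
  proof -
    have "{v \<in> {u}. {x, v} \<in> E \<and> X x (\<phi> x) v (\<phi> v)} = (if {x, u} \<in> E \<and> X x (\<phi> x) u (\<phi> u) then {u} else {})" by auto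
    then show ?thesis by (simp add: load_def)
  qed
  have "(\<Sum>x\<in>R - {u}. load E {u} \<phi> x) = card {x \<in> R - {u}. {x, u} \<in> E \<and> X x (\<phi> x) u (\<phi> u)}"
    unfolding one using finR by (simp flip: sum.inter_filter)
  also have "\<dots> = load E R \<phi> u"
    unfolding load_def using no_loop X_sym by (intro arg_cong[where f = card]) (auto simp: insert_commute)
  finally have "(\<Sum>x\<in>R - {u}. load E R \<phi> x) = (\<Sum>x\<in>R - {u}. load E (R - {u}) \<phi> x) + load E R \<phi> u"
    by (simp add: split sum.distrib)
  then show ?thesis using finR u by (simp add: sum.remove[of R u])
qed

text \<open>Some node of \<open>v\<close> is not matched to the colour of its other neighbour, so
  both colours of \<open>u\<close> would have to spoil that same node.\<close>

lemma flip_blocked: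
  assumes u: "u \<in> R" and v: "v \<in> blocked \<phi>" "v \<in> blocked (\<phi>(u := \<not> \<phi> u))" "{u, v} \<in> E"
  shows False
proof -
  let ?\<phi> = "\<phi>(u := \<not> \<phi> u)"
  have vB: "v \<in> B" "{v, u} \<in> E" using v by (auto simp: blocked_def insert_commute)
  obtain y where y: "y \<noteq> u" "nbrs E v V = {u, y}" using B_other[OF vB(1) _ vB(2)] u by blast
  have only: "x = u \<or> x = y" if "x \<in> V" "{v, x} \<in> E" for x using y(2) that by (auto simp: nbrs_def)
  have h: "X v \<beta> u (\<phi> u) \<or> X v \<beta> y (\<phi> y)" for \<beta> using v(1) only by (fastforce simp: blocked_def)
  have h': "X v \<beta> u (\<not> \<phi> u) \<or> X v \<beta> y (\<phi> y)" for \<beta> using v(2) only y(1) by (fastforce simp: blocked_def)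
  obtain \<beta> where "\<not> X v \<beta> y (\<phi> y)" using X_avoid by blast
  then have "X v \<beta> u (\<phi> u)" "X v \<beta> u (\<not> \<phi> u)" using h h' by blast+
  then show False using X_fun by blast
qed

text \<open>Minimality compares \<open>u\<close> with its flip. A neighbour in \<open>R\<close>
  conflicts with at most one of the two colours of \<open>u\<close>, and by
  \<open>flip_blocked\<close> one in \<open>B\<close> is blocked for at most one of them; this
  eliminates the flipped quantities.\<close>

lemma flip_bound:
  assumes min: "\<And>\<phi>'. energy \<phi> \<le> energy \<phi>'" and u: "u \<in> R"
  shows "4 * int (load E R \<phi> u) + 2 * int (card {v \<in> blocked \<phi>. {u, v} \<in> E}) - 4 * c u (\<phi> u)
    \<le> 2 * int (card (nbrs E u R)) + int (card (nbrs E u B)) - 2 * (c u False + c u True)"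
proof -
  let ?\<phi> = "\<phi>(u := \<not> \<phi> u)"
  have finR: "finite R" using fin by auto
  have finbl: "finite (blocked \<psi>)" for \<psi> using finB by (auto simp: blocked_def)
  have "load E (R - {u}) ?\<phi> x = load E (R - {u}) \<phi> x" if "x \<in> R - {u}" for x
    by (rule load_cong) (use that in auto)
  then have L: "int (\<Sum>x\<in>R. load E R ?\<phi> x) - int (\<Sum>x\<in>R. load E R \<phi> x) = 2 * int (load E R ?\<phi> u) - 2 * int (load E R \<phi> u)"
    using sum_load[OF u, of \<phi>] sum_load[OF u, of ?\<phi>] by simp
  have l: "load E R \<phi> u + load E R ?\<phi> u \<le> card (nbrs E u R)"
  proof -
    have "load E R ?\<phi> u = card {v \<in> nbrs E u R. X u (\<not> \<phi> u) v (\<phi> v)}"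
      unfolding load_def using no_loop by (intro arg_cong[where f = card]) (auto simp: nbrs_def)
    moreover have "load E R \<phi> u = card {v \<in> nbrs E u R. X u (\<phi> u) v (\<phi> v)}"
      unfolding load_def by (intro arg_cong[where f = card]) (auto simp: nbrs_def)
    ultimately show ?thesis
      using card_conflicts[of "nbrs E u R" u \<phi>] finR by (cases "\<phi> u") auto
  qed
  let ?b = "\<lambda>\<psi>. card {v \<in> blocked \<psi>. {u, v} \<in> E}"
  have "card (blocked \<psi>) = ?b \<psi> + card {v \<in> blocked \<psi>. {u, v} \<notin> E}" for \<psi>
  proof -
    have "blocked \<psi> = {v \<in> blocked \<psi>. {u, v} \<in> E} \<union> {v \<in> blocked \<psi>. {u, v} \<notin> E}" by auto
    then have "card (blocked \<psi>) = card ({v \<in> blocked \<psi>. {u, v} \<in> E} \<union> {v \<in> blocked \<psi>. {u, v} \<notin> E})" by simp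
    also have "\<dots> = ?b \<psi> + card {v \<in> blocked \<psi>. {u, v} \<notin> E}"
      using finbl by (intro card_Un_disjoint) auto
    finally show ?thesis .
  qed
  moreover have "{v \<in> blocked ?\<phi>. {u, v} \<notin> E} = {v \<in> blocked \<phi>. {u, v} \<notin> E}"
    by (auto simp: blocked_def insert_commute)
  ultimately have B1: "int (card (blocked ?\<phi>)) - int (card (blocked \<phi>)) = int (?b ?\<phi>) - int (?b \<phi>)"
    by simp
  have b: "?b \<phi> + ?b ?\<phi> \<le> card (nbrs E u B)"
  proof -
    have "?b \<phi> + ?b ?\<phi> = card ({v \<in> blocked \<phi>. {u, v} \<in> E} \<union> {v \<in> blocked ?\<phi>. {u, v} \<in> E})"
      using finbl flip_blocked[OF u] by (intro card_Un_disjoint[symmetric]) auto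
    also have "\<dots> \<le> card (nbrs E u B)"
      using finB by (intro card_mono) (auto simp: blocked_def nbrs_def)
    finally show ?thesis .
  qed
  have C: "(\<Sum>x\<in>R. c x (?\<phi> x)) - (\<Sum>x\<in>R. c x (\<phi> x)) = c u (\<not> \<phi> u) - c u (\<phi> u)"
  proof -
    have "(\<Sum>x\<in>R - {u}. c x (?\<phi> x)) = (\<Sum>x\<in>R - {u}. c x (\<phi> x))" by (rule sum.cong) auto
    then show ?thesis using finR u by (simp add: sum.remove[of R u])
  qed
  have D: "c u (\<not> \<phi> u) = c u False + c u True - c u (\<phi> u)" by (cases "\<phi> u") auto
  have l': "int (load E R \<phi> u) + int (load E R ?\<phi> u) \<le> int (card (nbrs E u R))" using l by linarith
  have b': "int (?b \<phi>) + int (?b ?\<phi>) \<le> int (card (nbrs E u B))" using b by linarith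
  have "0 \<le> (2 * int (load E R ?\<phi> u) - 2 * int (load E R \<phi> u)) + (int (?b ?\<phi>) - int (?b \<phi>)) - 2 * (c u (\<not> \<phi> u) - c u (\<phi> u))"
    unfolding L[symmetric] B1[symmetric] C[symmetric] using min[of ?\<phi>] by (simp add: energy_def)
  then show ?thesis using l' b' D by (simp add: algebra_simps)
qed

text \<open>A blocked vertex may choose which of its two neighbours bears the conflict, so a failure to
  colour yields a set violating Hall's condition.\<close>
lemma Hall_violation:
  obtains Z where "Z \<subseteq> R"
    "(\<Sum>u\<in>Z. c u (\<phi> u) - int (load E R \<phi> u)) < int (card {v \<in> blocked \<phi>. pe v \<in> Z \<and> qe v \<in> Z})"
proof (rule ccontr)
  assume neg: "\<not> thesis"
  note violation = that
  have finR: "finite R" using fin by auto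
  have blB: "blocked \<phi> \<subseteq> B" by (auto simp: blocked_def)
  have "\<exists>t. (\<forall>v\<in>blocked \<phi>. t v = pe v \<or> t v = qe v) \<and>
    (\<forall>u\<in>R. int (card {v \<in> blocked \<phi>. t v = u}) \<le> c u (\<phi> u) - int (load E R \<phi> u))"
  proof (rule orientation_Hall)
    show "finite (blocked \<phi>)" using blB finB finite_subset by blast
    show "int (card {v \<in> blocked \<phi>. pe v \<in> Z \<and> qe v \<in> Z}) \<le> (\<Sum>u\<in>Z. c u (\<phi> u) - int (load E R \<phi> u))"
      if "Z \<subseteq> R" for Z using neg violation[OF that] by (meson not_le)
  qed (use finR ends blB in auto)
  then obtain t where t: "\<And>v. v \<in> blocked \<phi> \<Longrightarrow> t v = pe v \<or> t v = qe v"
    and tk: "\<And>u. u \<in> R \<Longrightarrow> int (card {v \<in> blocked \<phi>. t v = u}) \<le> c u (\<phi> u) - int (load E R \<phi> u)" by blast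
  \<comment> \<open>The end that does not bear the conflict; blocked vertices are coloured so as to
    avoid it.\<close>
  define oe where "oe v = (if t v = pe v then qe v else pe v)" for v
  have "\<exists>\<beta>. \<not> X v \<beta> (oe v) (\<phi> (oe v))" for v by (rule X_avoid)
  then obtain g where g: "\<And>v. \<not> X v (g v) (oe v) (\<phi> (oe v))" by metis
  have "\<exists>\<beta>. \<forall>x\<in>V. {v, x} \<in> E \<longrightarrow> \<not> X v \<beta> x (\<phi> x)" if "v \<in> B - blocked \<phi>" for v
    using that by (auto simp: blocked_def)
  then obtain h where h: "\<And>v x. v \<in> B - blocked \<phi> \<Longrightarrow> x \<in> V \<Longrightarrow> {v, x} \<in> E \<Longrightarrow> \<not> X v (h v) x (\<phi> x)"
    by metis
  define f where "f = (\<lambda>v. if v \<in> blocked \<phi> then g v else if v \<in> B then h v else \<phi> v)"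
  have fR: "f u = \<phi> u" if "u \<in> R" for u using that blB by (auto simp: f_def)
  have D: "V - R = B" using BV by auto
  show False
  proof (rule extend_general[of R f])
    show "R \<subseteq> V" by auto
  next
    fix u assume u: "u \<in> R"
    have "load E R f u = load E R \<phi> u" by (rule load_cong) (use u fR in auto)
    moreover have "load E B f u \<le> card {v \<in> blocked \<phi>. t v = u}"
      unfolding load_def
    proof (rule card_mono)
      show "finite {v \<in> blocked \<phi>. t v = u}" by (rule finite_subset[OF _ finB]) (use blB in auto)
      show "{v \<in> B. {u, v} \<in> E \<and> X u (f u) v (f v)} \<subseteq> {v \<in> blocked \<phi>. t v = u}"
      proof
        fix v assume "v \<in> {v \<in> B. {u, v} \<in> E \<and> X u (f u) v (f v)}"
        then have v: "v \<in> B" "{v, u} \<in> E" "X v (f v) u (\<phi> u)"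
          using X_sym fR[OF u] by (auto simp: insert_commute)
        have bl: "v \<in> blocked \<phi>"
        proof (rule ccontr)
          assume "v \<notin> blocked \<phi>"
          then show False using h[of v u] v u by (auto simp: f_def)
        qed
        then have "X v (g v) u (\<phi> u)" using v by (simp add: f_def)
        then have "u \<noteq> oe v" using g by blast
        moreover have "u \<in> nbrs E v V" using v u by (auto simp: nbrs_def)
        then have "u = pe v \<or> u = qe v" using ends(1)[OF v(1)] by simp
        ultimately have "t v = u" using t[OF bl] by (auto simp: oe_def split: if_splits)
        then show "v \<in> {v \<in> blocked \<phi>. t v = u}" using bl by simp
      qed
    qed
    ultimately show "int (load E R f u + load E (V - R) f u) \<le> c u (f u)"
      using tk[OF u] fR[OF u] D by simp
  next
    fix d assume "d \<in> V - R"
    then have d: "d \<in> B" using D by blast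
    have oe: "oe d \<in> R" "{d, oe d} \<in> E" using ends[OF d] by (auto simp: oe_def)
    have "\<not> X d (f d) (oe d) (f (oe d))"
      using g[of d] h[of d "oe d"] d oe fR[OF oe(1)] by (auto simp: f_def)
    then show "int (load E V f d) \<le> c d (f d)" using B_load[OF d _ oe(2)] oe by auto
  qed
qed

text \<open>Doubling splits an edge inside \<open>R\<close> between its ends. A vertex of
  \<open>B\<close> of full weight contributes \<open>2 * (2 * i + 1) - 4 * (i + 1) = - 2\<close>,
  charged as - 1 to each of its neighbours; the last sum accounts for smaller weights.\<close>

lemma pot_discharging:
  "2 * P V = (\<Sum>u\<in>R. 2 * wt i (c u) - (i + 1) * int (card (nbrs E u R)) - int (card (nbrs E u B)))
     - (\<Sum>v\<in>B. 2 * (2 * i + 1 - wt i (c v)))"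
proof -
  have finR: "finite R" using fin by auto
  have VRB: "V = R \<union> B" "R \<inter> B = {}" using BV by auto
  have e: "2 * int (card {e \<in> E. e \<subseteq> V}) = (\<Sum>v\<in>V. int (card (nbrs E v V)))"
    using handshake[OF fin E2] by (simp flip: of_nat_sum)
  also have "\<dots> = (\<Sum>v\<in>R. int (card (nbrs E v V))) + (\<Sum>v\<in>B. int (card (nbrs E v V)))"
    using sum.union_disjoint[OF finR finB VRB(2), of "\<lambda>v. int (card (nbrs E v V))"] VRB(1) by simp
  also have "(\<Sum>v\<in>B. int (card (nbrs E v V))) = 2 * int (card B)"
    using finB by (simp add: B_def)
  also have "(\<Sum>v\<in>R. int (card (nbrs E v V))) = (\<Sum>v\<in>R. int (card (nbrs E v R)) + int (card (nbrs E v B)))"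
  proof (rule sum.cong)
    fix v show "int (card (nbrs E v V)) = int (card (nbrs E v R)) + int (card (nbrs E v B))"
      using card_nbrs_Un[OF finR finB VRB(2), of E v] VRB(1) by simp
  qed simp
  finally have e': "2 * int (card {e \<in> E. e \<subseteq> V}) = (\<Sum>v\<in>R. int (card (nbrs E v R))) + (\<Sum>v\<in>R. int (card (nbrs E v B))) + 2 * int (card B)"
    by (simp add: sum.distrib)
  have "(\<Sum>v\<in>R. card (nbrs E v B)) = (\<Sum>v\<in>B. card {u \<in> R. {u, v} \<in> E})"
    unfolding nbrs_def using sum_card_swap[OF finB finR] .
  also have "\<dots> = (\<Sum>v\<in>B. 2)"
  proof (rule sum.cong)
    fix v assume v: "v \<in> B"
    have "{u \<in> R. {u, v} \<in> E} = nbrs E v V"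
      using ends(2,3)[OF v] ends(1)[OF v] by (auto simp: nbrs_def insert_commute)
    then show "card {u \<in> R. {u, v} \<in> E} = 2" using v by (simp add: B_def)
  qed simp
  finally have m: "(\<Sum>v\<in>R. int (card (nbrs E v B))) = 2 * int (card B)" by (simp flip: of_nat_sum)
  have "(\<Sum>v\<in>V. wt i (c v)) = (\<Sum>v\<in>R. wt i (c v)) + (\<Sum>v\<in>B. wt i (c v))"
    using sum.union_disjoint[OF finR finB VRB(2), of "\<lambda>v. wt i (c v)"] VRB(1) by simp
  then have "2 * P V = 2 * (\<Sum>v\<in>R. wt i (c v)) + 2 * (\<Sum>v\<in>B. wt i (c v)) - (i + 1) * (2 * int (card {e \<in> E. e \<subseteq> V}))"
    by (simp add: pot_def)
  then show ?thesis unfolding e' m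
    using m by (simp add: sum_subtractf sum.distrib algebra_simps flip: sum_distrib_left)
qed

lemma contradiction: False
proof -
  have finR: "finite R" using fin by auto
  obtain \<phi> where min: "\<And>\<phi>'. energy \<phi> \<le> energy \<phi>'" using ex_min_energy by blast
  obtain Z where Z: "Z \<subseteq> R"
    "(\<Sum>u\<in>Z. c u (\<phi> u) - int (load E R \<phi> u)) < int (card {v \<in> blocked \<phi>. pe v \<in> Z \<and> qe v \<in> Z})"
    by (rule Hall_violation)
  define G where "G = {v \<in> blocked \<phi>. pe v \<in> Z \<and> qe v \<in> Z}"
  have finZ: "finite Z" using Z finR finite_subset by blast
  have blB: "blocked \<phi> \<subseteq> B" by (auto simp: blocked_def)
  have finbl: "finite (blocked \<phi>)" using blB finB finite_subset by blast
  have "Z \<noteq> {}" using Z by auto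
  then obtain v0 where v0: "v0 \<in> Z" by blast
  have "2 * card G = (\<Sum>v\<in>G. 2)" by simp
  also have "\<dots> \<le> (\<Sum>v\<in>G. card {u \<in> Z. {u, v} \<in> E})"
  proof (rule sum_mono)
    fix v assume v: "v \<in> G"
    then have vB: "v \<in> B" using blB by (auto simp: G_def)
    have "card {pe v, qe v} \<le> card {u \<in> Z. {u, v} \<in> E}"
      using finZ v ends(5,6)[OF vB] by (intro card_mono) (auto simp: G_def insert_commute)
    then show "2 \<le> card {u \<in> Z. {u, v} \<in> E}" using ends(4)[OF vB] by simp
  qed
  also have "\<dots> \<le> (\<Sum>v\<in>blocked \<phi>. card {u \<in> Z. {u, v} \<in> E})"
    using finbl by (intro sum_mono2) (auto simp: G_def)
  also have "\<dots> = (\<Sum>u\<in>Z. card {v \<in> blocked \<phi>. {u, v} \<in> E})"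
    using sum_card_swap[OF finbl finZ, of "\<lambda>u v. {u, v} \<in> E"] by simp
  finally have G: "2 * int (card G) \<le> (\<Sum>u\<in>Z. int (card {v \<in> blocked \<phi>. {u, v} \<in> E}))"
    by (simp flip: of_nat_sum)
  have "(\<Sum>u\<in>Z. 4 * int (load E R \<phi> u) + 2 * int (card {v \<in> blocked \<phi>. {u, v} \<in> E}) - 4 * c u (\<phi> u))
      \<le> (\<Sum>u\<in>Z. 2 * int (card (nbrs E u R)) + int (card (nbrs E u B)) - 2 * (c u False + c u True))"
    by (rule sum_mono) (use flip_bound[OF min] Z in blast)
  moreover have "(\<Sum>u\<in>Z. 4 * int (load E R \<phi> u) + 2 * int (card {v \<in> blocked \<phi>. {u, v} \<in> E}) - 4 * c u (\<phi> u))
      = 2 * (\<Sum>u\<in>Z. int (card {v \<in> blocked \<phi>. {u, v} \<in> E})) - 4 * (\<Sum>u\<in>Z. c u (\<phi> u) - int (load E R \<phi> u))"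
    by (simp add: sum_subtractf sum.distrib sum_distrib_left)
  \<comment> \<open>The Hall deficit is an integer, hence at least 1, and each vertex of
    \<open>G\<close> is seen from both its ends; with the factors of \<open>flip_bound\<close> this
    gives 4.\<close>
  ultimately have H: "4 \<le> (\<Sum>u\<in>Z. 2 * int (card (nbrs E u R)) + int (card (nbrs E u B)) - 2 * (c u False + c u True))"
    using G Z(2) unfolding G_def[symmetric] by linarith
  let ?ch = "\<lambda>u. 2 * wt i (c u) - (i + 1) * int (card (nbrs E u R)) - int (card (nbrs E u B))"
  have "0 \<le> (\<Sum>v\<in>B. 2 * (2 * i + 1 - wt i (c v)))"
  proof (rule sum_nonneg)
    fix v assume "v \<in> B"
    then have "wt i (c v) \<le> 2 * i + 1" using wt_le_2i BV by blast
    then show "0 \<le> 2 * (2 * i + 1 - wt i (c v))" by simp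
  qed
  then have "2 * P V \<le> (\<Sum>u\<in>R. ?ch u)" using pot_discharging by linarith
  also have "\<dots> \<le> (\<Sum>u\<in>Z. ?ch u)"
  proof -
    have "(\<Sum>u\<in>R - Z. ?ch u) \<le> 0"
    proof (rule sum_nonpos)
      fix u assume "u \<in> R - Z"
      then show "?ch u \<le> 0" using star_bound[of u] by simp
    qed
    then show ?thesis using sum.subset_diff[OF Z(1) finR, of ?ch] by linarith
  qed
  \<comment> \<open>By definition of \<open>kap\<close>, twice the weight is twice the capacities
    plus \<open>2 * (1 - \<kappa> u)\<close>; what remains is the right-hand side of
    \<open>flip_bound\<close>. As every \<open>\<kappa> u\<close> is at least 1, all correction
    terms but that of \<open>v0\<close> can then be dropped.\<close>
  also have "\<dots> \<le> (\<Sum>u\<in>Z. 2 * (1 - \<kappa> u) - (2 * int (card (nbrs E u R)) + int (card (nbrs E u B)) - 2 * (c u False + c u True)))"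
  proof (rule sum_mono)
    fix u
    have "2 * int (card (nbrs E u R)) \<le> (i + 1) * int (card (nbrs E u R))"
      using i_pos by (intro mult_right_mono) auto
    then show "?ch u \<le> 2 * (1 - \<kappa> u) - (2 * int (card (nbrs E u R)) + int (card (nbrs E u B)) - 2 * (c u False + c u True))"
      by (simp add: kap_def)
  qed
  also have "\<dots> = (\<Sum>u\<in>Z. 2 * (1 - \<kappa> u)) - (\<Sum>u\<in>Z. 2 * int (card (nbrs E u R)) + int (card (nbrs E u B)) - 2 * (c u False + c u True))"
    by (rule sum_subtractf)
  also have "\<dots> \<le> (\<Sum>u\<in>Z. 2 * (1 - \<kappa> u)) - 4" using H by linarith
  also have "(\<Sum>u\<in>Z. 2 * (1 - \<kappa> u)) \<le> 2 * (1 - \<kappa> v0)"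
  proof -
    have "(\<Sum>u\<in>Z - {v0}. 2 * (1 - \<kappa> u)) \<le> 0"
    proof (rule sum_nonpos)
      fix u assume "u \<in> Z - {v0}"
      then have "i \<le> \<kappa> u" using kap_ge_i Z by auto
      then show "2 * (1 - \<kappa> u) \<le> 0" using i_pos by simp
    qed
    then show ?thesis using sum.remove[OF finZ v0, of "\<lambda>u. 2 * (1 - \<kappa> u)"] by linarith
  qed
  finally have "2 * P V \<le> 2 * (1 - \<kappa> v0) - 4" by simp
  then show False using P_kap[of v0] v0 Z by auto
qed

end

section \<open>Goodness implies colourability; the bound for critical sets\<close>

context dp_cover
begin

lemma good_imp_colorable:
  assumes "finite V" "\<forall>e\<in>E. card e = 2" "valid i V c" "good i E V c"
  shows "\<exists>f. col V E c f"
  using assms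
proof (induction "card V + card {e \<in> E. e \<subseteq> V}" arbitrary: V E c rule: less_induct)
  case less
  show ?case
  proof (rule ccontr)
    assume "\<not> ?case"
    then interpret min_counterexample X i V E c
      using less by unfold_locales auto
    show False by (rule contradiction)
  qed
qed

text \<open>\<open>pot_gap\<close>, now supplied by \<open>good_imp_colorable\<close>, carries a
  violation from \<open>S\<close> to \<open>V\<close>: the potential only drops, and the same
  \<open>v\<close> serves.\<close>

lemma critical_bound:
  assumes "finite V" "\<forall>e\<in>E. card e = 2" "valid i V c" "\<nexists>f. col V E c f"
    and sub: "\<And>S. S \<subset> V \<Longrightarrow> \<exists>f. col S E c f"
  shows "\<exists>v\<in>V. pot i E c V + kap i (c v) < 0"
proof -
  have main: "\<exists>f. col V' E c' f" if "V' \<subset> V" "valid i V' c'" "good i E V' c'" for V' c'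
    using good_imp_colorable[OF _ assms(2) that(2,3)] assms(1) that(1) finite_subset by blast
  have "\<not> good i E V c" using good_imp_colorable assms by blast
  then obtain S v where S: "S \<subseteq> V" "v \<in> S" "pot i E c S + kap i (c v) < 0" by (auto simp: good_def not_le)
  show ?thesis
  proof (cases "S = V")
    case False
    then have "S \<noteq> {}" "S \<subset> V" using S by auto
    then have "pot i E c V + 1 \<le> pot i E c S" using pot_gap[OF assms(1-4) sub main] by blast
    then show ?thesis using S by (intro bexI[of _ v]) auto
  qed (use S in blast)
qed

end

section \<open>From covers to the abstract setting\<close>

definition node :: "('a, 'b) cover \<Rightarrow> 'a \<Rightarrow> bool \<Rightarrow> 'b" where
  "node C u \<beta> = (if \<beta> then rich C u else poor C u)"

definition caps :: "('a \<Rightarrow> int \<times> int) \<Rightarrow> 'a \<Rightarrow> bool \<Rightarrow> int" where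
  "caps c u \<beta> = (if \<beta> then snd (c u) else fst (c u))"

definition conflict :: "'a ugraph \<Rightarrow> ('a, 'b) cover \<Rightarrow> 'a \<Rightarrow> bool \<Rightarrow> 'a \<Rightarrow> bool \<Rightarrow> bool" where
  "conflict G C u \<alpha> v \<beta> \<longleftrightarrow> u \<in> verts G \<and> v \<in> verts G \<and> u \<noteq> v \<and> {node C u \<alpha>, node C v \<beta>} \<in> edges (host C)"

text \<open>Only the host is cut down: \<open>cover_of\<close> consults the fibres and labels just
  at the vertices of the graph.\<close>

definition restrict_cover :: "('a, 'b) cover \<Rightarrow> 'a set \<Rightarrow> ('a, 'b) cover" where
  "restrict_cover C S = C\<lparr>host := induced (host C) (\<Union>u\<in>S. fibre C u)\<rparr>"

lemma coverD:
  assumes "cover_of G C"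
  shows "simple_graph (host C)" "(\<Union>u\<in>verts G. fibre C u) = verts (host C)"
    "disjoint_family_on (fibre C) (verts G)"
    "u \<in> verts G \<Longrightarrow> card (fibre C u) = 2" "u \<in> verts G \<Longrightarrow> fibre C u = {poor C u, rich C u}"
    "u \<in> verts G \<Longrightarrow> complete_graph (induced (host C) (fibre C u))"
    "u \<in> verts G \<Longrightarrow> v \<in> verts G \<Longrightarrow> edges_between (host C) (fibre C u) (fibre C v) \<noteq> {} \<Longrightarrow> u = v \<or> {u, v} \<in> edges G"
    "u \<in> verts G \<Longrightarrow> v \<in> verts G \<Longrightarrow> {u, v} \<in> edges G \<Longrightarrow> is_matching (edges_between (host C) (fibre C u) (fibre C v))"
proof -
  show "simple_graph (host C)" using assms unfolding cover_of_def by (elim conjE)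
  show "(\<Union>u\<in>verts G. fibre C u) = verts (host C)" using assms unfolding cover_of_def by (elim conjE)
  show "disjoint_family_on (fibre C) (verts G)" using assms unfolding cover_of_def by (elim conjE)
  have "\<forall>u\<in>verts G. card (fibre C u) = 2 \<and> fibre C u = {poor C u, rich C u}"
    using assms unfolding cover_of_def by (elim conjE)
  then show "u \<in> verts G \<Longrightarrow> card (fibre C u) = 2" "u \<in> verts G \<Longrightarrow> fibre C u = {poor C u, rich C u}"
    by blast+
  have "\<forall>u\<in>verts G. complete_graph (induced (host C) (fibre C u))"
    using assms unfolding cover_of_def by (elim conjE)
  then show "u \<in> verts G \<Longrightarrow> complete_graph (induced (host C) (fibre C u))" by blast
  have "\<forall>u\<in>verts G. \<forall>v\<in>verts G.
      edges_between (host C) (fibre C u) (fibre C v) \<noteq> {} \<longrightarrow> u = v \<or> {u, v} \<in> edges G"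
    using assms unfolding cover_of_def by (elim conjE)
  then show "u \<in> verts G \<Longrightarrow> v \<in> verts G \<Longrightarrow> edges_between (host C) (fibre C u) (fibre C v) \<noteq> {}
      \<Longrightarrow> u = v \<or> {u, v} \<in> edges G" by blast
  have "\<forall>u\<in>verts G. \<forall>v\<in>verts G. {u, v} \<in> edges G \<longrightarrow>
      is_matching (edges_between (host C) (fibre C u) (fibre C v))"
    using assms unfolding cover_of_def by (elim conjE)
  then show "u \<in> verts G \<Longrightarrow> v \<in> verts G \<Longrightarrow> {u, v} \<in> edges G
      \<Longrightarrow> is_matching (edges_between (host C) (fibre C u) (fibre C v))" by blast
qed

lemma node_in_fibre: "cover_of G C \<Longrightarrow> u \<in> verts G \<Longrightarrow> node C u \<beta> \<in> fibre C u"
  using coverD(5) by (fastforce simp: node_def)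

lemma fibre_node:
  assumes "cover_of G C" "u \<in> verts G" "x \<in> fibre C u"
  shows "x = node C u (x = rich C u)"
  using coverD(5)[OF assms(1,2)] assms(3) by (auto simp: node_def)

lemma node_eq_iff:
  assumes "cover_of G C" "u \<in> verts G" "v \<in> verts G"
  shows "node C u \<alpha> = node C v \<beta> \<longleftrightarrow> u = v \<and> \<alpha> = \<beta>"
proof
  assume eq: "node C u \<alpha> = node C v \<beta>"
  have uv: "u = v"
  proof (rule ccontr)
    assume "u \<noteq> v"
    then have "fibre C u \<inter> fibre C v = {}"
      using coverD(3)[OF assms(1)] assms by (auto simp: disjoint_family_on_def)
    then show False
      using node_in_fibre[OF assms(1,2), of \<alpha>] node_in_fibre[OF assms(1,3), of \<beta>] eq by auto
  qed
  have "poor C u \<noteq> rich C u" using coverD(4,5)[OF assms(1,2)] by auto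
  then show "u = v \<and> \<alpha> = \<beta>" using eq uv by (auto simp: node_def split: if_splits)
qed auto

lemma conflict_edge:
  assumes "cover_of G C" "conflict G C u \<alpha> v \<beta>"
  shows "{u, v} \<in> edges G" "{node C u \<alpha>, node C v \<beta>} \<in> edges_between (host C) (fibre C u) (fibre C v)"
proof -
  have c: "u \<in> verts G" "v \<in> verts G" "u \<noteq> v" "{node C u \<alpha>, node C v \<beta>} \<in> edges (host C)"
    using assms by (auto simp: conflict_def)
  then show e: "{node C u \<alpha>, node C v \<beta>} \<in> edges_between (host C) (fibre C u) (fibre C v)"
    using node_in_fibre[OF assms(1)] unfolding edges_between_def by blast
  then show "{u, v} \<in> edges G" using coverD(7)[OF assms(1) c(1,2)] c(3) by blast
qed

lemma dp_cover_conflict: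
  fixes i :: int
  assumes C: "cover_of G C" and i: "i = 1 \<or> i = 2"
  shows "dp_cover (conflict G C) i"
proof
  show "conflict G C v \<beta> u \<alpha>" if "conflict G C u \<alpha> v \<beta>" for u \<alpha> v \<beta>
    using that by (auto simp: conflict_def insert_commute)
  show "\<beta> = \<beta>'" if x: "conflict G C u \<alpha> v \<beta>" "conflict G C u \<alpha> v \<beta>'" for u \<alpha> v \<beta> \<beta>'
  proof -
    have uv: "u \<in> verts G" "v \<in> verts G" "u \<noteq> v" using x by (auto simp: conflict_def)
    let ?e = "{node C u \<alpha>, node C v \<beta>}" and ?e' = "{node C u \<alpha>, node C v \<beta>'}"
    have "is_matching (edges_between (host C) (fibre C u) (fibre C v))"
      using coverD(8)[OF C uv(1,2)] conflict_edge(1)[OF C x(1)] by blast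
    then have M: "disjoint (edges_between (host C) (fibre C u) (fibre C v))" by (simp add: is_matching_def)
    have "?e = ?e'"
    proof (rule ccontr)
      assume "?e \<noteq> ?e'"
      then have "?e \<inter> ?e' = {}"
        by (rule disjointD[OF M conflict_edge(2)[OF C x(1)] conflict_edge(2)[OF C x(2)]])
      then show False by simp
    qed
    then have "node C v \<beta> = node C v \<beta>'" by (auto simp: doubleton_eq_iff)
    then show ?thesis using node_eq_iff[OF C uv(2,2)] by blast
  qed
qed (rule i)

text \<open>A map chooses one node in each fibre, so the edges at the node of \<open>u\<close> lead
  to other fibres and correspond to the conflicting neighbours of \<open>u\<close>.\<close>

lemma degree_eq_load:
  fixes i :: int
  assumes C: "cover_of G C" and i: "i = 1 \<or> i = 2" and S: "S \<subseteq> verts G" and u: "u \<in> S"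
    and \<phi>: "\<And>v. v \<in> S \<Longrightarrow> \<phi> v = node C v (f v)"
  shows "card {e \<in> edges (host C). e \<subseteq> \<phi> ` S \<and> \<phi> u \<in> e} = dp_cover.load (conflict G C) (edges G) S f u"
proof -
  interpret dp_cover "conflict G C" i by (rule dp_cover_conflict[OF C i])
  let ?A = "{v \<in> S. {u, v} \<in> edges G \<and> conflict G C u (f u) v (f v)}"
  have inj: "v = w" if "v \<in> S" "w \<in> S" "\<phi> v = \<phi> w" for v w
    using that \<phi> node_eq_iff[OF C, of v w] S by auto
  have "{e \<in> edges (host C). e \<subseteq> \<phi> ` S \<and> \<phi> u \<in> e} = (\<lambda>v. {\<phi> u, \<phi> v}) ` ?A"
  proof (intro equalityI subsetI)
    fix e assume e: "e \<in> {e \<in> edges (host C). e \<subseteq> \<phi> ` S \<and> \<phi> u \<in> e}"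
    then have "card e = 2" using coverD(1)[OF C] by (auto simp: simple_graph_def)
    then obtain y where y: "e = {\<phi> u, y}" "y \<noteq> \<phi> u"
      using e by (auto simp: card_2_iff insert_commute)
    then obtain v where v: "v \<in> S" "y = \<phi> v" using e by auto
    have "conflict G C u (f u) v (f v)"
      using e y v u S \<phi>[OF u] \<phi>[OF v(1)] by (auto simp: conflict_def)
    then have "v \<in> ?A" using v conflict_edge(1)[OF C] by blast
    then show "e \<in> (\<lambda>v. {\<phi> u, \<phi> v}) ` ?A" using y v by blast
  next
    fix e assume "e \<in> (\<lambda>v. {\<phi> u, \<phi> v}) ` ?A"
    then obtain v where "v \<in> ?A" "e = {\<phi> u, \<phi> v}" by blast
    then show "e \<in> {e \<in> edges (host C). e \<subseteq> \<phi> ` S \<and> \<phi> u \<in> e}"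
      using u \<phi> by (auto simp: conflict_def)
  qed
  moreover have "inj_on (\<lambda>v. {\<phi> u, \<phi> v}) ?A"
    using inj by (auto simp: inj_on_def doubleton_eq_iff)
  ultimately show ?thesis by (simp add: card_image load_def)
qed

lemma col_imp_coloring:
  fixes i :: int
  assumes C: "cover_of G C" and i: "i = 1 \<or> i = 2"
    and col: "dp_cover.col (conflict G C) (verts G) (edges G) (caps c) f"
  shows "coloring G c C (\<lambda>u. node C u (f u))"
proof -
  interpret dp_cover "conflict G C" i by (rule dp_cover_conflict[OF C i])
  let ?\<phi> = "\<lambda>u. node C u (f u)"
  have deg: "int (degree (map_graph G C ?\<phi>) (?\<phi> u)) \<le> caps c u (f u)" if u: "u \<in> verts G" for u
    using degree_eq_load[OF C i order_refl u, of ?\<phi> f] col u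
    by (simp add: degree_def map_graph_def induced_def col_def conj_assoc)
  have p: "poor C u = node C u False" "rich C u = node C u True" for u by (auto simp: node_def)
  show ?thesis unfolding coloring_def cover_map_def
  proof (intro conjI ballI impI)
    fix u assume u: "u \<in> verts G"
    show "?\<phi> u \<in> fibre C u" by (rule node_in_fibre[OF C u])
    show "int (degree (map_graph G C ?\<phi>) (poor C u)) \<le> fst (c u)" if "?\<phi> u = poor C u"
      using deg[OF u] that node_eq_iff[OF C u u, of "f u" False] by (simp add: p caps_def)
    show "int (degree (map_graph G C ?\<phi>) (rich C u)) \<le> snd (c u)" if "?\<phi> u = rich C u"
      using deg[OF u] that node_eq_iff[OF C u u, of "f u" True] by (simp add: p caps_def)
  qed
qed

lemma restrict_cover_of:
  assumes C: "cover_of G C" and S: "S \<subseteq> verts G"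
  shows "cover_of (induced G S) (restrict_cover C S)"
proof -
  let ?D = "restrict_cover C S"
  have V: "verts (induced G S) = S" using S by (auto simp: induced_def)
  have [simp]: "fibre ?D = fibre C" "poor ?D = poor C" "rich ?D = rich C"
    by (auto simp: restrict_cover_def)
  have host: "verts (host ?D) = verts (host C) \<inter> (\<Union>u\<in>S. fibre C u)"
    "edges (host ?D) = {e \<in> edges (host C). e \<subseteq> (\<Union>u\<in>S. fibre C u)}"
    by (auto simp: restrict_cover_def induced_def)
  have sub: "fibre C u \<subseteq> (\<Union>u\<in>S. fibre C u)" if "u \<in> S" for u using that by blast
  have eb: "edges_between (host ?D) (fibre C u) (fibre C v) = edges_between (host C) (fibre C u) (fibre C v)"
    if "u \<in> S" "v \<in> S" for u v
    using sub[OF that(1)] sub[OF that(2)] by (auto simp: edges_between_def host)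
  show ?thesis unfolding cover_of_def V
  proof (intro conjI ballI impI)
    show "simple_graph (host ?D)"
      using coverD(1)[OF C] by (auto simp: simple_graph_def host)
    show "(\<Union>u\<in>S. fibre ?D u) = verts (host ?D)"
      using coverD(2)[OF C] S by (auto simp: host)
    show "disjoint_family_on (fibre ?D) S"
      using coverD(3)[OF C] S by (auto simp: disjoint_family_on_def)
  next
    fix u assume u: "u \<in> S"
    then have uG: "u \<in> verts G" using S by auto
    show "card (fibre ?D u) = 2" "fibre ?D u = {poor ?D u, rich ?D u}"
      using coverD(4,5)[OF C uG] by simp_all
    show "complete_graph (induced (host ?D) (fibre ?D u))"
      using coverD(6)[OF C uG] sub[OF u] by (auto simp: complete_graph_def induced_def host)
    fix v assume v: "v \<in> S"
    then have vG: "v \<in> verts G" using S by auto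
    show "u = v \<or> {u, v} \<in> edges (induced G S)" if "edges_between (host ?D) (fibre ?D u) (fibre ?D v) \<noteq> {}"
      using coverD(7)[OF C uG vG] that eb[OF u v] u v by (auto simp: induced_def)
    show "is_matching (edges_between (host ?D) (fibre ?D u) (fibre ?D v))" if "{u, v} \<in> edges (induced G S)"
      using coverD(8)[OF C uG vG] that eb[OF u v] by (auto simp: induced_def)
  qed
qed

lemma coloring_imp_col:
  fixes i :: int
  assumes C: "cover_of G C" and i: "i = 1 \<or> i = 2" and S: "S \<subseteq> verts G"
    and \<phi>: "coloring (induced G S) c (restrict_cover C S) \<phi>"
  shows "dp_cover.col (conflict G C) S (edges G) (caps c) (\<lambda>u. \<phi> u = rich C u)"
proof -
  interpret dp_cover "conflict G C" i by (rule dp_cover_conflict[OF C i])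
  let ?f = "\<lambda>u. \<phi> u = rich C u" and ?D = "restrict_cover C S"
  have V: "verts (induced G S) = S" using S by (auto simp: induced_def)
  have D: "fibre ?D = fibre C" "poor ?D = poor C" "rich ?D = rich C"
    by (auto simp: restrict_cover_def)
  have fib: "\<phi> u \<in> fibre C u" if "u \<in> S" for u
    using \<phi> that unfolding coloring_def cover_map_def V D by blast
  have node: "\<phi> u = node C u (?f u)" if "u \<in> S" for u
    using fibre_node[OF C _ fib[OF that]] S that by blast
  have "\<phi> ` S \<subseteq> (\<Union>u\<in>S. fibre C u)" using fib by blast
  then have "{e \<in> edges (map_graph (induced G S) ?D \<phi>). x \<in> e} = {e \<in> edges (host C). e \<subseteq> \<phi> ` S \<and> x \<in> e}" for x
    unfolding map_graph_def V by (auto simp: induced_def restrict_cover_def)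
  then have deg: "degree (map_graph (induced G S) ?D \<phi>) (\<phi> u) = load (edges G) S ?f u" if "u \<in> S" for u
    using degree_eq_load[OF C i S that, of \<phi> ?f] node by (simp add: degree_def)
  show ?thesis unfolding col_def
  proof
    fix u assume u: "u \<in> S"
    have "\<phi> u = poor C u \<or> \<phi> u = rich C u" using fib[OF u] coverD(5)[OF C] S u by auto
    then show "int (load (edges G) S ?f u) \<le> caps c u (?f u)"
      using \<phi> u deg[OF u] unfolding coloring_def V D by (auto simp: caps_def)
  qed
qed

theorem theorem3p1:
  fixes i j :: int and G :: "'a ugraph" and c :: "'a \<Rightarrow> int \<times> int"
  assumes "i \<in> {1, 2}" and "j \<ge> 2 * i"
    and "simple_graph G"
    and "capacity i j G c"
    and "critical G c"
  shows "potential i j G c \<le> i - j - 1"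
proof -
  let ?V = "verts G" and ?E = "edges G"
  have i: "i = 1 \<or> i = 2" using assms(1) by auto
  have fin: "finite ?V" and E2: "\<forall>e\<in>?E. card e = 2" and EV: "\<And>e. e \<in> ?E \<Longrightarrow> e \<subseteq> ?V"
    using assms(3) by (auto simp: simple_graph_def)
  have cap: "- 1 \<le> fst (c v)" "fst (c v) \<le> i" "- 1 \<le> snd (c v)" "snd (c v) \<le> j" if "v \<in> ?V" for v
    using assms(4) that by (auto simp: capacity_def mem_Times_iff)
  obtain C :: "('a, nat) cover" where C: "cover_of G C" and nc: "\<nexists>\<phi>. coloring G c C \<phi>"
    using assms(5) by (auto simp: critical_def colorable_def)
  interpret dp_cover "conflict G C" i by (rule dp_cover_conflict[OF C i])
  have "\<exists>f. col S ?E (caps c) f" if S: "S \<subset> ?V" for S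
  proof -
    have "verts (induced G S) = S" using S by (auto simp: induced_def)
    then have "induced G S \<noteq> G" using S by auto
    moreover have "simple_graph (induced G S)"
      using assms(3) by (auto simp: simple_graph_def induced_def)
    ultimately have "proper_subgraph (induced G S) G"
      by (auto simp: proper_subgraph_def induced_def)
    then have "colorable (induced G S) c" using assms(5) by (auto simp: critical_def)
    then obtain \<phi> where "coloring (induced G S) c (restrict_cover C S) \<phi>"
      using restrict_cover_of[OF C, of S] S by (auto simp: colorable_def)
    then show ?thesis using coloring_imp_col[OF C i, of S] S by blast
  qed
  moreover have "\<nexists>f. col ?V ?E (caps c) f" using col_imp_coloring[OF C i] nc by blast
  moreover have "valid i ?V (caps c)" using cap by (auto simp: valid_def caps_def)
  ultimately obtain v where v: "v \<in> ?V" "pot i ?E (caps c) ?V + kap i (caps c v) < 0"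
    using critical_bound[OF fin E2] by blast
  have \<rho>: "i - j + 1 + fst (c u) + snd (c u) = wt i (caps c u) - (j - i - kap i (caps c u))" for u
    by (simp add: kap_def caps_def)
  \<comment> \<open>Here \<open>j \<ge> 2 * i\<close> enters: with both nodes usable,
    \<open>kap\<close> is the larger of \<open>i\<close> and \<open>b - i\<close>, where
    \<open>b \<le> j\<close>.\<close>
  have nn: "0 \<le> j - i - kap i (caps c u)" if "u \<in> ?V" for u
    using cap[OF that] assms(2) i by (auto simp: kap_def wt_def caps_def min_def)
  have "j - i - kap i (caps c v) \<le> (\<Sum>u\<in>?V. j - i - kap i (caps c u))"
    by (rule member_le_sum[OF v(1) _ fin]) (use nn in auto)
  moreover have "{e \<in> ?E. e \<subseteq> ?V} = ?E" using EV by auto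
  then have "potential i j G c = pot i ?E (caps c) ?V - (\<Sum>u\<in>?V. j - i - kap i (caps c u))"
    unfolding potential_def pot_def \<rho> by (simp add: sum_subtractf)
  ultimately show ?thesis using v(2) by linarith
qed

end
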